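(* Let $\overrightarrow{\Xi}^{(0)}$ be a unit-intensity renewal process on $\mathbb{R}$ whose inter-renewal distribution has finite variance, and let $(\overrightarrow{\Xi}^{(t)})_{t\ge 0}$ be the clustering dynamics started from $\overrightarrow{\Xi}^{(0)}$ (each point moves halfway towards its left or right neighbor, chosen uniformly at random and independently; co-located points merge; space is rescaled by $\frac34$). Then there is a point process $\overrightarrow{\Xi}^{(\infty)}$, whose law does not depend on $\overrightarrow{\Xi}^{(0)}$, such that $$\overrightarrow{\Xi}^{(t)}\to\overrightarrow{\Xi}^{(\infty)}\quad\text{in finite-dimensional distributions as } t\to\infty .$$ Moreover, if $\Theta$ denotes the Palm shift, then $\Theta\overrightarrow{\Xi}^{(t)}\Rightarrow\Theta\overrightarrow{\Xi}^{(\infty)}$ (weak convergence). Finally, the gap distribution of $\overrightarrow{\Xi}^{(\infty)}$, i.e. the law of $\overrightarrow{\Xi}^{(\infty)}_{1}-\overrightarrow{\Xi}^{(\infty)}_{0}$, has an exponentially decaying tail.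
   Context: A point process on $\mathbb{R}$ is a (possibly random) countable collection of points, viewed as a non-decreasing element $\Xi=(\Xi_i)_{i\in\mathbb{Z}}$ of $\mathbb{R}^{\mathbb{Z}}$. It is simple if almost surely no location carries more than one point. A simple point process is renewal if the gaps between successive points are i.i.d. It is stationary if the distributions of the number of points in any two sets of equal finite Lebesgue measure are equal; its intensity is $\lim_{t\to\pm\infty}\mathbb{E}N(t)/t$, where $N(t)$ is the number of points in $(0,t]$. The Palm-shifted process $\Theta\Xi$ is obtained by shifting all points of $\Xi$ so that the $0$-indexed point is at the origin. Dynamics: the initial process $\overrightarrow{\Xi}^{(0)}$ is a unit-intensity stationary point process on $\mathbb{R}$ (not required to have a point at the origin). Given $\overrightarrow{\Xi}^{(t)}$, each point moves halfway towards one of its two neighbors (left or right), chosen uniformly at random and independently of the other points' movements. If two points move to the same location they merge into one point; the result $\hat\Xi^{(t+1)}$ is a simple stationary point process of intensity $\frac34$. Then $\overrightarrow{\Xi}^{(t+1)}:=\frac34\times\hat\Xi^{(t+1)}$, where $c\times\Xi:=(c\,\Xi_i)_{i\in\mathbb{Z}}$, so that $\overrightarrow{\Xi}^{(t+1)}$ has unit intensity. Points are indexed by $\mathbb{Z}$ in increasing order, and the gaps $\overrightarrow{\Xi}^{(t)}_{i+1}-\overrightarrow{\Xi}^{(t)}_i$, $i\in\mathbb{Z}$, are identically distributed (generally not independent). An exponentially decaying tail of a nonnegative random variable $Z$ means that there are constants $C,c>0$ with $\mathbb{P}(Z>x)\le Ce^{-cx}$ for all $x\ge 0$. *)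

theory Defs
  imports "HOL-Probability.Probability"
begin

text \<open>
  Realisations of a point process are sequences of type \<^typ>\<open>int \<Rightarrow> real\<close>, with the product topology and
  its Borel sigma-algebra, which equals the product sigma-algebra (theorem
  \<open>sets_PiM_equal_borel\<close>). Everything below depends on a point process only through its law, so a
  point process is given by its law \<open>P\<close>, the law of the coordinate sequence \<open>x\<close>. The points are
  numbered in increasing order, \<open>x 1\<close> being the first point to the right of the origin.
\<close>

definition point_process :: "(int \<Rightarrow> real) measure \<Rightarrow> bool" where
  "point_process P \<longleftrightarrow> prob_space P \<and> sets P = sets borel \<and>
     (AE x in P. mono x \<and> x 0 \<le> 0 \<and> 0 < x 1)"

definition simple :: "(int \<Rightarrow> real) measure \<Rightarrow> bool" where
  "simple P \<longleftrightarrow> (AE x in P. inj x)"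

definition npoints :: "real set \<Rightarrow> (int \<Rightarrow> real) \<Rightarrow> ennreal" where
  "npoints B x = emeasure (count_space UNIV) {i. x i \<in> B}"

definition stationary :: "(int \<Rightarrow> real) measure \<Rightarrow> bool" where
  "stationary P \<longleftrightarrow> (\<forall>(s::real) (B :: nat \<Rightarrow> real set). (\<forall>j. B j \<in> sets borel) \<longrightarrow>
     distr P (borel :: (nat \<Rightarrow> ennreal) measure) (\<lambda>x j. npoints ((+) s ` B j) x) =
     distr P borel (\<lambda>x j. npoints (B j) x))"

text \<open>For \<open>t < 0\<close> the count \<open>N(t)\<close> is minus the number of points in \<open>(t, 0]\<close>.\<close>

definition counting :: "real \<Rightarrow> (int \<Rightarrow> real) \<Rightarrow> real" where
  "counting t x =
     (if 0 \<le> t then enn2real (npoints {0<..t} x) else - enn2real (npoints {t<..0} x))"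

text \<open>
  The mean counts are taken in \<^typ>\<open>ennreal\<close>, so that a process with infinite mean counts has no
  real intensity; the second limit is that of \<open>E N(t) / t\<close> as \<open>t\<close> tends to minus infinity.
\<close>

definition has_intensity :: "(int \<Rightarrow> real) measure \<Rightarrow> real \<Rightarrow> bool" where
  "has_intensity P r \<longleftrightarrow>
     ((\<lambda>t. (\<integral>\<^sup>+x. npoints {0<..t} x \<partial>P) / ennreal t) \<longlongrightarrow> ennreal r) at_top \<and>
     ((\<lambda>t. (\<integral>\<^sup>+x. npoints {t<..0} x \<partial>P) / ennreal (- t)) \<longlongrightarrow> ennreal r) at_bot"

definition shift_to_origin :: "(int \<Rightarrow> real) \<Rightarrow> int \<Rightarrow> real" where
  "shift_to_origin x = (\<lambda>j. x j - x 0)"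

text \<open>
  The law of the Palm-shifted process: a typical point is given the index 0 and moved to the
  origin. Typical means chosen according to the counting measure on the points in a
  unit interval,
    \<open>palm P A = E (card {i. 0 < x i \<le> 1 \<and> shift_to_origin (\<lambda>j. x (i + j)) \<in> A}) / E (card {i. 0 < x i \<le> 1})\<close>.
  Under this law the gaps \<open>x (i + 1) - x i\<close> of a stationary process are identically distributed.
  In the numbering by position the gap from \<open>x 0\<close> to \<open>x 1\<close> is the one that covers the
  origin, which is size-biased; statements about the gaps of a stationary process are therefore
  statements about \<open>palm P\<close>.
\<close>

definition palm :: "(int \<Rightarrow> real) measure \<Rightarrow> (int \<Rightarrow> real) measure" where
  "palm P = distr
     (density (P \<Otimes>\<^sub>M count_space (UNIV :: int set))
       (\<lambda>(x, i). indicator {0<..1} (x i) / (\<integral>\<^sup>+y. npoints {0<..1} y \<partial>P)))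
     borel (\<lambda>(x, i). shift_to_origin (\<lambda>j. x (i + j)))"

definition gap :: "int \<Rightarrow> (int \<Rightarrow> real) \<Rightarrow> real" where
  "gap i x = x (i + 1) - x i"

definition renewal :: "(int \<Rightarrow> real) measure \<Rightarrow> bool" where
  "renewal P \<longleftrightarrow> simple P \<and>
     prob_space.indep_vars (palm P) (\<lambda>_. borel) gap UNIV \<and>
     (\<forall>i. distr (palm P) borel (gap i) = distr (palm P) borel (gap 0))"

text \<open>
  One step of the dynamics. The point with index \<open>i\<close> moves to the right if \<open>m i\<close> holds, otherwise
  to the left. Passing to the range of the moved sequence merges co-located points.
\<close>

definition half_move :: "(int \<Rightarrow> bool) \<Rightarrow> (int \<Rightarrow> real) \<Rightarrow> int \<Rightarrow> real" where
  "half_move m x i = (x i + x (if m i then i + 1 else i - 1)) / 2"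

definition enumerate_points :: "real set \<Rightarrow> int \<Rightarrow> real" where
  "enumerate_points S = (THE y. strict_mono y \<and> range y = S \<and> y 0 \<le> 0 \<and> 0 < y 1)"

definition cluster_step :: "(int \<Rightarrow> bool) \<Rightarrow> (int \<Rightarrow> real) \<Rightarrow> int \<Rightarrow> real" where
  "cluster_step m x = (\<lambda>i. 3 / 4 * enumerate_points (range (half_move m x)) i)"

primrec clustering :: "(int \<Rightarrow> real) \<Rightarrow> (nat \<times> int \<Rightarrow> bool) \<Rightarrow> nat \<Rightarrow> int \<Rightarrow> real" where
  "clustering x m 0 = x"
| "clustering x m (Suc t) = cluster_step (\<lambda>i. m (t, i)) (clustering x m t)"

definition fair_moves :: "(nat \<times> int \<Rightarrow> bool) measure" where
  "fair_moves = PiM UNIV (\<lambda>_. measure_pmf (bernoulli_pmf (1 / 2)))"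

definition clustering_law :: "(int \<Rightarrow> real) measure \<Rightarrow> nat \<Rightarrow> (int \<Rightarrow> real) measure" where
  "clustering_law P t = distr (P \<Otimes>\<^sub>M fair_moves) borel (\<lambda>(x, m). clustering x m t)"

definition weakly_converges ::
    "(nat \<Rightarrow> 'a::topological_space measure) \<Rightarrow> 'a measure \<Rightarrow> bool" where
  "weakly_converges \<mu> \<nu> \<longleftrightarrow> (\<forall>f :: 'a \<Rightarrow> real. continuous_on UNIV f \<longrightarrow> bounded (range f) \<longrightarrow>
     (\<lambda>n. integral\<^sup>L (\<mu> n) f) \<longlonglongrightarrow> integral\<^sup>L \<nu> f)"

text \<open>
  Both usual meanings of the finite-dimensional distributions of a point process are covered:
  the joint laws of finitely many coordinates \<open>x i\<close>, and the joint laws of finitely many values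
  \<open>N(s)\<close> of the counting process. Outside its index set \<^const>\<open>restrict\<close> is constant, so the
  convergence is that of finite random vectors.
\<close>

definition fdd_converges :: "(nat \<Rightarrow> (int \<Rightarrow> real) measure) \<Rightarrow> (int \<Rightarrow> real) measure \<Rightarrow> bool" where
  "fdd_converges P Q \<longleftrightarrow>
     (\<forall>I. finite I \<longrightarrow>
        weakly_converges (\<lambda>t. distr (P t) borel (\<lambda>x. restrict x I))
          (distr Q borel (\<lambda>x. restrict x I))) \<and>
     (\<forall>(s :: nat \<Rightarrow> real) k.
        weakly_converges (\<lambda>t. distr (P t) borel (\<lambda>x. \<lambda>j\<in>{..<k}. counting (s j) x))
          (distr Q borel (\<lambda>x. \<lambda>j\<in>{..<k}. counting (s j) x)))"

definition exponential_tail :: "'a measure \<Rightarrow> ('a \<Rightarrow> real) \<Rightarrow> bool" where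
  "exponential_tail M Z \<longleftrightarrow>
     (\<exists>C c. C > 0 \<and> c > 0 \<and> (\<forall>z\<ge>0. measure M {w \<in> space M. Z w > z} \<le> C * exp (- c * z)))"

end

theory Submission
  imports Defs
begin

text \<open>
  Call gap i, the one between points i and i + 1, occupied if one of its end points moves into it. The
  points after a step are the midpoints of the occupied gaps, scaled by 3/4. No two
  consecutive gaps are empty, so the new points are numbered by walking along the occupied gaps.
  Seen from a new point the step is therefore a random linear map (\<open>palm_step\<close>) that depends on the moves only through the
  occupied gaps, and all the analysis is done with this map.

  A stationary process and its Palm law are tied together by the Campbell formula, the assumption of
  the locale \<open>palm_pair\<close>. It gives the inversion formula, stationarity and the intensity, and
  it is preserved by a step if on the Palm side the moves are conditioned to make gap 0 occupied
  (\<open>palm_pair_step\<close>). The processes at all times are in this way governed by products of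
  independent identically distributed linear maps.

  These maps contract. An increment over n new points is 3/4 times a mean of two increments over the
  old gaps between two occupied ones, and these are 4 n / 3 in the mean; if the mean square of an
  increment is at most linear in its length, the step multiplies it by at most 9/16 * 4/3 = 3/4
  (\<open>palm_step_contraction\<close>). Two starting configurations whose difference has linearly bounded mean
  square increments are thus forgotten exponentially fast. For a renewal process with finite variance
  the difference from the integer lattice is a sum of independent centred gaps, so its
  variance is linear; the lattice differs linearly from its own image after a step because the
  positions of the occupied gaps have Gaussian-type exponential moments (\<open>site_mgf_two_states\<close>).

  Multiplying the maps in the reverse order (\<open>backward\<close>) does not change the law at a fixed time, but
  now the step from t to t + 1 only adds an innermost factor, and the contraction makes the sequence
  started from the lattice converge almost surely. The law of the limit is the Palm law of the limit
  process, which inherits the invariance under a change of the typical point by weak convergence, and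
  the mean gap 1 by domination (\<open>palm_pair_limit\<close>). A renewal start driven by the same moves converges to
  the same limit, which gives convergence of the Palm laws; for the stationary laws
  the origin is placed uniformly in its gap, and the integral over its place is taken to the
  limit by dominated convergence (\<open>integral_clustering_tendsto\<close>).

  The exponential tail comes from a bound on exponential moments that holds at all times. By convexity a
  step replaces the parameter by 3/4 of it and the length of the increment by the number of old
  gaps, whose exponential moments are known; the exponents then form a convergent recursion
  (\<open>exp_moment_backward\<close>), and Fatou's lemma carries the bound to the limit.
\<close>

section \<open>Occupied gaps\<close>

text \<open>
  Gap i lies between the points i and i + 1. Each point moves to the midpoint of an adjacent gap, and two
  points merge when both end points of a gap move into it; the midpoints of the occupied gaps are
  therefore all the points after a step, each listed once.
\<close>

definition occupied :: "(int \<Rightarrow> bool) \<Rightarrow> int \<Rightarrow> bool" where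
  "occupied m i \<longleftrightarrow> m i \<or> \<not> m (i + 1)"

text \<open>
  If gap i + 1 is empty, then point i + 2 moves right, so gap i + 2 is occupied: looking two gaps ahead
  is enough.
\<close>

definition next_site :: "(int \<Rightarrow> bool) \<Rightarrow> int \<Rightarrow> int" where
  "next_site m i = (if occupied m (i + 1) then i + 1 else i + 2)"

definition prev_site :: "(int \<Rightarrow> bool) \<Rightarrow> int \<Rightarrow> int" where
  "prev_site m i = (if occupied m (i - 1) then i - 1 else i - 2)"

text \<open>
  The occupied gaps in increasing order, counted from gap i as number 0, when gap i itself is
  occupied.
\<close>

definition site :: "(int \<Rightarrow> bool) \<Rightarrow> int \<Rightarrow> int \<Rightarrow> int" where
  "site m i k = (if 0 \<le> k then (next_site m ^^ nat k) i else (prev_site m ^^ nat (- k)) i)"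

definition midpt :: "(int \<Rightarrow> real) \<Rightarrow> int \<Rightarrow> real" where
  "midpt x i = (x i + x (i + 1)) / 2"

lemma occupied_next_site: "occupied m (next_site m i)"
  by (auto simp: next_site_def occupied_def algebra_simps)

lemma occupied_prev_site: "occupied m (prev_site m i)"
  by (auto simp: prev_site_def occupied_def)

lemma next_prev_site: "occupied m i \<Longrightarrow> next_site m (prev_site m i) = i"
  by (auto simp: prev_site_def next_site_def occupied_def algebra_simps)

lemma prev_next_site: "occupied m i \<Longrightarrow> prev_site m (next_site m i) = i"
  by (auto simp: prev_site_def next_site_def occupied_def algebra_simps)

lemma not_occupied_between: "i < j \<Longrightarrow> j < next_site m i \<Longrightarrow> \<not> occupied m j"
proof -
  assume a: "i < j" "j < next_site m i"
  then have "next_site m i = i + 2" "\<not> occupied m (i + 1)"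
    by (auto simp: next_site_def split: if_splits)
  moreover from a this(1) have "j = i + 1" by linarith
  ultimately show ?thesis by simp
qed

lemma next_site_gt: "i < next_site m i"
  by (simp add: next_site_def)

lemma site_0 [simp]: "site m i 0 = i"
  by (simp add: site_def)

lemma occupied_site: "occupied m i \<Longrightarrow> occupied m (site m i k)"
proof -
  assume "occupied m i"
  then have "occupied m ((next_site m ^^ n) i)" "occupied m ((prev_site m ^^ n) i)" for n
    by (induction n) (simp_all add: occupied_next_site occupied_prev_site)
  then show ?thesis by (simp add: site_def)
qed

lemma site_add_1:
  assumes "occupied m i"
  shows "site m i (k + 1) = next_site m (site m i k)"
proof (cases "0 \<le> k")
  case True
  then have "nat (k + 1) = Suc (nat k)" by simp
  with True show ?thesis by (simp add: site_def)
next
  case False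
  then have "nat (- k) = Suc (nat (- (k + 1)))" by simp
  then have "site m i k = prev_site m (site m i (k + 1))"
    using False by (auto simp: site_def)
  then show ?thesis
    using next_prev_site occupied_site[OF assms] by metis
qed

lemma strict_mono_int_step:
  fixes f :: "int \<Rightarrow> 'a::order"
  assumes "\<And>i. f i < f (i + 1)"
  shows "strict_mono f"
proof (rule strict_monoI)
  fix i j :: int assume "i < j"
  then show "f i < f j"
    by (induction j rule: int_gr_induct) (use assms in \<open>auto intro: less_trans\<close>)
qed

lemma strict_mono_int_add:
  fixes f :: "int \<Rightarrow> int"
  assumes "strict_mono f" "0 \<le> n"
  shows "f k + n \<le> f (k + n)"
  using assms(2)
proof (induction n rule: int_ge_induct)
  case (step n)
  have "f (k + n) < f (k + (n + 1))"
    using assms(1) by (simp add: strict_mono_less)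
  with step show ?case by simp
qed simp

lemma strict_mono_site: "occupied m i \<Longrightarrow> strict_mono (site m i)"
  by (rule strict_mono_int_step) (simp add: site_add_1 next_site_gt)

text \<open>
  The quantifiers run over the natural numbers, which makes the condition a countable combination of
  measurable ones.
\<close>

definition two_sided :: "(int \<Rightarrow> real) \<Rightarrow> bool" where
  "two_sided x \<longleftrightarrow> mono x \<and> (\<forall>n::nat. \<exists>i. x i \<le> - real n) \<and> (\<forall>n::nat. \<exists>i. real n < x i)"

lemma two_sidedD:
  assumes "two_sided x"
  shows "mono x" "\<exists>i. x i \<le> a" "\<exists>i. a < x i"
proof -
  show "mono x" using assms by (simp add: two_sided_def)
  obtain n :: nat where n: "\<bar>a\<bar> \<le> real n" using real_arch_simple by blast
  have "\<exists>i. x i \<le> - real n" "\<exists>i. real n < x i" using assms by (auto simp: two_sided_def)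
  then show "\<exists>i. x i \<le> a" "\<exists>i. a < x i"
    using n by (meson abs_le_D2 abs_le_iff le_minus_iff minus_le_iff order_trans, meson abs_le_D1 le_less_trans)
qed

lemma two_sidedI:
  assumes "mono x" "\<And>a. \<exists>i. x i \<le> a" "\<And>a. \<exists>i. a < x i"
  shows "two_sided x"
  using assms by (auto simp: two_sided_def)

lemma mono_ex1_crossing:
  fixes x :: "int \<Rightarrow> 'a::linorder"
  assumes "mono x" "\<exists>i. x i \<le> a" "\<exists>i. a < x i"
  shows "\<exists>!i. x i \<le> a \<and> a < x (i + 1)"
proof -
  obtain i0 i1 where i: "x i0 \<le> a" "a < x i1" using assms by auto
  have "\<exists>i. x i \<le> a \<and> a < x (i + 1)"
  proof (rule ccontr)
    assume "\<not> ?thesis"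
    then have *: "\<And>i. x i \<le> a \<Longrightarrow> x (i + 1) \<le> a" by (auto simp: not_less)
    have "x j \<le> a" if "i0 \<le> j" for j
      using that by (induction j rule: int_ge_induct) (use i * in auto)
    moreover have "i0 \<le> i1"
      using i assms(1) by (meson linorder_le_cases linorder_not_le monoD order_trans)
    ultimately show False using i by (auto simp: not_less[symmetric])
  qed
  moreover have "i = j" if "x i \<le> a" "a < x (i + 1)" "x j \<le> a" "a < x (j + 1)" for i j
  proof (rule ccontr)
    assume "i \<noteq> j"
    then consider "i + 1 \<le> j" | "j + 1 \<le> i" by linarith
    then show False
      by cases (use that monoD[OF assms(1)] in \<open>auto dest!: monoD[OF assms(1)]\<close>)
  qed
  ultimately show ?thesis by blast
qed

lemma two_sided_ex1_crossing: "two_sided x \<Longrightarrow> \<exists>!i. x i \<le> a \<and> a < x (i + 1)"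
  by (intro mono_ex1_crossing two_sidedD)

text \<open>
  The sites increase strictly through the integers, hence pass every gap j, and none of those that
  are jumped over is occupied.
\<close>

lemma range_site:
  assumes "occupied m i"
  shows "range (site m i) = {j. occupied m j}"
proof (intro equalityI subsetI)
  fix j assume "j \<in> {j. occupied m j}"
  then have j: "occupied m j" by simp
  note sm = strict_mono_site[OF assms]
  have "\<exists>!k. site m i k \<le> j \<and> j < site m i (k + 1)"
  proof (rule mono_ex1_crossing)
    show "mono (site m i)" using sm by (rule strict_mono_mono)
    have "site m i (- \<bar>j - i\<bar>) + \<bar>j - i\<bar> \<le> i"
      using strict_mono_int_add[OF sm, of "\<bar>j - i\<bar>" "- \<bar>j - i\<bar>"] by simp
    then show "\<exists>k. site m i k \<le> j" by (intro exI[of _ "- \<bar>j - i\<bar>"]) linarith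
    have "i + (\<bar>j - i\<bar> + 1) \<le> site m i (\<bar>j - i\<bar> + 1)"
      using strict_mono_int_add[OF sm, of "\<bar>j - i\<bar> + 1" 0] by simp
    then show "\<exists>k. j < site m i k" by (intro exI[of _ "\<bar>j - i\<bar> + 1"]) linarith
  qed
  then obtain k where "site m i k \<le> j" "j < next_site m (site m i k)"
    by (auto simp: site_add_1[OF assms])
  then have "j = site m i k" using not_occupied_between j by (metis order_le_less)
  then show "j \<in> range (site m i)" by simp
qed (use occupied_site[OF assms] in auto)

lemma site_site:
  assumes "occupied m i"
  shows "site m (site m i j) k = site m i (j + k)"
proof (induction k rule: int_induct[where k = 0])
  case (step1 k)
  then show ?case
    using site_add_1[OF assms, of "j + k"] site_add_1[OF occupied_site[OF assms], of j k]
    by (simp add: add.assoc)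
next
  case (step2 k)
  have "next_site m (site m (site m i j) (k - 1)) = next_site m (site m i (j + (k - 1)))"
    using step2 site_add_1[OF assms, of "j + (k - 1)"] site_add_1[OF occupied_site[OF assms], of j "k - 1"]
    by simp
  then show ?case
    using prev_next_site occupied_site[OF assms] occupied_site[OF occupied_site[OF assms]] by metis
qed simp

lemma site_shift: "site m i k = i + site (\<lambda>j. m (i + j)) 0 k"
proof -
  have o: "occupied m (i + a) = occupied (\<lambda>j. m (i + j)) a" for a
    by (simp add: occupied_def add.assoc)
  have "(next_site m ^^ n) i = i + (next_site (\<lambda>j. m (i + j)) ^^ n) 0" for n
    by (induction n) (simp_all add: next_site_def o[symmetric] add.assoc)
  moreover have "(prev_site m ^^ n) i = i + (prev_site (\<lambda>j. m (i + j)) ^^ n) 0" for n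
    by (induction n) (simp_all add: prev_site_def o[symmetric] add_diff_eq)
  ultimately show ?thesis by (simp add: site_def)
qed

lemma occupied_shift: "occupied (\<lambda>j. m (i + j)) 0 = occupied m i"
  by (simp add: occupied_def)

section \<open>One step seen from a typical point\<close>

definition recenter :: "int \<Rightarrow> (int \<Rightarrow> real) \<Rightarrow> int \<Rightarrow> real" where
  "recenter i x = (\<lambda>j. x (i + j) - x i)"

text \<open>
  A step as it is seen from the new point in gap 0, which is the new origin. For given moves it is linear
  in the configuration.
\<close>

definition palm_step :: "(int \<Rightarrow> bool) \<Rightarrow> (int \<Rightarrow> real) \<Rightarrow> int \<Rightarrow> real" where
  "palm_step m x = (\<lambda>k. 3 / 4 * (midpt x (site m 0 k) - midpt x 0))"

lemma shift_to_origin_eq_recenter: "shift_to_origin (\<lambda>j. x (i + j)) = recenter i x"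
  by (simp add: shift_to_origin_def recenter_def)

lemma midpt_recenter: "midpt (recenter i x) a = midpt x (i + a) - x i"
  by (simp add: midpt_def recenter_def field_simps)

lemma range_half_move: "range (half_move m x) = midpt x ` {i. occupied m i}"
proof (intro equalityI subsetI)
  fix y assume "y \<in> range (half_move m x)"
  then obtain i where y: "y = half_move m x i" by auto
  show "y \<in> midpt x ` {i. occupied m i}"
  proof (cases "m i")
    case True
    then show ?thesis
      by (intro image_eqI[of _ _ i]) (auto simp: y half_move_def midpt_def occupied_def)
  next
    case False
    then show ?thesis
      by (intro image_eqI[of _ _ "i - 1"]) (auto simp: y half_move_def midpt_def occupied_def)
  qed
next
  fix y assume "y \<in> midpt x ` {i. occupied m i}"
  then obtain i where y: "y = midpt x i" and i: "m i \<or> \<not> m (i + 1)" by (auto simp: occupied_def)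
  show "y \<in> range (half_move m x)"
  proof (cases "m i")
    case True
    then show ?thesis by (intro image_eqI[of _ _ i]) (auto simp: y half_move_def midpt_def)
  next
    case False
    with i show ?thesis by (intro image_eqI[of _ _ "i + 1"]) (auto simp: y half_move_def midpt_def)
  qed
qed

text \<open>
  The map between the two numberings is an increasing bijection of the integers, hence a translation.
\<close>

lemma strict_mono_same_range_shift:
  fixes y y' :: "int \<Rightarrow> real"
  assumes y: "strict_mono y" and y': "strict_mono y'" and r: "range y' = range y"
  obtains c where "\<And>k. y' k = y (k + c)"
proof -
  have "\<forall>k. \<exists>j. y' k = y j" using r by (metis rangeE rangeI)
  then obtain \<phi> where \<phi>: "\<And>k. y' k = y (\<phi> k)" by metis
  have sm: "\<phi> j < \<phi> k \<longleftrightarrow> j < k" for j k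
    using \<phi> strict_mono_less[OF y] strict_mono_less[OF y'] by metis
  have surj: "\<exists>k. \<phi> k = j" for j
  proof -
    have "y j \<in> range y'" using r by simp
    then show ?thesis using \<phi> strict_mono_eq[OF y] by (metis rangeE)
  qed
  have step: "\<phi> (k + 1) = \<phi> k + 1" for k
  proof -
    obtain j where j: "\<phi> j = \<phi> k + 1" using surj by blast
    then have "k < j" using sm by (metis zless_add1_eq)
    then have "\<not> \<phi> j < \<phi> (k + 1)" by (simp add: sm)
    moreover have "\<phi> k < \<phi> (k + 1)" by (simp add: sm)
    ultimately show ?thesis using j by linarith
  qed
  have "\<phi> k = k + \<phi> 0" for k
  proof (induction k rule: int_induct[where k = 0])
    case (step2 k)
    then show ?case using step[of "k - 1"] by simp
  qed (simp_all add: step)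
  then show ?thesis using \<phi> that by metis
qed

lemma enumerate_points_eq:
  assumes "strict_mono y" "range y = S" "y 0 \<le> 0" "0 < y 1"
  shows "enumerate_points S = y"
  unfolding enumerate_points_def
proof (rule the_equality)
  show "strict_mono y \<and> range y = S \<and> y 0 \<le> 0 \<and> 0 < y 1" using assms by simp
  fix y' :: "int \<Rightarrow> real" assume *: "strict_mono y' \<and> range y' = S \<and> y' 0 \<le> 0 \<and> 0 < y' 1"
  then obtain c where c: "\<And>k. y' k = y (k + c)"
    using strict_mono_same_range_shift[OF assms(1), of y'] assms(2) by metis
  have "y c < y 1" "y 0 < y (1 + c)"
    using * assms c[of 0] c[of 1] by (auto intro: le_less_trans)
  then have "c = 0" using strict_mono_less[OF assms(1)] by force
  with c show "y' = y" by auto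
qed

lemma midpt_less: "strict_mono x \<Longrightarrow> i < j \<Longrightarrow> midpt x i < midpt x j"
  by (auto simp: midpt_def strict_mono_def intro!: divide_strict_right_mono add_strict_mono)

lemma midpt_mono: "mono x \<Longrightarrow> i \<le> j \<Longrightarrow> midpt x i \<le> midpt x j"
  by (auto simp: midpt_def mono_def intro!: divide_right_mono add_mono)

lemma two_sided_midpt_site:
  assumes x: "two_sided x" and i: "occupied m i"
  shows "two_sided (\<lambda>k. midpt x (site m i k))"
proof (rule two_sidedI)
  note sm = strict_mono_site[OF i] and mx = two_sidedD(1)[OF x]
  show "mono (\<lambda>k. midpt x (site m i k))"
    using strict_mono_less_eq[OF sm] by (intro monoI midpt_mono[OF mx]) auto
  fix a :: real
  obtain j where j: "x j \<le> a" using two_sidedD(2)[OF x] by blast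
  define l where "l = \<bar>j - i\<bar> + 1"
  have "site m i (- l) + l \<le> i"
    using strict_mono_int_add[OF sm, of l "- l"] by (simp add: l_def)
  then have "x (site m i (- l)) \<le> a" "x (site m i (- l) + 1) \<le> a"
    using j by (auto intro!: order_trans[OF monoD[OF mx] j] simp: l_def)
  then have "midpt x (site m i (- l)) \<le> a" by (simp add: midpt_def)
  then show "\<exists>k. midpt x (site m i k) \<le> a" ..
  obtain j where j: "a < x j" using two_sidedD(3)[OF x] by blast
  define l where "l = \<bar>j - i\<bar>"
  have "i + l \<le> site m i l"
    using strict_mono_int_add[OF sm, of l 0] by (simp add: l_def)
  then have "a < x (site m i l)" "a < x (site m i l + 1)"
    using j by (auto intro!: less_le_trans[OF j monoD[OF mx]] simp: l_def)
  then have "a < midpt x (site m i l)" by (simp add: midpt_def)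
  then show "\<exists>k. a < midpt x (site m i k)" ..
qed

text \<open>
  Any occupied gap serves as a start of the enumeration; the start is then moved so that the
  origin lies between the points 0 and 1.
\<close>

lemma cluster_step_eq:
  assumes x: "strict_mono x" "two_sided x"
  obtains i where "occupied m i" "\<And>k. cluster_step m x k = 3 / 4 * midpt x (site m i k)"
    "cluster_step m x 0 \<le> 0" "0 < cluster_step m x 1"
proof -
  obtain i0 where i0: "occupied m i0" using occupied_next_site by blast
  obtain k where k: "midpt x (site m i0 k) \<le> 0" "0 < midpt x (site m i0 (k + 1))"
    using two_sided_ex1_crossing[OF two_sided_midpt_site[OF x(2) i0], of 0] by auto
  define i where "i = site m i0 k"
  have i: "occupied m i" using occupied_site[OF i0] by (simp add: i_def)
  have e: "enumerate_points (range (half_move m x)) = (\<lambda>k. midpt x (site m i k))"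
  proof (rule enumerate_points_eq)
    show "strict_mono (\<lambda>k. midpt x (site m i k))"
      using midpt_less[OF x(1)] strict_mono_less[OF strict_mono_site[OF i]] by (auto simp: strict_mono_def)
    show "range (\<lambda>k. midpt x (site m i k)) = range (half_move m x)"
      unfolding range_half_move range_site[OF i, symmetric] by auto
  qed (use k in \<open>simp_all add: i_def site_site[OF i0]\<close>)
  show thesis
    by (rule that[OF i]) (use k in \<open>simp_all add: cluster_step_def e i_def site_site[OF i0]\<close>)
qed

lemma recenter_cluster_step:
  assumes "occupied m i" "\<And>k. y k = 3 / 4 * midpt x (site m i k)"
  shows "recenter k y = palm_step (\<lambda>j. m (site m i k + j)) (recenter (site m i k) x)"
proof
  fix j
  have "site m i (k + j) = site m i k + site (\<lambda>j. m (site m i k + j)) 0 j"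
    by (metis site_site[OF assms(1)] site_shift)
  then show "recenter k y j = palm_step (\<lambda>j. m (site m i k + j)) (recenter (site m i k) x) j"
    unfolding palm_step_def recenter_def[of k] by (simp add: assms(2) midpt_recenter)
qed

lemma mono_cluster_step:
  assumes "strict_mono x" "two_sided x"
  shows "strict_mono (cluster_step m x)" "two_sided (cluster_step m x)"
    "cluster_step m x 0 \<le> 0" "0 < cluster_step m x 1"
proof -
  obtain i where i: "occupied m i" "\<And>k. cluster_step m x k = 3 / 4 * midpt x (site m i k)"
    "cluster_step m x 0 \<le> 0" "0 < cluster_step m x 1"
    using cluster_step_eq[OF assms] by blast
  show "strict_mono (cluster_step m x)"
    using midpt_less[OF assms(1)] strict_mono_less[OF strict_mono_site[OF i(1)]]
    by (auto simp: strict_mono_def i(2))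
  have t: "two_sided (\<lambda>k. midpt x (site m i k))" by (rule two_sided_midpt_site[OF assms(2) i(1)])
  show "two_sided (cluster_step m x)"
  proof (rule two_sidedI)
    show "mono (cluster_step m x)" using \<open>strict_mono (cluster_step m x)\<close> by (rule strict_mono_mono)
    show "\<exists>k. cluster_step m x k \<le> a" "\<exists>k. a < cluster_step m x k" for a
      using two_sidedD(2,3)[OF t, of "4 / 3 * a"] by (auto simp: i(2) field_simps)
  qed
qed (use cluster_step_eq[OF assms, of m] in auto)

text \<open>
  A sum over the new points does not depend on their numbering, so they may be indexed by the old gaps
  that they come from. In this form each term sees the old configuration and the moves from one old
  point only, without reference to the origin.
\<close>

lemma nn_integral_cluster_step_points:
  fixes h :: "real \<Rightarrow> (int \<Rightarrow> real) \<Rightarrow> ennreal"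
  assumes x: "strict_mono x" "two_sided x"
  shows "(\<integral>\<^sup>+k. h (cluster_step m x k) (recenter k (cluster_step m x)) \<partial>count_space UNIV) =
    (\<integral>\<^sup>+j. indicator {j. occupied m j} j *
       h (3 / 4 * midpt x j) (palm_step (\<lambda>l. m (j + l)) (recenter j x)) \<partial>count_space UNIV)"
proof -
  obtain i where i: "occupied m i" "\<And>k. cluster_step m x k = 3 / 4 * midpt x (site m i k)"
    using cluster_step_eq[OF x] by blast
  have "bij_betw (site m i) UNIV {j. occupied m j}"
    using strict_mono_site[OF i(1)] range_site[OF i(1)]
    by (auto simp: bij_betw_def strict_mono_imp_inj_on)
  then have "(\<integral>\<^sup>+j. h (3 / 4 * midpt x j) (palm_step (\<lambda>l. m (j + l)) (recenter j x)) \<partial>count_space {j. occupied m j})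
    = (\<integral>\<^sup>+k. h (cluster_step m x k) (recenter k (cluster_step m x)) \<partial>count_space UNIV)"
    by (subst nn_integral_bij_count_space[symmetric])
       (auto simp: i recenter_cluster_step[OF i] intro!: nn_integral_cong)
  then show ?thesis
    by (simp add: nn_integral_count_space_indicator mult.commute)
qed

section \<open>Measurability\<close>

abbreviation move_space :: "(int \<Rightarrow> bool) measure" where
  "move_space \<equiv> PiM UNIV (\<lambda>_. count_space UNIV)"

lemma measurable_point:
  fixes f :: "'a \<Rightarrow> int \<Rightarrow> real"
  assumes "f \<in> borel_measurable N"
  shows "(\<lambda>w. f w i) \<in> borel_measurable N"
  using assms by (rule measurable_product_then_coordinatewise)

lemma borel_measurable_pred_le [measurable (raw)]:
  fixes f :: "'a \<Rightarrow> 'b::{second_countable_topology, linorder_topology}"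
  shows "f \<in> borel_measurable M \<Longrightarrow> g \<in> borel_measurable M \<Longrightarrow> Measurable.pred M (\<lambda>w. f w \<le> g w)"
  unfolding pred_def by (rule borel_measurable_le)

lemma measurable_point_at:
  fixes f :: "'a \<Rightarrow> int \<Rightarrow> real"
  assumes [measurable]: "f \<in> borel_measurable N" "g \<in> measurable N (count_space UNIV)"
  shows "(\<lambda>w. f w (g w)) \<in> borel_measurable N"
  by (rule measurable_compose_countable[OF measurable_point[OF assms(1)] assms(2)])

lemma measurable_recenter [measurable (raw)]:
  assumes [measurable]: "f \<in> borel_measurable N"
  shows "(\<lambda>w. recenter i (f w)) \<in> borel_measurable N"
  unfolding recenter_def
  by (rule measurable_coordinatewise_then_product)
    (intro borel_measurable_diff measurable_point assms)

definition translate :: "real \<Rightarrow> (int \<Rightarrow> real) \<Rightarrow> int \<Rightarrow> real" where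
  "translate s x = (\<lambda>j. x j + s)"

lemma measurable_translate [measurable (raw)]:
  assumes [measurable]: "g \<in> borel_measurable N" "f \<in> borel_measurable N"
  shows "(\<lambda>w. translate (g w) (f w)) \<in> borel_measurable N"
  unfolding translate_def
  by (rule measurable_coordinatewise_then_product)
    (intro borel_measurable_add measurable_point assms)

lemma mono_int_iff: "mono x \<longleftrightarrow> (\<forall>i j. i \<le> j \<longrightarrow> x i \<le> (x j :: real))"
  by (auto simp: mono_def)

lemma measurable_two_sided [measurable]: "Measurable.pred borel two_sided"
  unfolding two_sided_def[abs_def] mono_int_iff by measurable

lemma measurable_strict_mono [measurable]:
  "Measurable.pred borel (\<lambda>x :: int \<Rightarrow> real. strict_mono x)"
  unfolding strict_mono_def by measurable

lemma measurable_move: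
  assumes "f \<in> measurable N move_space"
  shows "(\<lambda>w. f w i) \<in> measurable N (count_space UNIV)"
  by (rule measurable_compose[OF assms measurable_component_singleton]) simp

lemma measurable_shift_moves:
  assumes [measurable]: "f \<in> measurable N move_space"
  shows "(\<lambda>w j. f w (i + j)) \<in> measurable N move_space"
  by (rule measurable_abs_UNIV, rule measurable_move, rule assms)

lemma measurable_occupied [measurable (raw)]:
  assumes [measurable]: "f \<in> measurable N move_space"
  shows "Measurable.pred N (\<lambda>w. occupied (f w) i)"
proof -
  have [measurable]: "(\<lambda>w. f w j) \<in> measurable N (count_space UNIV)" for j
    by (rule measurable_move) measurable
  show ?thesis unfolding occupied_def by measurable
qed

lemma measurable_next_prev_site:
  assumes [measurable]: "f \<in> measurable N move_space" and g: "g \<in> measurable N (count_space UNIV)"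
  shows "(\<lambda>w. next_site (f w) (g w)) \<in> measurable N (count_space UNIV)"
    "(\<lambda>w. prev_site (f w) (g w)) \<in> measurable N (count_space UNIV)"
proof -
  have "(\<lambda>w. next_site (f w) i) \<in> measurable N (count_space UNIV)"
    "(\<lambda>w. prev_site (f w) i) \<in> measurable N (count_space UNIV)" for i
    unfolding next_site_def prev_site_def by measurable
  from this[THEN measurable_compose_countable[OF _ g]]
  show "(\<lambda>w. next_site (f w) (g w)) \<in> measurable N (count_space UNIV)"
    "(\<lambda>w. prev_site (f w) (g w)) \<in> measurable N (count_space UNIV)"
    by simp_all
qed

lemma measurable_site [measurable (raw)]:
  assumes [measurable]: "f \<in> measurable N move_space"
  shows "(\<lambda>w. site (f w) i k) \<in> measurable N (count_space UNIV)"
proof -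
  have "(\<lambda>w. (next_site (f w) ^^ n) i) \<in> measurable N (count_space UNIV)" for n
    by (induction n) (simp_all add: measurable_next_prev_site)
  moreover have "(\<lambda>w. (prev_site (f w) ^^ n) i) \<in> measurable N (count_space UNIV)" for n
    by (induction n) (simp_all add: measurable_next_prev_site)
  ultimately show ?thesis by (simp add: site_def)
qed

lemma measurable_midpt [measurable (raw)]:
  assumes f: "f \<in> borel_measurable N" and g: "g \<in> measurable N (count_space UNIV)"
  shows "(\<lambda>w. midpt (f w) (g w)) \<in> borel_measurable N"
proof -
  have "(\<lambda>w. midpt (f w) i) \<in> borel_measurable N" for i
    unfolding midpt_def
    by (intro borel_measurable_divide borel_measurable_add measurable_point f borel_measurable_const)
  then show ?thesis by (rule measurable_compose_countable[OF _ g])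
qed

lemma measurable_palm_step [measurable (raw)]:
  assumes [measurable]: "f \<in> measurable N move_space" "g \<in> borel_measurable N"
  shows "(\<lambda>w. palm_step (f w) (g w)) \<in> borel_measurable N"
  unfolding palm_step_def
  by (rule measurable_coordinatewise_then_product)
    (intro borel_measurable_times borel_measurable_diff measurable_midpt measurable_site assms
      measurable_const, simp_all)

text \<open>
  The enumeration by position is a definite description, from which nothing about measurability can be
  read off. The candidate below is built from suprema and infima over a countable index set, hence
  measurable, and agrees with the enumeration wherever that exists; elsewhere the definite
  description has one fixed value.
\<close>

definition point_after :: "(int \<Rightarrow> real) \<Rightarrow> real \<Rightarrow> real" where
  "point_after z a = real_of_ereal (INF i. if a < z i then ereal (z i) else \<infinity>)"

definition point_before :: "(int \<Rightarrow> real) \<Rightarrow> real \<Rightarrow> real" where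
  "point_before z a = real_of_ereal (SUP i. if z i < a then ereal (z i) else - \<infinity>)"

definition enumeration_candidate :: "(int \<Rightarrow> real) \<Rightarrow> int \<Rightarrow> real" where
  "enumeration_candidate z k =
     (if 0 < k then (point_after z ^^ nat k) 0
      else (point_before z ^^ nat (- k)) (point_before z (point_after z 0)))"

lemma point_after_eq:
  assumes "a < b" "b \<in> range z" "\<And>i. a < z i \<Longrightarrow> b \<le> z i"
  shows "point_after z a = b"
proof -
  have "(INF i. if a < z i then ereal (z i) else \<infinity>) = ereal b"
  proof (rule antisym)
    obtain i where i: "z i = b" using assms by auto
    show "(INF i. if a < z i then ereal (z i) else \<infinity>) \<le> ereal b"
      by (rule INF_lower2[of i]) (use i assms in auto)
    show "ereal b \<le> (INF i. if a < z i then ereal (z i) else \<infinity>)"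
      by (rule INF_greatest) (use assms in auto)
  qed
  then show ?thesis by (simp add: point_after_def)
qed

lemma point_before_eq:
  assumes "b < a" "b \<in> range z" "\<And>i. z i < a \<Longrightarrow> z i \<le> b"
  shows "point_before z a = b"
proof -
  have "(SUP i. if z i < a then ereal (z i) else - \<infinity>) = ereal b"
  proof (rule antisym)
    obtain i where i: "z i = b" using assms by auto
    show "ereal b \<le> (SUP i. if z i < a then ereal (z i) else - \<infinity>)"
      by (rule SUP_upper2[of i]) (use i assms in auto)
    show "(SUP i. if z i < a then ereal (z i) else - \<infinity>) \<le> ereal b"
      by (rule SUP_least) (use assms in auto)
  qed
  then show ?thesis by (simp add: point_before_def)
qed

lemma enumeration_candidate_eq:
  assumes y: "strict_mono y" "range y = range z" "y 0 \<le> 0" "0 < y 1"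
  shows "enumeration_candidate z = y"
proof
  have zy: "\<exists>j. z i = y j" for i using y(2) by (metis rangeE rangeI)
  have yz: "y j \<in> range z" for j using y(2) by auto
  have le: "y (k + 1) \<le> y j" if "y k < y j" for k j
    using that y(1) by (simp add: strict_mono_less strict_mono_less_eq)
  have le': "y j \<le> y (k - 1)" if "y j < y k" for k j
    using that y(1) by (simp add: strict_mono_less strict_mono_less_eq)
  have after: "point_after z (y k) = y (k + 1)" for k
    by (rule point_after_eq) (use y(1) yz zy le in \<open>auto simp: strict_mono_less, metis\<close>)
  have before: "point_before z (y k) = y (k - 1)" for k
    by (rule point_before_eq) (use y(1) yz zy le' in \<open>auto simp: strict_mono_less, metis\<close>)
  have first: "point_after z 0 = y 1"
  proof (rule point_after_eq[OF y(4) yz])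
    fix i assume i: "0 < z i"
    obtain j where j: "z i = y j" using zy by blast
    then have "y 0 < y j" using i y(3) by simp
    then show "y 1 \<le> z i" using le[of 0 j] j by simp
  qed
  have pos: "(point_after z ^^ Suc n) 0 = y (int (Suc n))" for n
  proof (induction n)
    case (Suc n)
    have "(point_after z ^^ Suc (Suc n)) 0 = point_after z (y (int (Suc n)))"
      using Suc by simp
    then show ?case by (simp add: after add.commute)
  qed (simp add: first)
  have neg: "(point_before z ^^ n) (y 0) = y (- int n)" for n
    by (induction n) (auto simp: before intro!: arg_cong[where f = y])
  fix k
  show "enumeration_candidate z k = y k"
  proof (cases "0 < k")
    case True
    then obtain n where "nat k = Suc n" "k = int (Suc n)"
      by (metis gr0_implies_Suc zero_less_nat_eq int_nat_eq order_less_imp_le)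
    with True pos[of n] show ?thesis by (simp only: enumeration_candidate_def if_True)
  next
    case False
    then show ?thesis using neg[of "nat (- k)"] first before[of 1]
      by (simp add: enumeration_candidate_def)
  qed
qed

text \<open>
  A form of the conditions on an enumeration in which only countably many pairs of coordinates are
  compared.
\<close>

definition is_enumeration :: "(int \<Rightarrow> real) \<Rightarrow> (int \<Rightarrow> real) \<Rightarrow> bool" where
  "is_enumeration z y \<longleftrightarrow> (\<forall>i j. i < j \<longrightarrow> y i < y j) \<and> (\<forall>i. \<exists>j. y i = z j) \<and> (\<forall>j. \<exists>i. z j = y i) \<and>
     y 0 \<le> 0 \<and> 0 < y 1"

lemma is_enumeration_iff:
  "is_enumeration z y \<longleftrightarrow> strict_mono y \<and> range y = range z \<and> y 0 \<le> 0 \<and> 0 < y 1"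
proof -
  have "range y = range z \<longleftrightarrow> (\<forall>i. \<exists>j. y i = z j) \<and> (\<forall>j. \<exists>i. z j = y i)"
    by (simp add: set_eq_subset image_subset_iff image_iff)
  then show ?thesis by (auto simp: is_enumeration_def strict_mono_def)
qed

lemma enumerate_points_range:
  "enumerate_points (range z) =
     (if is_enumeration z (enumeration_candidate z) then enumeration_candidate z else (THE y. False))"
proof (cases "is_enumeration z (enumeration_candidate z)")
  case True
  then show ?thesis
    by (auto simp: is_enumeration_iff intro: enumerate_points_eq)
next
  case False
  then have "\<not> (strict_mono y \<and> range y = range z \<and> y 0 \<le> 0 \<and> 0 < y 1)" for y :: "int \<Rightarrow> real"
    using enumeration_candidate_eq[of y z] by (auto simp: is_enumeration_iff)
  then have "(\<lambda>y :: int \<Rightarrow> real. strict_mono y \<and> range y = range z \<and> y 0 \<le> 0 \<and> 0 < y 1) = (\<lambda>y. False)" by auto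
  with False show ?thesis unfolding enumerate_points_def by simp
qed

lemma measurable_enumerate_points:
  fixes f :: "'a \<Rightarrow> int \<Rightarrow> real"
  assumes [measurable]: "f \<in> borel_measurable N"
  shows "(\<lambda>w. enumerate_points (range (f w))) \<in> borel_measurable N"
proof -
  note [measurable] = measurable_point[OF assms]
  have [measurable]: "(\<lambda>w. point_after (f w) (g w)) \<in> borel_measurable N"
    "(\<lambda>w. point_before (f w) (g w)) \<in> borel_measurable N"
    if [measurable]: "g \<in> borel_measurable N" for g
    unfolding point_after_def point_before_def by measurable
  have [measurable]: "(\<lambda>w. (point_after (f w) ^^ n) (g w)) \<in> borel_measurable N"
    "(\<lambda>w. (point_before (f w) ^^ n) (g w)) \<in> borel_measurable N"
    if [measurable]: "g \<in> borel_measurable N" for g n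
    by (induction n) simp_all
  have [measurable]: "(\<lambda>w. enumeration_candidate (f w)) \<in> borel_measurable N"
    unfolding enumeration_candidate_def[abs_def]
    by (rule measurable_coordinatewise_then_product) measurable
  note [measurable] = measurable_point[OF this]
  have [measurable]: "Measurable.pred N (\<lambda>w. is_enumeration (f w) (enumeration_candidate (f w)))"
    unfolding is_enumeration_def by measurable
  show ?thesis unfolding enumerate_points_range by measurable
qed

lemma measurable_cluster_step [measurable (raw)]:
  assumes [measurable]: "f \<in> measurable N move_space" "g \<in> borel_measurable N"
  shows "(\<lambda>w. cluster_step (f w) (g w)) \<in> borel_measurable N"
proof -
  note [measurable] = measurable_point[OF assms(2)] measurable_move[OF assms(1)]
  have *: "half_move m x i = (x i + (if m i then x (i + 1) else x (i - 1))) / 2" for m x i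
    by (simp add: half_move_def)
  have "(\<lambda>w. half_move (f w) (g w)) \<in> borel_measurable N"
    by (rule measurable_coordinatewise_then_product) (unfold *, measurable)
  then have e: "(\<lambda>w. enumerate_points (range (half_move (f w) (g w)))) \<in> borel_measurable N"
    by (rule measurable_enumerate_points)
  show ?thesis
    unfolding cluster_step_def
    by (rule measurable_coordinatewise_then_product)
      (intro borel_measurable_times measurable_point e borel_measurable_const)
qed

lemma npoints_eq_sum: "npoints B x = (\<integral>\<^sup>+i. indicator B (x i) \<partial>count_space UNIV)"
proof -
  have "(\<integral>\<^sup>+i. indicator B (x i) \<partial>count_space UNIV) =
    (\<integral>\<^sup>+i. indicator {i. x i \<in> B} i \<partial>count_space (UNIV :: int set))"
    by (auto intro!: nn_integral_cong simp: indicator_def)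
  then show ?thesis by (simp add: npoints_def)
qed

lemma measurable_sum_points:
  fixes f :: "'i::countable \<Rightarrow> 'a \<Rightarrow> ennreal"
  assumes [measurable]: "\<And>i. f i \<in> borel_measurable N"
  shows "(\<lambda>w. \<integral>\<^sup>+i. f i w \<partial>count_space UNIV) \<in> borel_measurable N"
proof (rule sigma_finite_measure.borel_measurable_nn_integral)
  show "sigma_finite_measure (count_space (UNIV :: 'i set))"
    by (rule sigma_finite_measure_count_space)
  show "(\<lambda>(w, i). f i w) \<in> borel_measurable (N \<Otimes>\<^sub>M count_space UNIV)"
    unfolding split_beta
    by (rule measurable_compose_countable[where g = snd and f = "\<lambda>i w. f i (fst w)"]) measurable
qed

lemma measurable_npoints [measurable (raw)]:
  assumes [measurable]: "B \<in> sets borel" "f \<in> borel_measurable N"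
  shows "(\<lambda>w. npoints B (f w)) \<in> borel_measurable N"
  unfolding npoints_eq_sum
  by (intro measurable_sum_points measurable_compose[OF measurable_point[OF assms(2)]]) simp

section \<open>Palm pairs\<close>

lemma measurable_fst_snd_point [measurable]:
  "(\<lambda>w. (fst w :: int \<Rightarrow> real) i) \<in> borel_measurable (borel \<Otimes>\<^sub>M N)"
  "(\<lambda>w. (snd w :: int \<Rightarrow> real) i) \<in> borel_measurable (N \<Otimes>\<^sub>M borel)"
  by (rule measurable_point, simp)+

lemma recenter_recenter: "recenter k (recenter i x) = recenter (i + k) x"
  by (simp add: recenter_def add.assoc)

lemma recenter_translate: "recenter i (translate s x) = recenter i x"
  by (simp add: recenter_def translate_def)

lemma recenter_0: "recenter i x 0 = 0"
  by (simp add: recenter_def)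

lemma translate_recenter: "translate (x i + a) (recenter i x) = translate a (\<lambda>j. x (i + j))"
  by (simp add: recenter_def translate_def)

lemma translate_apply: "translate s x i = x i + s"
  by (simp add: translate_def)

lemma translate_0: "translate 0 x = x"
  by (simp add: translate_def)

lemma two_sided_relabel: "two_sided x \<Longrightarrow> two_sided (\<lambda>j. x (i + j))"
proof (rule two_sidedI)
  assume x: "two_sided x"
  show "mono (\<lambda>j. x (i + j))" using two_sidedD(1)[OF x] by (auto simp: mono_def)
  fix a
  obtain j where "x j \<le> a" using two_sidedD(2)[OF x] by blast
  then show "\<exists>j. x (i + j) \<le> a" by (intro exI[of _ "j - i"]) simp
  obtain j where "a < x j" using two_sidedD(3)[OF x] by blast
  then show "\<exists>j. a < x (i + j)" by (intro exI[of _ "j - i"]) simp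
qed

lemma two_sided_translate: "two_sided x \<Longrightarrow> two_sided (translate s x)"
proof (rule two_sidedI)
  assume x: "two_sided x"
  show "mono (translate s x)" using two_sidedD(1)[OF x] by (auto simp: mono_def translate_def)
  show "\<exists>j. translate s x j \<le> a" "\<exists>j. a < translate s x j" for a
    using two_sidedD(2,3)[OF x, of "a - s"] by (auto simp: translate_def algebra_simps)
qed

lemma recenter_eq_translate: "recenter i x = translate (- x i) (\<lambda>j. x (i + j))"
  by (simp add: recenter_def translate_def)

lemma two_sided_recenter: "two_sided x \<Longrightarrow> two_sided (recenter i x)"
  unfolding recenter_eq_translate by (intro two_sided_translate two_sided_relabel)

text \<open>
  A two-sided sequence passes the level a in a single gap, so that a function can be written as a sum
  over all points with one nonzero term. This brings single configurations into the reach of the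
  Campbell formula, which is about sums over points.
\<close>

lemma nn_integral_crossing:
  fixes g :: "int \<Rightarrow> ennreal"
  assumes "two_sided x" "x k \<le> a" "a < x (k + 1)"
  shows "(\<integral>\<^sup>+i. (if x i \<le> a \<and> a < x (i + 1) then g i else 0) \<partial>count_space UNIV) = g k"
proof -
  have "i = k" if "x i \<le> a" "a < x (i + 1)" for i
    using ex1E[OF two_sided_ex1_crossing[OF assms(1), of a]] assms(2,3) that by metis
  then have "(\<integral>\<^sup>+i. (if x i \<le> a \<and> a < x (i + 1) then g i else 0) \<partial>count_space UNIV) =
      (\<Sum>i\<in>{k}. if x i \<le> a \<and> a < x (i + 1) then g i else 0)"
    by (intro nn_integral_count_space') auto
  then show ?thesis using assms(2,3) by simp
qed

lemma nn_integral_crossing_const: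
  fixes c :: ennreal
  assumes "two_sided x"
  shows "(\<integral>\<^sup>+i. (if x i \<le> a \<and> a < x (i + 1) then c else 0) \<partial>count_space UNIV) = c"
proof -
  obtain k where "x k \<le> a" "a < x (k + 1)"
    using two_sided_ex1_crossing[OF assms, of a] by blast
  then show ?thesis using nn_integral_crossing[OF assms, of k a "\<lambda>_. c"] by simp
qed

lemma nn_integral_count_int_shift:
  fixes g :: "int \<Rightarrow> ennreal"
  shows "(\<integral>\<^sup>+i. g (k + i) \<partial>count_space UNIV) = (\<integral>\<^sup>+i. g i \<partial>count_space UNIV)"
  by (rule nn_integral_bij_count_space) (auto intro: bij_betwI[where g = "\<lambda>i. i - k"])

lemma nn_integral_translate_lborel:
  fixes g :: "real \<Rightarrow> ennreal"
  assumes "g \<in> borel_measurable borel"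
  shows "(\<integral>\<^sup>+s. g (c + s) \<partial>lborel) = (\<integral>\<^sup>+s. g s \<partial>lborel)"
  using nn_integral_real_affine[OF assms, of 1 c] by simp

lemma nn_integral_reflect_lborel:
  fixes g :: "real \<Rightarrow> ennreal"
  assumes "g \<in> borel_measurable borel"
  shows "(\<integral>\<^sup>+s. g (- s) \<partial>lborel) = (\<integral>\<^sup>+s. g s \<partial>lborel)"
  using nn_integral_real_affine[OF assms, of "-1" 0] by simp

lemma nn_integral_unit_interval:
  fixes b :: ennreal and c :: real
  shows "(\<integral>\<^sup>+s. (if 0 < s + c \<and> s + c \<le> 1 then b else 0) \<partial>lborel) = b"
proof -
  have "(\<integral>\<^sup>+s. (if 0 < s + c \<and> s + c \<le> 1 then b else 0) \<partial>lborel) =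
    (\<integral>\<^sup>+s. b * indicator {- c <.. 1 - c} s \<partial>lborel)"
  proof (rule nn_integral_cong)
    fix s
    have "0 < s + c \<and> s + c \<le> 1 \<longleftrightarrow> s \<in> {- c <.. 1 - c}" by auto
    then show "(if 0 < s + c \<and> s + c \<le> 1 then b else 0) = b * indicator {- c <.. 1 - c} s"
      by (simp add: indicator_def)
  qed
  then show ?thesis by (simp add: nn_integral_cmult)
qed

lemma nn_integral_interval:
  fixes a :: real and c :: ennreal
  shows "(\<integral>\<^sup>+s. (if 0 \<le> s \<and> s < a then c else 0) \<partial>lborel) = c * ennreal a"
proof -
  have "(\<integral>\<^sup>+s. (if 0 \<le> s \<and> s < a then c else 0) \<partial>lborel) = (\<integral>\<^sup>+s. c * indicator {0..<a} s \<partial>lborel)"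
    by (intro nn_integral_cong) (auto simp: indicator_def)
  then show ?thesis by (cases "0 \<le> a") (simp_all add: nn_integral_cmult ennreal_neg)
qed

lemma npoints_relabel: "npoints B (\<lambda>j. x (i + j)) = npoints B x"
  unfolding npoints_eq_sum by (rule nn_integral_count_int_shift)

lemma npoints_image_add: "npoints ((+) s ` B) x = npoints B (translate (- s) x)"
proof -
  have "x i \<in> (+) s ` B \<longleftrightarrow> x i - s \<in> B" for i
    by (auto intro: image_eqI[of _ _ "x i - s"])
  then show ?thesis by (simp add: npoints_def translate_def)
qed

lemma nn_integral_palm:
  assumes [measurable_cong]: "sets P = sets borel" and mean: "(\<integral>\<^sup>+y. npoints {0<..1} y \<partial>P) = 1"
    and [measurable]: "F \<in> borel_measurable borel"
  shows "(\<integral>\<^sup>+x. F x \<partial>palm P) =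
    (\<integral>\<^sup>+x. \<integral>\<^sup>+i. (if 0 < x i \<and> x i \<le> 1 then F (recenter i x) else 0) \<partial>count_space UNIV \<partial>P)"
proof -
  interpret C: sigma_finite_measure "count_space (UNIV :: int set)"
    by (rule sigma_finite_measure_count_space)
  let ?f = "\<lambda>(x :: int \<Rightarrow> real, i). indicator {0<..1} (x i) :: ennreal"
  have [measurable]: "(\<lambda>w. (fst w :: int \<Rightarrow> real) (snd w)) \<in> borel_measurable (borel \<Otimes>\<^sub>M count_space UNIV)"
    by (rule measurable_point_at) simp_all
  have "(\<lambda>w. indicator {0<..1} ((fst w :: int \<Rightarrow> real) (snd w)) :: ennreal) \<in> borel_measurable (borel \<Otimes>\<^sub>M count_space UNIV)"
    by measurable
  then have [measurable]: "?f \<in> borel_measurable (borel \<Otimes>\<^sub>M count_space UNIV)"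
    by (simp add: split_beta')
  have "(\<lambda>w. recenter (snd w) (fst w)) \<in> borel_measurable (borel \<Otimes>\<^sub>M count_space UNIV)"
    by (rule measurable_compose_countable[where g = snd and f = "\<lambda>i w. recenter i (fst w)"]) measurable
  then have [measurable]: "(\<lambda>(x, i). recenter i x) \<in> borel_measurable (borel \<Otimes>\<^sub>M count_space UNIV)"
    by (simp add: split_beta')
  have "(\<integral>\<^sup>+y. F y \<partial>palm P) = (\<integral>\<^sup>+w. ?f w * F ((\<lambda>(x, i). recenter i x) w) \<partial>(P \<Otimes>\<^sub>M count_space UNIV))"
    unfolding palm_def mean shift_to_origin_eq_recenter
    by (simp add: nn_integral_distr nn_integral_density divide_ennreal_def)
  also have "\<dots> = (\<integral>\<^sup>+x. \<integral>\<^sup>+i. ?f (x, i) * F (recenter i x) \<partial>count_space UNIV \<partial>P)"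
    by (subst C.nn_integral_fst[symmetric]) simp_all
  also have "\<dots> = (\<integral>\<^sup>+x. \<integral>\<^sup>+i. (if 0 < x i \<and> x i \<le> 1 then F (recenter i x) else 0) \<partial>count_space UNIV \<partial>P)"
    by (intro nn_integral_cong) (auto simp: indicator_def)
  finally show ?thesis .
qed

text \<open>
  The Campbell formula with unit intensity: in the mean, the places of the points are distributed
  according to Lebesgue measure and, independently of its place, the configuration seen from a point
  has the law \<open>\<mu>\<close>. This one identity contains stationarity and the intensity, and
  determines each of the two laws from the other.
\<close>

locale palm_pair = P: prob_space P + palm: prob_space \<mu>
  for P \<mu> :: "(int \<Rightarrow> real) measure" +
  assumes sets_P [measurable_cong]: "sets P = sets borel"
    and sets_palm [measurable_cong]: "sets \<mu> = sets borel"
    and numbered: "AE x in P. two_sided x \<and> x 0 \<le> 0 \<and> 0 < x 1"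
    and campbell_pair: "h \<in> borel_measurable (borel \<Otimes>\<^sub>M borel) \<Longrightarrow>
      (\<integral>\<^sup>+x. \<integral>\<^sup>+i. h (x i, recenter i x) \<partial>count_space UNIV \<partial>P) = (\<integral>\<^sup>+x. \<integral>\<^sup>+s. h (s, x) \<partial>lborel \<partial>\<mu>)"
begin

lemma campbell:
  "(\<lambda>w. h (fst w) (snd w)) \<in> borel_measurable (borel \<Otimes>\<^sub>M borel) \<Longrightarrow>
    (\<integral>\<^sup>+x. \<integral>\<^sup>+i. h (x i) (recenter i x) \<partial>count_space UNIV \<partial>P) = (\<integral>\<^sup>+x. \<integral>\<^sup>+s. h s x \<partial>lborel \<partial>\<mu>)"
  using campbell_pair[of "\<lambda>w. h (fst w) (snd w)"] by simp

lemma space_P: "space P = UNIV" and space_palm: "space \<mu> = UNIV"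
  using sets_eq_imp_space_eq[OF sets_P] sets_eq_imp_space_eq[OF sets_palm] by simp_all

text \<open>
  The point 0 is the only one that lies at or before the origin while its successor lies beyond, so
  the value of F is a sum over the points with this condition.
\<close>

lemma nn_integral_translate:
  assumes [measurable]: "F \<in> borel_measurable borel"
  shows "(\<integral>\<^sup>+x. F (translate a x) \<partial>P) =
    (\<integral>\<^sup>+x. \<integral>\<^sup>+s. (if s \<le> 0 \<and> 0 < s + x 1 then F (translate (s + a) x) else 0) \<partial>lborel \<partial>\<mu>)"
proof -
  let ?h = "\<lambda>(s::real) (x::int \<Rightarrow> real). if s \<le> 0 \<and> 0 < s + x 1 then F (translate (s + a) x) else 0"
  have "(\<integral>\<^sup>+x. F (translate a x) \<partial>P) =
    (\<integral>\<^sup>+x. \<integral>\<^sup>+i. ?h (x i) (recenter i x) \<partial>count_space UNIV \<partial>P)"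
  proof (rule nn_integral_cong_AE)
    show "AE x in P. F (translate a x) = (\<integral>\<^sup>+i. ?h (x i) (recenter i x) \<partial>count_space UNIV)"
      using numbered
    proof eventually_elim
      case (elim x)
      have "(\<integral>\<^sup>+i. ?h (x i) (recenter i x) \<partial>count_space UNIV) =
        (\<integral>\<^sup>+i. (if x i \<le> 0 \<and> 0 < x (i + 1) then F (translate a (\<lambda>j. x (i + j))) else 0) \<partial>count_space UNIV)"
        using translate_recenter[of x _ a] by (intro nn_integral_cong) (simp add: recenter_def)
      also have "\<dots> = F (translate a x)"
        using elim by (subst nn_integral_crossing[where k = 0]) auto
      finally show ?case by simp
    qed
  qed
  also have "\<dots> = (\<integral>\<^sup>+x. \<integral>\<^sup>+s. ?h s x \<partial>lborel \<partial>\<mu>)"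
    by (rule campbell) measurable
  finally show ?thesis .
qed

text \<open>
  The inversion formula: the gap that covers the origin is a typical gap biased by its length, and
  the origin is uniformly distributed in it.
\<close>

lemma nn_integral_inversion:
  assumes [measurable]: "F \<in> borel_measurable borel"
  shows "(\<integral>\<^sup>+x. F x \<partial>P) =
    (\<integral>\<^sup>+x. \<integral>\<^sup>+s. (if 0 \<le> s \<and> s < x 1 then F (translate (- s) x) else 0) \<partial>lborel \<partial>\<mu>)"
proof -
  have "(\<integral>\<^sup>+s. (if s \<le> 0 \<and> 0 < s + x 1 then F (translate (s + 0) x) else 0) \<partial>lborel) =
    (\<integral>\<^sup>+s. (if 0 \<le> s \<and> s < x 1 then F (translate (- s) x) else 0) \<partial>lborel)" for x
    by (subst nn_integral_reflect_lborel[symmetric]) (auto intro!: nn_integral_cong)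
  then show ?thesis using nn_integral_translate[OF assms, of 0] by (simp add: translate_0)
qed

text \<open>
  A translated configuration is not numbered from the origin any more, so only functions
  that ignore the numbering are invariant under translation. For them the gap covering the
  origin may be replaced by the one covering the point a.
\<close>

lemma nn_integral_translate_invariant:
  assumes [measurable]: "F \<in> borel_measurable borel"
    and inv: "\<And>i x. F (\<lambda>j. x (i + j)) = F x"
  shows "(\<integral>\<^sup>+x. F (translate a x) \<partial>P) = (\<integral>\<^sup>+x. F x \<partial>P)"
proof -
  let ?h = "\<lambda>(s::real) (x::int \<Rightarrow> real). if s \<le> a \<and> a < s + x 1 then F (translate s x) else 0"
  have "(\<integral>\<^sup>+x. F (translate a x) \<partial>P) = (\<integral>\<^sup>+x. \<integral>\<^sup>+s. ?h (a + s) x \<partial>lborel \<partial>\<mu>)"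
    unfolding nn_integral_translate[OF assms(1)]
    by (intro nn_integral_cong) (auto simp: add_ac)
  also have "\<dots> = (\<integral>\<^sup>+x. \<integral>\<^sup>+s. ?h s x \<partial>lborel \<partial>\<mu>)"
    by (intro nn_integral_cong nn_integral_translate_lborel) measurable
  also have "\<dots> = (\<integral>\<^sup>+x. \<integral>\<^sup>+i. ?h (x i) (recenter i x) \<partial>count_space UNIV \<partial>P)"
    by (rule campbell[symmetric]) measurable
  also have "\<dots> = (\<integral>\<^sup>+x. F x \<partial>P)"
  proof (rule nn_integral_cong_AE)
    show "AE x in P. (\<integral>\<^sup>+i. ?h (x i) (recenter i x) \<partial>count_space UNIV) = F x"
      using numbered
    proof eventually_elim
      case (elim x)
      have "(\<integral>\<^sup>+i. ?h (x i) (recenter i x) \<partial>count_space UNIV) =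
        (\<integral>\<^sup>+i. (if x i \<le> a \<and> a < x (i + 1) then F x else 0) \<partial>count_space UNIV)"
        using translate_recenter[of x _ 0]
        by (intro nn_integral_cong) (simp add: translate_0 inv recenter_def)
      also have "\<dots> = F x"
        using elim by (subst nn_integral_crossing_const) auto
      finally show ?case .
    qed
  qed
  finally show ?thesis .
qed

text \<open>
  The Palm law is an average over the points in a unit interval, all of which satisfy the condition.
\<close>

lemma AE_palm:
  assumes [measurable]: "Measurable.pred borel A"
    and "AE x in P. \<forall>i. A (recenter i x)"
  shows "AE x in \<mu>. A x"
proof -
  let ?h = "\<lambda>(s::real) (x::int \<Rightarrow> real). if 0 < s \<and> s \<le> 1 then indicator {x. \<not> A x} x else 0 :: ennreal"
  have "emeasure \<mu> {x \<in> space \<mu>. \<not> A x} = (\<integral>\<^sup>+x. indicator {x. \<not> A x} x \<partial>\<mu>)"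
    by (simp add: space_palm)
  also have "\<dots> = (\<integral>\<^sup>+x. \<integral>\<^sup>+s. ?h s x \<partial>lborel \<partial>\<mu>)"
    by (intro nn_integral_cong, subst nn_integral_unit_interval[where c = 0, symmetric]) simp
  also have "\<dots> = (\<integral>\<^sup>+x. \<integral>\<^sup>+i. ?h (x i) (recenter i x) \<partial>count_space UNIV \<partial>P)"
    by (rule campbell[symmetric]) measurable
  also have "\<dots> = (\<integral>\<^sup>+x. 0 \<partial>P)"
  proof (rule nn_integral_cong_AE)
    show "AE x in P. (\<integral>\<^sup>+i. ?h (x i) (recenter i x) \<partial>count_space UNIV) = 0"
      using assms(2) by eventually_elim (auto intro!: nn_integral_zero' AE_I2)
  qed
  finally have "emeasure \<mu> {x \<in> space \<mu>. \<not> A x} = 0" by simp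
  then show ?thesis by (intro AE_I[where N = "{x \<in> space \<mu>. \<not> A x}"]) auto
qed

lemma palm_two_sided: "AE x in \<mu>. x 0 = 0 \<and> two_sided x"
proof (rule AE_palm)
  show "AE x in P. \<forall>i. recenter i x 0 = 0 \<and> two_sided (recenter i x)"
    using numbered by eventually_elim (simp add: recenter_0 two_sided_recenter)
qed measurable

text \<open>
  Take the mean over the points whose k-th predecessor lies in the unit interval, instead of the points
  in the unit interval themselves. A shift of the index turns one sum into the other, and the
  displacement of the interval does not affect its Lebesgue measure.
\<close>

lemma palm_recenter:
  assumes [measurable]: "F \<in> borel_measurable borel"
  shows "(\<integral>\<^sup>+x. F (recenter k x) \<partial>\<mu>) = (\<integral>\<^sup>+x. F x \<partial>\<mu>)"
proof -
  let ?h = "\<lambda>(s::real) (x::int \<Rightarrow> real). if 0 < s \<and> s \<le> 1 then F (recenter k x) else 0"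
  let ?h' = "\<lambda>(s::real) (x::int \<Rightarrow> real). if 0 < s + x (- k) \<and> s + x (- k) \<le> 1 then F x else 0"
  have "(\<integral>\<^sup>+x. F (recenter k x) \<partial>\<mu>) = (\<integral>\<^sup>+x. \<integral>\<^sup>+s. ?h s x \<partial>lborel \<partial>\<mu>)"
    by (intro nn_integral_cong, subst nn_integral_unit_interval[where c = 0, symmetric]) simp
  also have "\<dots> = (\<integral>\<^sup>+x. \<integral>\<^sup>+i. ?h (x i) (recenter i x) \<partial>count_space UNIV \<partial>P)"
    by (rule campbell[symmetric]) measurable
  also have "\<dots> = (\<integral>\<^sup>+x. \<integral>\<^sup>+i. ?h' (x i) (recenter i x) \<partial>count_space UNIV \<partial>P)"
  proof (rule nn_integral_cong)
    fix x
    show "(\<integral>\<^sup>+i. ?h (x i) (recenter i x) \<partial>count_space UNIV) = (\<integral>\<^sup>+i. ?h' (x i) (recenter i x) \<partial>count_space UNIV)"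
      by (subst nn_integral_count_int_shift[where k = k, symmetric])
         (auto intro!: nn_integral_cong simp: recenter_recenter recenter_def add_ac)
  qed
  also have "\<dots> = (\<integral>\<^sup>+x. \<integral>\<^sup>+s. ?h' s x \<partial>lborel \<partial>\<mu>)"
    by (rule campbell) measurable
  also have "\<dots> = (\<integral>\<^sup>+x. F x \<partial>\<mu>)"
    by (simp add: nn_integral_unit_interval)
  finally show ?thesis .
qed

lemma palm_mean_gap: "(\<integral>\<^sup>+x. ennreal (x 1) \<partial>\<mu>) = 1"
proof -
  show ?thesis
    using nn_integral_inversion[of "\<lambda>_. 1"] by (simp add: P.emeasure_space_1 nn_integral_interval)
qed

lemma mean_npoints:
  assumes "a \<le> b"
  shows "(\<integral>\<^sup>+x. npoints {a<..b} x \<partial>P) = ennreal (b - a)"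
proof -
  have "(\<integral>\<^sup>+x. npoints {a<..b} x \<partial>P) = (\<integral>\<^sup>+x. \<integral>\<^sup>+s. indicator {a<..b} s \<partial>lborel \<partial>\<mu>)"
    unfolding npoints_eq_sum by (rule campbell) measurable
  then show ?thesis using assms by (simp add: palm.emeasure_space_1)
qed

lemma palm_eq: "palm P = \<mu>"
proof (rule measure_eqI)
  show "sets (palm P) = sets \<mu>" by (simp add: palm_def sets_palm)
  fix A assume "A \<in> sets (palm P)"
  then have [measurable]: "A \<in> sets borel" by (simp add: palm_def)
  let ?h = "\<lambda>(s::real) (x::int \<Rightarrow> real). if 0 < s \<and> s \<le> 1 then indicator A x else 0 :: ennreal"
  have "emeasure (palm P) A = (\<integral>\<^sup>+y. indicator A y \<partial>palm P)"
    by (simp add: palm_def)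
  also have "\<dots> = (\<integral>\<^sup>+x. \<integral>\<^sup>+i. ?h (x i) (recenter i x) \<partial>count_space UNIV \<partial>P)"
    by (rule nn_integral_palm[OF sets_P]) (use mean_npoints[of 0 1] in simp_all)
  also have "\<dots> = (\<integral>\<^sup>+x. \<integral>\<^sup>+s. ?h s x \<partial>lborel \<partial>\<mu>)"
    by (rule campbell) measurable
  also have "\<dots> = (\<integral>\<^sup>+x. indicator A x \<partial>\<mu>)"
    by (intro nn_integral_cong, subst nn_integral_unit_interval[where c = 0, symmetric]) simp
  also have "\<dots> = emeasure \<mu> A" by simp
  finally show "emeasure (palm P) A = emeasure \<mu> A" .
qed

lemma has_intensity_1: "has_intensity P 1"
proof -
  have "eventually (\<lambda>t. (\<integral>\<^sup>+x. npoints {0<..t} x \<partial>P) / ennreal t = ennreal 1) at_top"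
    using eventually_gt_at_top[of "0 :: real"]
    by eventually_elim (simp add: mean_npoints ennreal_divide_self)
  moreover have "eventually (\<lambda>t. (\<integral>\<^sup>+x. npoints {t<..0} x \<partial>P) / ennreal (- t) = ennreal 1) at_bot"
    using eventually_gt_at_bot[of "0 :: real"]
    by eventually_elim (simp add: mean_npoints ennreal_divide_self)
  ultimately show ?thesis
    unfolding has_intensity_def by (auto intro: tendsto_eventually)
qed

lemma stationary: "stationary P"
  unfolding stationary_def
proof (intro allI impI)
  fix s and B :: "nat \<Rightarrow> real set" assume B: "\<forall>j. B j \<in> sets borel"
  have [measurable]: "B j \<in> sets borel" for j using B by simp
  have sB [measurable]: "(\<lambda>x j. npoints (B j) x) \<in> borel_measurable borel"
    by (rule measurable_coordinatewise_then_product) measurable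
  show "distr P borel (\<lambda>x j. npoints ((+) s ` B j) x) = distr P borel (\<lambda>x j. npoints (B j) x)"
    (is "distr P borel ?f = distr P borel ?g")
  proof (rule measure_eqI)
    fix A assume "A \<in> sets (distr P borel ?f)"
    then have [measurable]: "A \<in> sets borel" by simp
    let ?F = "\<lambda>x. indicator A (\<lambda>j. npoints (B j) x) :: ennreal"
    have f: "?f = (\<lambda>x. ?g (translate (- s) x))" by (simp add: npoints_image_add)
    have [measurable]: "?f \<in> borel_measurable borel" unfolding f by measurable
    have "emeasure (distr P borel ?f) A = (\<integral>\<^sup>+x. indicator A x \<partial>distr P borel ?f)"
      by simp
    also have "\<dots> = (\<integral>\<^sup>+x. ?F (translate (- s) x) \<partial>P)"
      by (subst nn_integral_distr) (simp_all add: npoints_image_add)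
    also have "\<dots> = (\<integral>\<^sup>+x. ?F x \<partial>P)"
      by (rule nn_integral_translate_invariant) (simp_all add: npoints_relabel)
    also have "\<dots> = (\<integral>\<^sup>+x. indicator A x \<partial>distr P borel ?g)"
      by (subst nn_integral_distr) simp_all
    also have "\<dots> = emeasure (distr P borel ?g) A" by simp
    finally show "emeasure (distr P borel ?f) A = emeasure (distr P borel ?g) A" .
  qed simp
qed

lemma point_process: "point_process P"
  unfolding point_process_def
proof (intro conjI)
  show "AE x in P. mono x \<and> x 0 \<le> 0 \<and> 0 < x 1"
    using numbered by eventually_elim (auto dest: two_sidedD)
qed (simp_all add: sets_P P.prob_space_axioms)

end

text \<open>
  The stationary process with a given Palm law: bias by the length of the gap to the right of the
  typical point and put the origin uniformly into that gap.
\<close>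

definition from_palm :: "(int \<Rightarrow> real) measure \<Rightarrow> (int \<Rightarrow> real) measure" where
  "from_palm \<mu> = distr (density (\<mu> \<Otimes>\<^sub>M lborel) (\<lambda>w. indicator {w. 0 \<le> snd w \<and> snd w < fst w 1} w))
     borel (\<lambda>w. translate (- snd w) (fst w))"

lemma nn_integral_from_palm:
  assumes [measurable_cong]: "sets \<mu> = sets borel" and [measurable]: "F \<in> borel_measurable borel"
  shows "(\<integral>\<^sup>+x. F x \<partial>from_palm \<mu>) =
    (\<integral>\<^sup>+x. \<integral>\<^sup>+s. (if 0 \<le> s \<and> s < x 1 then F (translate (- s) x) else 0) \<partial>lborel \<partial>\<mu>)"
proof -
  have "(\<integral>\<^sup>+x. F x \<partial>from_palm \<mu>) = (\<integral>\<^sup>+w. indicator {w. 0 \<le> snd w \<and> snd w < fst w 1} w *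
      F (translate (- snd w) (fst w)) \<partial>(\<mu> \<Otimes>\<^sub>M lborel))"
    unfolding from_palm_def
    by (simp add: nn_integral_distr nn_integral_density del: nn_integral_indicator)
  also have "\<dots> = (\<integral>\<^sup>+x. \<integral>\<^sup>+s. indicator {w. 0 \<le> snd w \<and> snd w < fst w 1} (x, s) *
      F (translate (- s) x) \<partial>lborel \<partial>\<mu>)"
    by (subst lborel.nn_integral_fst[symmetric]) simp_all
  also have "\<dots> = (\<integral>\<^sup>+x. \<integral>\<^sup>+s. (if 0 \<le> s \<and> s < x 1 then F (translate (- s) x) else 0) \<partial>lborel \<partial>\<mu>)"
    by (intro nn_integral_cong) (auto simp: indicator_def)
  finally show ?thesis .
qed

text \<open>
  The origin is placed in the gap to the right of point 0. Seen from point i this is the gap to the right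
  of point -i, so by invariance the terms of the sum over the points i are integrals over the
  different gaps of one configuration, and together these gaps cover the line.
\<close>

lemma palm_pair_from_palm:
  assumes "prob_space \<mu>" and sets [measurable_cong]: "sets \<mu> = sets borel"
    and two: "AE x in \<mu>. x 0 = 0 \<and> two_sided x"
    and inv: "\<And>F k. F \<in> borel_measurable borel \<Longrightarrow> (\<integral>\<^sup>+x. F (recenter k x) \<partial>\<mu>) = (\<integral>\<^sup>+x. F x \<partial>\<mu>)"
    and mean: "(\<integral>\<^sup>+x. ennreal (x 1) \<partial>\<mu>) = 1"
  shows "palm_pair (from_palm \<mu>) \<mu>"
proof -
  interpret prob_space \<mu> by fact
  note nn = nn_integral_from_palm[OF sets]
  have sets_from [simp]: "sets (from_palm \<mu>) = sets borel" by (simp add: from_palm_def)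
  then have space_from [simp]: "space (from_palm \<mu>) = UNIV" using sets_eq_imp_space_eq by fastforce
  have prob: "prob_space (from_palm \<mu>)"
    using nn[of "\<lambda>_. 1"] mean by (intro prob_spaceI) (simp add: nn_integral_interval)
  have num: "AE x in from_palm \<mu>. two_sided x \<and> x 0 \<le> 0 \<and> 0 < x 1"
  proof -
    let ?A = "\<lambda>x. two_sided x \<and> x 0 \<le> 0 \<and> 0 < x 1"
    have "emeasure (from_palm \<mu>) {x. \<not> ?A x} = (\<integral>\<^sup>+x. indicator {x. \<not> ?A x} x \<partial>from_palm \<mu>)"
      by (subst nn_integral_indicator) simp_all
    also have "\<dots> = (\<integral>\<^sup>+x. \<integral>\<^sup>+s. (if 0 \<le> s \<and> s < x 1 then indicator {x. \<not> ?A x} (translate (- s) x) else 0)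
        \<partial>lborel \<partial>\<mu>)"
      by (rule nn) measurable
    also have "\<dots> = (\<integral>\<^sup>+x. 0 \<partial>\<mu>)"
    proof (rule nn_integral_cong_AE)
      show "AE x in \<mu>. (\<integral>\<^sup>+s. (if 0 \<le> s \<and> s < x 1 then indicator {x. \<not> ?A x} (translate (- s) x) else 0)
        \<partial>lborel) = (0 :: ennreal)"
        using two
      proof eventually_elim
        case (elim x)
        have "(\<integral>\<^sup>+s. (if 0 \<le> s \<and> s < x 1 then indicator {x. \<not> ?A x} (translate (- s) x) else 0) \<partial>lborel)
          = (\<integral>\<^sup>+(s::real). (0 :: ennreal) \<partial>lborel)"
        proof (rule nn_integral_cong)
          fix s :: real
          show "(if 0 \<le> s \<and> s < x 1 then indicator {x. \<not> ?A x} (translate (- s) x) else 0) = (0 :: ennreal)"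
            using elim two_sided_translate[of x "- s"] by (auto simp: indicator_def) (simp_all add: translate_def)
        qed
        then show ?case by simp
      qed
    qed
    finally show ?thesis by (intro AE_I[where N = "{x. \<not> ?A x}"]) auto
  qed
  have camp: "(\<integral>\<^sup>+x. \<integral>\<^sup>+i. h (x i, recenter i x) \<partial>count_space UNIV \<partial>from_palm \<mu>) =
      (\<integral>\<^sup>+x. \<integral>\<^sup>+s. h (s, x) \<partial>lborel \<partial>\<mu>)"
    if h [measurable]: "h \<in> borel_measurable (borel \<Otimes>\<^sub>M borel)" for h
  proof -
    \<comment> \<open>Here r is the place of the origin when point i sits at 0.\<close>
    define G where "G i y = (\<integral>\<^sup>+r. (if y (- i) \<le> r \<and> r < y (1 - i) then h (- r, y) else 0) \<partial>lborel)" for i y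
    have [measurable]: "G i \<in> borel_measurable borel" for i
      unfolding G_def by measurable
    have "(\<integral>\<^sup>+x. \<integral>\<^sup>+i. h (x i, recenter i x) \<partial>count_space UNIV \<partial>from_palm \<mu>) =
      (\<integral>\<^sup>+i. \<integral>\<^sup>+x. h (x i, recenter i x) \<partial>from_palm \<mu> \<partial>count_space UNIV)"
      by (rule nn_integral_count_space_nn_integral)
         (auto simp: measurable_cong_sets[OF sets_from refl])
    also have "\<dots> = (\<integral>\<^sup>+i. \<integral>\<^sup>+x. G i (recenter i x) \<partial>\<mu> \<partial>count_space UNIV)"
    proof (rule nn_integral_cong)
      fix i :: int
      have "(\<integral>\<^sup>+x. h (x i, recenter i x) \<partial>from_palm \<mu>) =
        (\<integral>\<^sup>+x. \<integral>\<^sup>+s. (if 0 \<le> s \<and> s < x 1 then h (x i - s, recenter i x) else 0) \<partial>lborel \<partial>\<mu>)"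
        using nn[of "\<lambda>x. h (x i, recenter i x)"]
        by (simp add: recenter_translate translate_apply cong: if_cong)
      also have "\<dots> = (\<integral>\<^sup>+x. G i (recenter i x) \<partial>\<mu>)"
      proof (rule nn_integral_cong_AE)
        show "AE x in \<mu>. (\<integral>\<^sup>+s. (if 0 \<le> s \<and> s < x 1 then h (x i - s, recenter i x) else 0) \<partial>lborel) =
            G i (recenter i x)"
          using two
        proof eventually_elim
          case (elim x)
          have "(\<integral>\<^sup>+s. (if 0 \<le> s \<and> s < x 1 then h (x i - s, recenter i x) else 0) \<partial>lborel) =
            (\<integral>\<^sup>+r. (if 0 \<le> x i + r \<and> x i + r < x 1 then h (x i - (x i + r), recenter i x) else 0) \<partial>lborel)"
            by (rule nn_integral_translate_lborel[symmetric]) measurable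
          also have "\<dots> = G i (recenter i x)"
            unfolding G_def by (intro nn_integral_cong) (use elim in \<open>auto simp: recenter_def\<close>)
          finally show ?case .
        qed
      qed
      finally show "(\<integral>\<^sup>+x. h (x i, recenter i x) \<partial>from_palm \<mu>) = (\<integral>\<^sup>+x. G i (recenter i x) \<partial>\<mu>)" .
    qed
    also have "\<dots> = (\<integral>\<^sup>+i. \<integral>\<^sup>+x. G i x \<partial>\<mu> \<partial>count_space UNIV)"
      by (intro nn_integral_cong inv) measurable
    also have "\<dots> = (\<integral>\<^sup>+x. \<integral>\<^sup>+i. G i x \<partial>count_space UNIV \<partial>\<mu>)"
      by (rule nn_integral_count_space_nn_integral[symmetric]) measurable
    also have "\<dots> = (\<integral>\<^sup>+x. \<integral>\<^sup>+s. h (s, x) \<partial>lborel \<partial>\<mu>)"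
    proof (rule nn_integral_cong_AE)
      show "AE x in \<mu>. (\<integral>\<^sup>+i. G i x \<partial>count_space UNIV) = (\<integral>\<^sup>+s. h (s, x) \<partial>lborel)"
        using two
      proof eventually_elim
        case (elim x)
        have "(\<integral>\<^sup>+i. G i x \<partial>count_space UNIV) = (\<integral>\<^sup>+r. \<integral>\<^sup>+i. (if x (- i) \<le> r \<and> r < x (1 - i) then h (- r, x) else 0)
            \<partial>count_space UNIV \<partial>lborel)"
          unfolding G_def by (rule nn_integral_count_space_nn_integral[symmetric]) measurable
        also have "\<dots> = (\<integral>\<^sup>+r. h (- r, x) \<partial>lborel)"
        proof (rule nn_integral_cong)
          fix r :: real
          have "(\<integral>\<^sup>+i. (if x (- i) \<le> r \<and> r < x (1 - i) then h (- r, x) else 0) \<partial>count_space UNIV) =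
            (\<integral>\<^sup>+i. (if x i \<le> r \<and> r < x (i + 1) then h (- r, x) else 0) \<partial>count_space UNIV)"
            using nn_integral_bij_count_space[of uminus "UNIV :: int set" "UNIV :: int set"
                "\<lambda>i. if x i \<le> r \<and> r < x (i + 1) then h (- r, x) else 0"]
            by (simp add: bij_uminus add.commute)
          then show "(\<integral>\<^sup>+i. (if x (- i) \<le> r \<and> r < x (1 - i) then h (- r, x) else 0) \<partial>count_space UNIV) = h (- r, x)"
            using elim by (simp add: nn_integral_crossing_const)
        qed
        also have "\<dots> = (\<integral>\<^sup>+s. h (s, x) \<partial>lborel)"
          by (rule nn_integral_reflect_lborel) measurable
        finally show ?case .
      qed
    qed
    finally show ?thesis .
  qed
  show ?thesis
    by (intro palm_pair.intro palm_pair_axioms.intro) (fact prob sets_from sets num camp assms)+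
qed

section \<open>Fair moves\<close>

lemma measurable_resample:
  "(\<lambda>(m, r) i. if i \<in> J then r i else m i) \<in> measurable (PiM UNIV M \<Otimes>\<^sub>M PiM UNIV M) (PiM UNIV M)"
  unfolding split_beta'
proof (rule measurable_abs_UNIV)
  fix i
  have c: "(\<lambda>x. x i) \<in> measurable (PiM UNIV M) (M i)" by (rule measurable_component_singleton) simp
  show "(\<lambda>w. if i \<in> J then snd w i else fst w i) \<in> measurable (PiM UNIV M \<Otimes>\<^sub>M PiM UNIV M) (M i)"
    using measurable_compose[OF measurable_snd c] measurable_compose[OF measurable_fst c]
    by (cases "i \<in> J") simp_all
qed

text \<open>
  The measure of a cylinder set factors into the coordinates in J and the others. With J a single
  coordinate this is conditioning on one move, with J the moves of one time conditioning on all others.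
\<close>

lemma distr_PiM_resample:
  assumes "\<And>i. prob_space (M i)"
  shows "distr (PiM UNIV M \<Otimes>\<^sub>M PiM UNIV M) (PiM UNIV M) (\<lambda>(m, r) i. if i \<in> J then r i else m i) = PiM UNIV M"
    (is "?D = _")
proof -
  interpret prob_space "M i" for i by fact
  interpret product_prob_space M UNIV by unfold_locales
  let ?f = "\<lambda>(m, r) i. if i \<in> J then r i else m i"
  have f [measurable]: "?f \<in> measurable (PiM UNIV M \<Otimes>\<^sub>M PiM UNIV M) (PiM UNIV M)"
    by (rule measurable_resample)
  show ?thesis
  proof (rule PiM_eq)
    fix K E assume K: "finite K" "K \<subseteq> UNIV" "\<And>j. j \<in> K \<Longrightarrow> E j \<in> sets (M j)"
    let ?X = "prod_emb UNIV M K (\<Pi>\<^sub>E j\<in>K. E j)"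
    have "?f -` ?X \<inter> space (PiM UNIV M \<Otimes>\<^sub>M PiM UNIV M) =
      prod_emb UNIV M (K - J) (\<Pi>\<^sub>E j\<in>K - J. E j) \<times> prod_emb UNIV M (K \<inter> J) (\<Pi>\<^sub>E j\<in>K \<inter> J. E j)"
      by (auto simp: space_pair_measure space_PiM prod_emb_def PiE_iff split: if_splits)
    then have "emeasure ?D ?X = emeasure (PiM UNIV M) (prod_emb UNIV M (K - J) (\<Pi>\<^sub>E j\<in>K - J. E j)) *
        emeasure (PiM UNIV M) (prod_emb UNIV M (K \<inter> J) (\<Pi>\<^sub>E j\<in>K \<inter> J. E j))"
      using K by (subst emeasure_distr[OF f]) (auto intro!: sets_PiM_I P.emeasure_pair_measure_Times)
    also have "\<dots> = (\<Prod>j\<in>K - J. emeasure (M j) (E j)) * (\<Prod>j\<in>K \<inter> J. emeasure (M j) (E j))"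
      using K by (intro arg_cong2[where f = "(*)"] emeasure_PiM_emb) auto
    also have "\<dots> = (\<Prod>j\<in>K. emeasure (M j) (E j))"
      using K(1) by (metis Int_commute mult.commute prod.Int_Diff)
    finally show "emeasure ?D ?X = (\<Prod>j\<in>K. emeasure (M j) (E j))" .
  qed simp
qed

lemma nn_integral_PiM_resample:
  assumes M: "\<And>i. prob_space (M i)" and [measurable]: "F \<in> borel_measurable (PiM UNIV M)"
  shows "(\<integral>\<^sup>+m. F m \<partial>PiM UNIV M) =
    (\<integral>\<^sup>+m. \<integral>\<^sup>+r. F (\<lambda>i. if i \<in> J then r i else m i) \<partial>PiM UNIV M \<partial>PiM UNIV M)"
proof -
  interpret prob_space "PiM UNIV M" by (rule prob_space_PiM) (rule M)
  have f [measurable]: "(\<lambda>(m, r) i. if i \<in> J then r i else m i) \<in> measurable (PiM UNIV M \<Otimes>\<^sub>M PiM UNIV M) (PiM UNIV M)"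
    by (rule measurable_resample)
  have "(\<integral>\<^sup>+m. F m \<partial>PiM UNIV M) =
    (\<integral>\<^sup>+w. F ((\<lambda>(m, r) i. if i \<in> J then r i else m i) w) \<partial>(PiM UNIV M \<Otimes>\<^sub>M PiM UNIV M))"
    by (subst distr_PiM_resample[where M = M and J = J, OF M, symmetric]) (simp add: nn_integral_distr)
  then show ?thesis by (subst (asm) nn_integral_fst[symmetric]) simp_all
qed

definition fair_bits :: "(int \<Rightarrow> bool) measure" where
  "fair_bits = PiM UNIV (\<lambda>_. measure_pmf (bernoulli_pmf (1 / 2)))"

lemma sets_fair_bits [measurable_cong]: "sets fair_bits = sets move_space"
  unfolding fair_bits_def by (rule sets_PiM_cong) (simp_all add: sets_measure_pmf_count_space)

lemma space_fair_bits [simp]: "space fair_bits = UNIV"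
  by (simp add: fair_bits_def space_PiM)

lemma prob_space_fair_bits: "prob_space fair_bits"
  unfolding fair_bits_def by (intro prob_space_PiM measure_pmf.prob_space_axioms)

interpretation fair_bits: prob_space fair_bits
  by (rule prob_space_fair_bits)

lemma nn_integral_fair_bits_shift:
  assumes [measurable]: "F \<in> borel_measurable move_space"
  shows "(\<integral>\<^sup>+m. F (\<lambda>j. m (k + j)) \<partial>fair_bits) = (\<integral>\<^sup>+m. F m \<partial>fair_bits)"
proof -
  have "distr fair_bits fair_bits (\<lambda>m j. m (k + j)) = fair_bits"
    unfolding fair_bits_def
    using distr_PiM_reindex[of UNIV "\<lambda>_. measure_pmf (bernoulli_pmf (1 / 2))" "\<lambda>j. k + j" UNIV]
    by (simp add: measure_pmf.prob_space_axioms restrict_def)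
  moreover have "(\<lambda>m j. m (k + j)) \<in> measurable fair_bits fair_bits"
    using measurable_shift_moves[of "\<lambda>m. m" fair_bits k] by measurable
  ultimately show ?thesis
    using nn_integral_distr[of "\<lambda>m j. m (k + j)" fair_bits fair_bits F] by simp
qed

lemma nn_integral_bernoulli_half:
  "(\<integral>\<^sup>+b. f b \<partial>measure_pmf (bernoulli_pmf (1 / 2))) = ennreal (1 / 2) * f True + ennreal (1 / 2) * f False"
  by (subst nn_integral_bernoulli_pmf) (simp_all add: mult.commute)

lemma measurable_fun_upd_move:
  "(\<lambda>m. m(k := b)) \<in> measurable move_space move_space"
proof (rule measurable_abs_UNIV)
  fix n
  show "(\<lambda>m. (m(k := b)) n) \<in> measurable move_space (count_space UNIV)"
    by (cases "n = k") simp_all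
qed

lemma nn_integral_fair_bits_split:
  assumes [measurable]: "F \<in> borel_measurable move_space"
  shows "(\<integral>\<^sup>+m. F m \<partial>fair_bits) =
    ennreal (1 / 2) * (\<integral>\<^sup>+m. F (m(k := True)) \<partial>fair_bits) +
    ennreal (1 / 2) * (\<integral>\<^sup>+m. F (m(k := False)) \<partial>fair_bits)"
proof -
  let ?B = "measure_pmf (bernoulli_pmf (1 / 2))"
  have upd: "(\<lambda>i. if i \<in> {k} then r i else m i) = m(k := r k)" for m r :: "int \<Rightarrow> bool" by auto
  have [measurable]: "F \<in> borel_measurable (PiM UNIV (\<lambda>_. ?B))"
    using assms sets_fair_bits unfolding fair_bits_def by (simp cong: measurable_cong_sets)
  have [measurable]: "(\<lambda>m. F (m(k := b))) \<in> borel_measurable fair_bits" for b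
    using measurable_compose[OF measurable_fun_upd_move assms] by measurable
  have "(\<integral>\<^sup>+m. F m \<partial>fair_bits) = (\<integral>\<^sup>+m. \<integral>\<^sup>+r. F (m(k := r k)) \<partial>fair_bits \<partial>fair_bits)"
    unfolding fair_bits_def
    by (subst nn_integral_PiM_resample[of _ _ "{k}"]) (simp_all only: upd, simp_all add: measure_pmf.prob_space_axioms)
  moreover have "(\<integral>\<^sup>+r. F (m(k := r k)) \<partial>fair_bits) = (\<integral>\<^sup>+b. F (m(k := b)) \<partial>?B)" for m
    by (subst distr_PiM_component[of UNIV "\<lambda>_. ?B" k, symmetric])
       (simp_all add: measure_pmf.prob_space_axioms nn_integral_distr fair_bits_def)
  ultimately show ?thesis
    by (simp add: nn_integral_bernoulli_half nn_integral_add nn_integral_cmult)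
qed

section \<open>One step of the dynamics\<close>

lemma occupied_prob: "(\<integral>\<^sup>+m. indicator {m. occupied m 0} m \<partial>fair_bits) = ennreal (3 / 4)"
proof -
  have "(\<integral>\<^sup>+m. indicator {m. occupied m 0} m \<partial>fair_bits) =
     ennreal (1 / 2) + ennreal (1 / 2) * (\<integral>\<^sup>+m. of_bool (\<not> m 1) \<partial>fair_bits)"
    by (subst nn_integral_fair_bits_split[of _ 0])
       (simp_all add: occupied_def indicator_def fair_bits.emeasure_space_1[simplified])
  also have "(\<integral>\<^sup>+m. of_bool (\<not> m 1) \<partial>fair_bits) = ennreal (1 / 2)"
    by (subst nn_integral_fair_bits_split[of _ 1])
       (simp_all add: indicator_def fair_bits.emeasure_space_1[simplified])
  also have "ennreal (1 / 2) + ennreal (1 / 2) * ennreal (1 / 2) = ennreal (1 / 2 + 1 / 2 * (1 / 2))"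
    by (simp only: ennreal_plus ennreal_mult zero_le_divide_1_iff zero_le_numeral mult_nonneg_nonneg)
  finally show ?thesis by simp
qed

text \<open>
  A new point arises in three quarters of the gaps, so the moves seen from a typical new point
  are fair moves conditioned on the event that gap 0 is occupied.
\<close>

definition palm_moves :: "(int \<Rightarrow> bool) measure" where
  "palm_moves = density fair_bits (\<lambda>m. ennreal (4 / 3) * indicator {m. occupied m 0} m)"

lemma sets_palm_moves [measurable_cong]: "sets palm_moves = sets move_space"
  by (simp add: palm_moves_def sets_fair_bits)

lemma space_palm_moves [simp]: "space palm_moves = UNIV"
  by (simp add: palm_moves_def)

lemma nn_integral_palm_moves:
  assumes [measurable]: "F \<in> borel_measurable move_space"
  shows "(\<integral>\<^sup>+m. F m \<partial>palm_moves) = ennreal (4 / 3) * (\<integral>\<^sup>+m. indicator {m. occupied m 0} m * F m \<partial>fair_bits)"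
  unfolding palm_moves_def
  by (subst nn_integral_density) (simp_all add: nn_integral_cmult[symmetric] mult.assoc)

interpretation palm_moves: prob_space palm_moves
proof
  have "emeasure palm_moves (space palm_moves) = (\<integral>\<^sup>+m. 1 \<partial>palm_moves)" by simp
  also have "\<dots> = 1"
    by (subst nn_integral_palm_moves) (simp_all add: occupied_prob flip: ennreal_mult)
  finally show "emeasure palm_moves (space palm_moves) = 1" .
qed

lemma AE_palm_moves_occupied: "AE m in palm_moves. occupied m 0"
  unfolding palm_moves_def by (subst AE_density) (auto simp: indicator_def)

definition step_law :: "(int \<Rightarrow> real) measure \<Rightarrow> (int \<Rightarrow> real) measure" where
  "step_law P = distr (P \<Otimes>\<^sub>M fair_bits) borel (\<lambda>w. cluster_step (snd w) (fst w))"

definition palm_step_law :: "(int \<Rightarrow> real) measure \<Rightarrow> (int \<Rightarrow> real) measure" where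
  "palm_step_law \<mu> = distr (palm_moves \<Otimes>\<^sub>M \<mu>) borel (\<lambda>w. palm_step (fst w) (snd w))"

lemma nn_integral_step_law:
  assumes [measurable_cong]: "sets P = sets borel" and [measurable]: "F \<in> borel_measurable borel"
  shows "(\<integral>\<^sup>+x. F x \<partial>step_law P) = (\<integral>\<^sup>+x. \<integral>\<^sup>+m. F (cluster_step m x) \<partial>fair_bits \<partial>P)"
  unfolding step_law_def
  by (subst nn_integral_distr, measurable, subst fair_bits.nn_integral_fst[symmetric]) simp_all

lemma nn_integral_palm_step_law:
  assumes "prob_space \<mu>" and [measurable_cong]: "sets \<mu> = sets borel" and [measurable]: "F \<in> borel_measurable borel"
  shows "(\<integral>\<^sup>+x. F x \<partial>palm_step_law \<mu>) = (\<integral>\<^sup>+m. \<integral>\<^sup>+x. F (palm_step m x) \<partial>\<mu> \<partial>palm_moves)"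
proof -
  interpret prob_space \<mu> by fact
  show ?thesis unfolding palm_step_law_def
    by (subst nn_integral_distr, measurable, subst nn_integral_fst[symmetric]) simp_all
qed

lemma prob_space_palm_step_law:
  assumes "prob_space \<mu>" and [measurable_cong]: "sets \<mu> = sets borel"
  shows "prob_space (palm_step_law \<mu>)"
proof -
  interpret prob_space \<mu> by fact
  interpret pair_prob_space palm_moves \<mu> by unfold_locales
  show ?thesis unfolding palm_step_law_def by (rule prob_space_distr) measurable
qed

lemma (in palm_pair) AE_step_law:
  assumes [measurable]: "Measurable.pred borel A" and "AE x in P. \<forall>m. A (cluster_step m x)"
  shows "AE x in step_law P. A x"
proof -
  interpret PF: pair_prob_space P fair_bits by unfold_locales
  have "AE w in P \<Otimes>\<^sub>M fair_bits. A (cluster_step (snd w) (fst w))"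
    by (rule PF.AE_pair_measure) (use assms(2) in \<open>auto elim: eventually_mono\<close>)
  then show ?thesis unfolding step_law_def by (subst AE_distr_iff) simp_all
qed

lemma nn_integral_affine_scale:
  fixes g :: "real \<Rightarrow> ennreal"
  assumes "g \<in> borel_measurable borel"
  shows "(\<integral>\<^sup>+s. g (3 / 4 * (s + c)) \<partial>lborel) = ennreal (4 / 3) * (\<integral>\<^sup>+s. g s \<partial>lborel)"
proof -
  have "(\<integral>\<^sup>+s. g s \<partial>lborel) = ennreal (3 / 4) * (\<integral>\<^sup>+s. g (3 / 4 * (s + c)) \<partial>lborel)"
    using nn_integral_real_affine[OF assms, of "3 / 4" "3 / 4 * c"]
    by (simp add: distrib_left add.commute del: times_divide_eq_left times_divide_eq_right)
  then show ?thesis by (simp add: mult.assoc[symmetric] flip: ennreal_mult)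
qed

text \<open>
  The new points are summed over the old gaps that contain them. The fair moves seen from any old point
  have the same law, so the moves can be integrated out gap by gap, which leaves a sum over the
  old points to which the Campbell formula applies. The scaling by 3/4 stretches Lebesgue measure by
  4/3, and this is the constant that conditions on an occupied gap.
\<close>

lemma (in palm_pair) palm_pair_step:
  assumes strict: "AE x in P. strict_mono x"
  shows "palm_pair (step_law P) (palm_step_law \<mu>)" "AE x in step_law P. strict_mono x"
proof -
  have good: "AE x in P. strict_mono x \<and> two_sided x"
    using strict numbered by eventually_elim auto
  show "AE x in step_law P. strict_mono x"
    by (rule AE_step_law, simp, use good in eventually_elim) (simp add: mono_cluster_step)
  have num: "AE x in step_law P. two_sided x \<and> x 0 \<le> 0 \<and> 0 < x 1"
    by (rule AE_step_law, simp, use good in eventually_elim) (simp add: mono_cluster_step)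
  have sets_step [measurable_cong]: "sets (step_law P) = sets borel"
    "sets (palm_step_law \<mu>) = sets borel" by (simp_all add: step_law_def palm_step_law_def)
  have prob: "prob_space (step_law P)"
  proof -
    interpret PF: pair_prob_space P fair_bits by unfold_locales
    show ?thesis unfolding step_law_def by (rule PF.prob_space_distr) measurable
  qed
  have camp: "(\<integral>\<^sup>+x. \<integral>\<^sup>+i. h (x i, recenter i x) \<partial>count_space UNIV \<partial>step_law P) =
      (\<integral>\<^sup>+x. \<integral>\<^sup>+s. h (s, x) \<partial>lborel \<partial>palm_step_law \<mu>)"
    if h [measurable]: "h \<in> borel_measurable (borel \<Otimes>\<^sub>M borel)" for h
  proof -
    note [measurable] = measurable_shift_moves
    define H where "H s x = (\<integral>\<^sup>+m. indicator {m. occupied m 0} m * h (3 / 4 * (s + midpt x 0), palm_step m x) \<partial>fair_bits)"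
      for s x
    have H: "(\<lambda>w. H (fst w) (snd w)) \<in> borel_measurable (borel \<Otimes>\<^sub>M borel)"
      unfolding H_def by measurable
    have [measurable]: "(\<lambda>x. \<integral>\<^sup>+i. h (x i, recenter i x) \<partial>count_space UNIV) \<in> borel_measurable borel"
      by (rule measurable_sum_points) measurable
    have "(\<integral>\<^sup>+x. \<integral>\<^sup>+i. h (x i, recenter i x) \<partial>count_space UNIV \<partial>step_law P) =
      (\<integral>\<^sup>+x. \<integral>\<^sup>+m. \<integral>\<^sup>+k. h (cluster_step m x k, recenter k (cluster_step m x)) \<partial>count_space UNIV \<partial>fair_bits \<partial>P)"
      by (rule nn_integral_step_law[OF sets_P]) measurable
    also have "\<dots> = (\<integral>\<^sup>+x. \<integral>\<^sup>+j. H (x j) (recenter j x) \<partial>count_space UNIV \<partial>P)"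
    proof (rule nn_integral_cong_AE)
      show "AE x in P. (\<integral>\<^sup>+m. \<integral>\<^sup>+k. h (cluster_step m x k, recenter k (cluster_step m x)) \<partial>count_space UNIV \<partial>fair_bits) =
          (\<integral>\<^sup>+j. H (x j) (recenter j x) \<partial>count_space UNIV)"
        using good
      proof eventually_elim
        case (elim x)
        let ?g = "\<lambda>j m. indicator {m. occupied m 0} m * h (3 / 4 * midpt x j, palm_step m (recenter j x))"
        have [measurable]: "?g j \<in> borel_measurable move_space" for j by measurable
        have "(\<integral>\<^sup>+m. \<integral>\<^sup>+k. h (cluster_step m x k, recenter k (cluster_step m x)) \<partial>count_space UNIV \<partial>fair_bits) =
          (\<integral>\<^sup>+m. \<integral>\<^sup>+j. ?g j (\<lambda>l. m (j + l)) \<partial>count_space UNIV \<partial>fair_bits)"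
          using elim
          by (intro nn_integral_cong[of fair_bits],
              subst nn_integral_cluster_step_points[where h = "\<lambda>s x. h (s, x)"])
             (auto simp: indicator_def occupied_shift intro!: nn_integral_cong)
        also have "\<dots> = (\<integral>\<^sup>+j. \<integral>\<^sup>+m. ?g j (\<lambda>l. m (j + l)) \<partial>fair_bits \<partial>count_space UNIV)"
        proof (rule nn_integral_count_space_nn_integral)
          fix j
          have "(\<lambda>m l. m (j + l)) \<in> measurable fair_bits move_space"
            using measurable_shift_moves[of "\<lambda>m. m" fair_bits j] by measurable
          then show "(\<lambda>m. ?g j (\<lambda>l. m (j + l))) \<in> borel_measurable fair_bits"
            by (rule measurable_compose[of _ _ _ "?g j"]) measurable
        qed simp
        also have "\<dots> = (\<integral>\<^sup>+j. \<integral>\<^sup>+m. ?g j m \<partial>fair_bits \<partial>count_space UNIV)"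
          by (intro nn_integral_cong nn_integral_fair_bits_shift[of "?g j" j for j]) measurable
        also have "\<dots> = (\<integral>\<^sup>+j. H (x j) (recenter j x) \<partial>count_space UNIV)"
          by (simp add: H_def midpt_recenter)
        finally show ?case .
      qed
    qed
    also have "\<dots> = (\<integral>\<^sup>+x. \<integral>\<^sup>+s. H s x \<partial>lborel \<partial>\<mu>)"
      by (rule campbell[OF H])
    also have "\<dots> = (\<integral>\<^sup>+x. ennreal (4 / 3) *
        (\<integral>\<^sup>+m. indicator {m. occupied m 0} m * (\<integral>\<^sup>+s. h (s, palm_step m x) \<partial>lborel) \<partial>fair_bits) \<partial>\<mu>)"
    proof (rule nn_integral_cong)
      fix x
      interpret LF: pair_sigma_finite lborel fair_bits by unfold_locales
      have "(\<integral>\<^sup>+s. H s x \<partial>lborel) = (\<integral>\<^sup>+m. \<integral>\<^sup>+s. indicator {m. occupied m 0} m * h (3 / 4 * (s + midpt x 0), palm_step m x)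
          \<partial>lborel \<partial>fair_bits)"
        unfolding H_def by (rule LF.Fubini'[symmetric]) measurable
      also have "\<dots> = (\<integral>\<^sup>+m. ennreal (4 / 3) * (indicator {m. occupied m 0} m * (\<integral>\<^sup>+s. h (s, palm_step m x) \<partial>lborel)) \<partial>fair_bits)"
      proof (rule nn_integral_cong)
        fix m
        have "(\<integral>\<^sup>+s. h (3 / 4 * (s + midpt x 0), palm_step m x) \<partial>lborel) = ennreal (4 / 3) * (\<integral>\<^sup>+s. h (s, palm_step m x) \<partial>lborel)"
          by (rule nn_integral_affine_scale) measurable
        then show "(\<integral>\<^sup>+s. indicator {m. occupied m 0} m * h (3 / 4 * (s + midpt x 0), palm_step m x) \<partial>lborel) =
            ennreal (4 / 3) * (indicator {m. occupied m 0} m * (\<integral>\<^sup>+s. h (s, palm_step m x) \<partial>lborel))"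
          by (subst nn_integral_cmult) (simp_all add: mult_ac)
      qed
      also have "\<dots> = ennreal (4 / 3) *
        (\<integral>\<^sup>+m. indicator {m. occupied m 0} m * (\<integral>\<^sup>+s. h (s, palm_step m x) \<partial>lborel) \<partial>fair_bits)"
        by (rule nn_integral_cmult) measurable
      finally show "(\<integral>\<^sup>+s. H s x \<partial>lborel) = ennreal (4 / 3) *
        (\<integral>\<^sup>+m. indicator {m. occupied m 0} m * (\<integral>\<^sup>+s. h (s, palm_step m x) \<partial>lborel) \<partial>fair_bits)" .
    qed
    also have "\<dots> = (\<integral>\<^sup>+x. \<integral>\<^sup>+m. (\<integral>\<^sup>+s. h (s, palm_step m x) \<partial>lborel) \<partial>palm_moves \<partial>\<mu>)"
      by (intro nn_integral_cong nn_integral_palm_moves[symmetric]) measurable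
    also have "\<dots> = (\<integral>\<^sup>+m. \<integral>\<^sup>+x. (\<integral>\<^sup>+s. h (s, palm_step m x) \<partial>lborel) \<partial>\<mu> \<partial>palm_moves)"
    proof -
      interpret MP: pair_prob_space \<mu> palm_moves by unfold_locales
      show ?thesis by (rule MP.Fubini'[symmetric]) measurable
    qed
    also have "\<dots> = (\<integral>\<^sup>+x. \<integral>\<^sup>+s. h (s, x) \<partial>lborel \<partial>palm_step_law \<mu>)"
      by (subst nn_integral_palm_step_law[OF palm.prob_space_axioms sets_palm]) simp_all
    finally show ?thesis .
  qed
  show "palm_pair (step_law P) (palm_step_law \<mu>)"
    by (intro palm_pair.intro palm_pair_axioms.intro)
       (fact prob sets_step num camp prob_space_palm_step_law[OF palm.prob_space_axioms sets_palm])+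
qed

section \<open>The law after several steps\<close>

abbreviation all_moves_space :: "(nat \<times> int \<Rightarrow> bool) measure" where
  "all_moves_space \<equiv> PiM UNIV (\<lambda>_. count_space UNIV)"

lemma sets_fair_moves [measurable_cong]: "sets fair_moves = sets all_moves_space"
  unfolding fair_moves_def by (rule sets_PiM_cong) (simp_all add: sets_measure_pmf_count_space)

interpretation fair_moves: prob_space fair_moves
  unfolding fair_moves_def by (intro prob_space_PiM measure_pmf.prob_space_axioms)

lemma measurable_move_row:
  assumes "g \<in> measurable N all_moves_space"
  shows "(\<lambda>w i. g w (t, i)) \<in> measurable N move_space"
  by (rule measurable_abs_UNIV, rule measurable_compose[OF assms measurable_component_singleton]) simp

lemma measurable_clustering [measurable (raw)]:
  assumes [measurable]: "f \<in> borel_measurable N" and g: "g \<in> measurable N all_moves_space"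
  shows "(\<lambda>w. clustering (f w) (g w) t) \<in> borel_measurable N"
proof (induction t)
  case (Suc t)
  then show ?case
    by (simp only: clustering.simps) (rule measurable_cluster_step[OF measurable_move_row[OF g]])
qed simp

lemma clustering_cong:
  "(\<And>s i. s < t \<Longrightarrow> m (s, i) = m' (s, i)) \<Longrightarrow> clustering x m t = clustering x m' t"
proof (induction t)
  case (Suc t)
  then have "clustering x m t = clustering x m' t" "(\<lambda>i. m (t, i)) = (\<lambda>i. m' (t, i))" by auto
  then show ?case by simp
qed simp

lemma nn_integral_fair_moves_row:
  assumes [measurable]: "F \<in> borel_measurable all_moves_space"
  shows "(\<integral>\<^sup>+m. F m \<partial>fair_moves) =
    (\<integral>\<^sup>+m. \<integral>\<^sup>+r. F (\<lambda>p. if fst p = t then r (snd p) else m p) \<partial>fair_bits \<partial>fair_moves)"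
proof -
  let ?B = "measure_pmf (bernoulli_pmf (1 / 2))"
  have mF: "F \<in> borel_measurable (PiM UNIV (\<lambda>_. ?B))"
    using assms sets_fair_moves unfolding fair_moves_def by (simp cong: measurable_cong_sets)
  have upd: "(\<lambda>i. if i \<in> {t} \<times> UNIV then r i else m i) = (\<lambda>p. if fst p = t then r (t, snd p) else m p)"
    for m r :: "nat \<times> int \<Rightarrow> bool" by auto
  have "(\<integral>\<^sup>+m. F m \<partial>fair_moves) =
    (\<integral>\<^sup>+m. \<integral>\<^sup>+r. F (\<lambda>p. if fst p = t then r (t, snd p) else m p) \<partial>fair_moves \<partial>fair_moves)"
    unfolding fair_moves_def
    by (subst nn_integral_PiM_resample[OF measure_pmf.prob_space_axioms mF, of "{t} \<times> UNIV"]) (simp only: upd)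
  moreover have "(\<integral>\<^sup>+r. F (\<lambda>p. if fst p = t then r (t, snd p) else m p) \<partial>fair_moves) =
     (\<integral>\<^sup>+r. F (\<lambda>p. if fst p = t then r (snd p) else m p) \<partial>fair_bits)" for m
  proof -
    have d: "distr fair_moves fair_bits (\<lambda>r i. r (t, i)) = fair_bits"
      unfolding fair_bits_def fair_moves_def
      using distr_PiM_reindex[of UNIV "\<lambda>_. ?B" "\<lambda>i. (t, i)" UNIV]
      by (simp add: measure_pmf.prob_space_axioms inj_on_def restrict_def)
    have row: "(\<lambda>r i. r (t, i)) \<in> measurable fair_moves fair_bits"
      using measurable_move_row[of "\<lambda>r. r" fair_moves t] by measurable
    have "(\<lambda>r p. if fst p = t then r (snd p) else m p) \<in> measurable fair_bits all_moves_space"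
    proof (rule measurable_abs_UNIV)
      fix p
      show "(\<lambda>r. if fst p = t then r (snd p) else m p) \<in> measurable fair_bits (count_space UNIV)"
        using measurable_move[of "\<lambda>r. r" fair_bits "snd p"] by (cases "fst p = t") simp_all
    qed
    from measurable_compose[OF this assms]
    have [measurable]: "(\<lambda>r. F (\<lambda>p. if fst p = t then r (snd p) else m p)) \<in> borel_measurable fair_bits" .
    show ?thesis
      by (subst d[symmetric], subst nn_integral_distr[OF row]) simp_all
  qed
  ultimately show ?thesis by simp
qed

text \<open>
  The configuration at time t depends on the moves of earlier times only, so the moves of time t may be
  drawn afresh.
\<close>

lemma clustering_law_Suc:
  assumes "prob_space P" and [measurable_cong]: "sets P = sets borel"
  shows "clustering_law P (Suc t) = step_law (clustering_law P t)"
proof -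
  have meas [measurable]: "(\<lambda>(x, m). clustering x m s) \<in> borel_measurable (P \<Otimes>\<^sub>M fair_moves)" for s
    unfolding split_beta' by measurable
  have sets_law [measurable_cong]: "sets (clustering_law P s) = sets borel" for s
    by (simp add: clustering_law_def)
  have law: "(\<integral>\<^sup>+x. F x \<partial>clustering_law P s) = (\<integral>\<^sup>+x. \<integral>\<^sup>+m. F (clustering x m s) \<partial>fair_moves \<partial>P)"
    if [measurable]: "F \<in> borel_measurable borel" for F s
  proof -
    have "(\<integral>\<^sup>+x. F x \<partial>clustering_law P s) = (\<integral>\<^sup>+w. F ((\<lambda>(x, m). clustering x m s) w) \<partial>(P \<Otimes>\<^sub>M fair_moves))"
      unfolding clustering_law_def by (rule nn_integral_distr) measurable
    also have "\<dots> = (\<integral>\<^sup>+x. \<integral>\<^sup>+m. F (clustering x m s) \<partial>fair_moves \<partial>P)"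
      by (subst fair_moves.nn_integral_fst[symmetric]) simp_all
    finally show ?thesis .
  qed
  show ?thesis
  proof (rule measure_eqI)
    show "sets (clustering_law P (Suc t)) = sets (step_law (clustering_law P t))"
      by (simp add: sets_law step_law_def)
    fix A assume "A \<in> sets (clustering_law P (Suc t))"
    then have [measurable]: "A \<in> sets borel" by (simp add: sets_law)
    let ?F = "indicator A :: (int \<Rightarrow> real) \<Rightarrow> ennreal"
    have "emeasure (clustering_law P (Suc t)) A = (\<integral>\<^sup>+x. ?F x \<partial>clustering_law P (Suc t))"
      by (simp add: sets_law)
    also have "\<dots> = (\<integral>\<^sup>+x. \<integral>\<^sup>+m. ?F (cluster_step (\<lambda>i. m (t, i)) (clustering x m t)) \<partial>fair_moves \<partial>P)"
      by (simp only: clustering.simps law measurable borel_measurable_indicator \<open>A \<in> sets borel\<close>)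
    also have "\<dots> = (\<integral>\<^sup>+x. \<integral>\<^sup>+m. \<integral>\<^sup>+r. ?F (cluster_step r (clustering x m t)) \<partial>fair_bits \<partial>fair_moves \<partial>P)"
    proof (rule nn_integral_cong)
      fix x
      note [measurable] = measurable_move_row
      have c: "clustering x (\<lambda>p. if fst p = t then r (snd p) else m p) t = clustering x m t" for r m
        by (rule clustering_cong) simp
      have "(\<lambda>m. cluster_step (\<lambda>i. m (t, i)) (clustering x m t)) \<in> borel_measurable all_moves_space"
        by (intro measurable_cluster_step measurable_move_row measurable_clustering) simp_all
      then have "(\<lambda>m. ?F (cluster_step (\<lambda>i. m (t, i)) (clustering x m t))) \<in> borel_measurable all_moves_space"
        by (rule measurable_compose) simp
      from nn_integral_fair_moves_row[OF this, of t]
      show "(\<integral>\<^sup>+m. ?F (cluster_step (\<lambda>i. m (t, i)) (clustering x m t)) \<partial>fair_moves) =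
        (\<integral>\<^sup>+m. \<integral>\<^sup>+r. ?F (cluster_step r (clustering x m t)) \<partial>fair_bits \<partial>fair_moves)"
        by (simp add: c)
    qed
    also have "\<dots> = (\<integral>\<^sup>+x. \<integral>\<^sup>+r. ?F (cluster_step r x) \<partial>fair_bits \<partial>clustering_law P t)"
      by (rule law[symmetric]) measurable
    also have "\<dots> = (\<integral>\<^sup>+x. ?F x \<partial>step_law (clustering_law P t))"
      by (rule nn_integral_step_law[OF sets_law, symmetric]) simp
    also have "\<dots> = emeasure (step_law (clustering_law P t)) A"
      by (simp add: step_law_def)
    finally show "emeasure (clustering_law P (Suc t)) A = emeasure (step_law (clustering_law P t)) A" .
  qed
qed

lemma clustering_law_0:
  assumes "prob_space P" and [measurable_cong]: "sets P = sets borel"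
  shows "clustering_law P 0 = P"
proof -
  have "clustering_law P 0 = distr (P \<Otimes>\<^sub>M fair_moves) P fst"
    unfolding clustering_law_def by (intro distr_cong) (auto simp: assms(2))
  then show ?thesis by (simp add: fair_moves.distr_pair_fst)
qed

lemma (in palm_pair) palm_pair_clustering:
  assumes "AE x in P. strict_mono x"
  shows "palm_pair (clustering_law P t) ((palm_step_law ^^ t) \<mu>)"
proof -
  have "palm_pair (clustering_law P t) ((palm_step_law ^^ t) \<mu>) \<and> (AE x in clustering_law P t. strict_mono x)"
  proof (induction t)
    case 0
    then show ?case
      using assms palm_pair_axioms unfolding clustering_law_0[OF P.prob_space_axioms sets_P] by simp
  next
    case (Suc t)
    then show ?case
      using palm_pair.palm_pair_step[of "clustering_law P t" "(palm_step_law ^^ t) \<mu>"]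
      unfolding clustering_law_Suc[OF P.prob_space_axioms sets_P] by simp
  qed
  then show ?thesis ..
qed

section \<open>The Palm pair of a stationary process\<close>

text \<open>
  Stationarity is a statement about counts, while the Campbell formula speaks of numbered points. Counts
  in the intervals between the origin and the rational numbers determine the points numbered from
  the origin.
\<close>

definition test_interval :: "nat \<Rightarrow> real set" where
  "test_interval n = (let q = of_rat (nat_to_rat_surj n) in if 0 < q then {0<..q} else {q<..0})"

text \<open>
  Point i is the infimum of the rational numbers q that lie at or beyond it; for positive i this says
  that at least i points lie in (0, q], otherwise that q is nonnegative or at most -i points lie in
  (q, 0].
\<close>

definition points_of_counts :: "(nat \<Rightarrow> ennreal) \<Rightarrow> int \<Rightarrow> real" where
  "points_of_counts c i = real_of_ereal (INF n.
     let q = of_rat (nat_to_rat_surj n) in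
     if (if 0 < i then 0 < q \<and> of_nat (nat i) \<le> c n else 0 \<le> q \<or> c n \<le> of_nat (nat (- i)))
     then ereal q else \<infinity>)"

lemma measurable_points_of_counts [measurable]: "points_of_counts \<in> borel_measurable borel"
  unfolding points_of_counts_def[abs_def] Let_def
  by (rule measurable_coordinatewise_then_product) measurable

lemma npoints_ge:
  assumes "finite I" "\<And>i. i \<in> I \<Longrightarrow> x i \<in> B"
  shows "of_nat (card I) \<le> npoints B x"
proof -
  have "emeasure (count_space UNIV) I \<le> emeasure (count_space UNIV) {i. x i \<in> B}"
    using assms by (intro emeasure_mono) auto
  then show ?thesis using assms by (simp add: npoints_def)
qed

lemma npoints_le:
  assumes "finite I" "\<And>i. x i \<in> B \<Longrightarrow> i \<in> I"
  shows "npoints B x \<le> of_nat (card I)"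
proof -
  have "emeasure (count_space UNIV) {i. x i \<in> B} \<le> emeasure (count_space UNIV) I"
    using assms by (intro emeasure_mono) auto
  then show ?thesis using assms by (simp add: npoints_def)
qed

lemma le_iff_npoints:
  assumes x: "mono x" "x 0 \<le> 0" "0 < x 1"
  shows "0 < i \<Longrightarrow> x i \<le> q \<longleftrightarrow> 0 < q \<and> of_nat (nat i) \<le> npoints {0<..q} x"
    and "i \<le> 0 \<Longrightarrow> x i \<le> q \<longleftrightarrow> 0 \<le> q \<or> npoints {q<..0} x \<le> of_nat (nat (- i))"
proof -
  have pos: "0 < x j" if "1 \<le> j" for j using monoD[OF x(1) that] x(3) by simp
  have npos: "x j \<le> 0" if "j \<le> 0" for j using monoD[OF x(1) that] x(2) by simp
  have pos_iff: "0 < x j \<longleftrightarrow> 1 \<le> j" for j using pos[of j] npos[of j] by linarith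
  have npos_iff: "x j \<le> 0 \<longleftrightarrow> j \<le> 0" for j using pos[of j] npos[of j] by linarith
  show "x i \<le> q \<longleftrightarrow> 0 < q \<and> of_nat (nat i) \<le> npoints {0<..q} x" if i: "0 < i"
  proof
    assume le: "x i \<le> q"
    have "of_nat (card {1..i}) \<le> npoints {0<..q} x"
      using le pos monoD[OF x(1)] by (intro npoints_ge) (auto intro: order_trans)
    then show "0 < q \<and> of_nat (nat i) \<le> npoints {0<..q} x"
      using pos[of i] le i by simp
  next
    assume r: "0 < q \<and> of_nat (nat i) \<le> npoints {0<..q} x"
    show "x i \<le> q"
    proof (rule ccontr)
      assume "\<not> x i \<le> q"
      then have "npoints {0<..q} x \<le> of_nat (card {1..i - 1})"
      proof (intro npoints_le)
        fix j assume j: "x j \<in> {0<..q}"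
        have "\<not> i \<le> j" using monoD[OF x(1), of i j] j \<open>\<not> x i \<le> q\<close> by auto
        then show "j \<in> {1..i - 1}" using j by (simp add: pos_iff)
      qed simp
      with conjunct2[OF r] have "(of_nat (nat i) :: ennreal) \<le> of_nat (card {1..i - 1})"
        by (rule order_trans)
      then have "nat i \<le> card {1..i - 1}" by (simp only: of_nat_le_iff)
      then show False using i by simp
    qed
  qed
  show "x i \<le> q \<longleftrightarrow> 0 \<le> q \<or> npoints {q<..0} x \<le> of_nat (nat (- i))" if i: "i \<le> 0"
  proof
    assume le: "x i \<le> q"
    have "npoints {q<..0} x \<le> of_nat (card {i + 1..0})"
    proof (intro npoints_le)
      fix j assume j: "x j \<in> {q<..0}"
      have "\<not> j \<le> i" using monoD[OF x(1), of j i] j le by auto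
      then show "j \<in> {i + 1..0}" using j by (simp add: npos_iff)
    qed simp
    then show "0 \<le> q \<or> npoints {q<..0} x \<le> of_nat (nat (- i))" by simp
  next
    assume r: "0 \<le> q \<or> npoints {q<..0} x \<le> of_nat (nat (- i))"
    show "x i \<le> q"
    proof (cases "0 \<le> q")
      case True
      then show ?thesis using npos[OF i] by simp
    next
      case False
      show ?thesis
      proof (rule ccontr)
        assume n: "\<not> x i \<le> q"
        have "of_nat (card {i..0}) \<le> npoints {q<..0} x"
          using n monoD[OF x(1), of i] npos by (intro npoints_ge) (auto simp: not_le intro: less_le_trans)
        moreover have "npoints {q<..0} x \<le> of_nat (nat (- i))" using r False by simp
        ultimately have "(of_nat (card {i..0}) :: ennreal) \<le> of_nat (nat (- i))" by (rule order_trans)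
        then have "card {i..0} \<le> nat (- i)" by (simp only: of_nat_le_iff)
        then show False using i by simp
      qed
    qed
  qed
qed

lemma INF_rat_ge: "(INF n. let q = of_rat (nat_to_rat_surj n) in if a \<le> q then ereal q else \<infinity>) = ereal a"
proof (rule antisym)
  show "ereal a \<le> (INF n. let q = of_rat (nat_to_rat_surj n) in if a \<le> q then ereal q else \<infinity>)"
    by (rule INF_greatest) (simp add: Let_def)
  show "(INF n. let q = of_rat (nat_to_rat_surj n) in if a \<le> q then ereal q else \<infinity>) \<le> ereal a"
  proof (rule dense_ge)
    fix b assume "ereal a < b"
    then obtain c where c: "a < c" "ereal c < b" using ereal_dense2 by fastforce
    then obtain q :: rat where q: "a < of_rat q" "of_rat q < c"
      using of_rat_dense[of a c] by auto
    obtain n where n: "nat_to_rat_surj n = q" using surj_nat_to_rat_surj by (metis surjD)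
    have "ereal (of_rat q) < b" using q c by (metis ereal_less(2) less_ereal.simps(1) less_trans)
    then show "(INF n. let q = of_rat (nat_to_rat_surj n) in if a \<le> q then ereal q else \<infinity>) \<le> b"
      by (intro INF_lower2[of n]) (use q n in \<open>auto simp: Let_def\<close>)
  qed
qed

lemma points_of_counts_eq:
  assumes x: "mono x" "x 0 \<le> 0" "0 < x 1"
  shows "points_of_counts (\<lambda>n. npoints (test_interval n) x) = x"
proof
  fix i
  let ?q = "\<lambda>n. of_rat (nat_to_rat_surj n) :: real"
  have e: "(if 0 < i then 0 < ?q n \<and> of_nat (nat i) \<le> npoints (test_interval n) x
      else 0 \<le> ?q n \<or> npoints (test_interval n) x \<le> of_nat (nat (- i))) \<longleftrightarrow> x i \<le> ?q n" for n
  proof (cases "0 < i")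
    case True
    then show ?thesis
      using le_iff_npoints(1)[OF x True, of "?q n"] by (cases "0 < ?q n") (simp_all add: test_interval_def Let_def)
  next
    case False
    then have "i \<le> 0" by simp
    with False show ?thesis
      using le_iff_npoints(2)[OF x \<open>i \<le> 0\<close>, of "?q n"]
      by (cases "0 < ?q n") (simp_all add: test_interval_def Let_def)
  qed
  show "points_of_counts (\<lambda>n. npoints (test_interval n) x) i = x i"
    unfolding points_of_counts_def Let_def e using INF_rat_ge[of "x i"] by (simp add: Let_def)
qed

lemma stationary_nn_integral_counts:
  fixes B :: "nat \<Rightarrow> real set"
  assumes "stationary P" and [measurable_cong]: "sets P = sets borel"
    and B [measurable]: "\<And>j. B j \<in> sets borel" and [measurable]: "F \<in> borel_measurable borel"
  shows "(\<integral>\<^sup>+x. F (\<lambda>j. npoints (B j) (translate a x)) \<partial>P) = (\<integral>\<^sup>+x. F (\<lambda>j. npoints (B j) x) \<partial>P)"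
proof -
  have [measurable]: "(\<lambda>x j. npoints (B j) x) \<in> borel_measurable borel"
    by (rule measurable_coordinatewise_then_product) measurable
  have e: "(\<lambda>x j. npoints ((+) (- a) ` B j) x) = (\<lambda>x j. npoints (B j) (translate a x))"
    using npoints_image_add[of "- a"] by simp
  have [measurable]: "(\<lambda>x j. npoints (B j) (translate a x)) \<in> borel_measurable borel"
    by (rule measurable_coordinatewise_then_product) measurable
  have "distr P borel (\<lambda>x j. npoints (B j) (translate a x)) = distr P borel (\<lambda>x j. npoints (B j) x)"
    using assms(1)[unfolded stationary_def, rule_format, of B "- a"] B unfolding e by simp
  then have "(\<integral>\<^sup>+c. F c \<partial>distr P borel (\<lambda>x j. npoints (B j) (translate a x))) =
    (\<integral>\<^sup>+c. F c \<partial>distr P borel (\<lambda>x j. npoints (B j) x))" by simp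
  then show ?thesis by (simp add: nn_integral_distr)
qed

locale stationary_simple = prob_space P for P :: "(int \<Rightarrow> real) measure" +
  assumes point_process: "point_process P" and stationary: "stationary P"
    and intensity: "has_intensity P 1" and simple: "simple P"
begin

lemma sets_P [measurable_cong]: "sets P = sets borel"
  using point_process by (simp add: point_process_def)

text \<open>
  By stationarity the mean count of (0, n] is exactly n times that of (0, 1], so the limit that defines
  the intensity is attained at 1.
\<close>

lemma mean_npoints_unit: "(\<integral>\<^sup>+x. npoints {0<..1} x \<partial>P) = 1"
proof -
  let ?N = "\<integral>\<^sup>+x. npoints {0<..1} x \<partial>P"
  have shift: "(\<integral>\<^sup>+x. npoints {real n<..real n + 1} x \<partial>P) = ?N" for n
  proof -
    have "(\<integral>\<^sup>+x. npoints {0<..1} (translate (- real n) x) \<partial>P) = ?N"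
      using stationary_nn_integral_counts[OF stationary sets_P, of "\<lambda>_. {0<..1}" "\<lambda>c. c 0" "- real n"]
      by simp
    moreover have "npoints {0<..1} (translate (- real n) x) = npoints {real n<..real n + 1} x" for x
      by (simp add: npoints_def translate_def algebra_simps)
    ultimately show ?thesis by simp
  qed
  have sum: "(\<integral>\<^sup>+x. npoints {0<..real n} x \<partial>P) = of_nat n * ?N" for n
  proof (induction n)
    case 0
    show ?case by (simp add: npoints_def)
  next
    case (Suc n)
    have "npoints {0<..real (Suc n)} x = npoints {0<..real n} x + npoints {real n<..real n + 1} x" for x
    proof -
      have "{i. x i \<in> {0<..real (Suc n)}} = {i. x i \<in> {0<..real n}} \<union> {i. x i \<in> {real n<..real n + 1}}" by auto
      then show ?thesis unfolding npoints_def by (subst plus_emeasure) auto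
    qed
    then show ?case using Suc shift by (simp add: nn_integral_add distrib_right)
  qed
  have "((\<lambda>t. (\<integral>\<^sup>+x. npoints {0<..t} x \<partial>P) / ennreal t) \<longlongrightarrow> ennreal 1) at_top"
    using intensity by (simp add: has_intensity_def)
  then have lim: "(\<lambda>n. (\<integral>\<^sup>+x. npoints {0<..real n} x \<partial>P) / ennreal (real n)) \<longlonglongrightarrow> ennreal 1"
    by (rule filterlim_compose[OF _ filterlim_real_sequentially])
  have "eventually (\<lambda>n. (\<integral>\<^sup>+x. npoints {0<..real n} x \<partial>P) / ennreal (real n) = ?N) sequentially"
    using eventually_gt_at_top[of 0]
  proof eventually_elim
    case (elim n)
    then show ?case
      unfolding sum ennreal_of_nat_eq_real_of_nat
      by (simp add: mult.commute[of "ennreal (real n)"] ennreal_mult_divide_eq)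
  qed
  then have "(\<lambda>n. (\<integral>\<^sup>+x. npoints {0<..real n} x \<partial>P) / ennreal (real n)) \<longlonglongrightarrow> ?N"
    by (rule tendsto_eventually)
  from LIMSEQ_unique[OF this lim] show ?thesis by (simp only: ennreal_1)
qed

lemma AE_finite_unit: "AE x in P. npoints {a<..a + 1} x \<noteq> \<infinity>"
proof -
  have "npoints {0<..1} (translate (- a) x) = npoints {a<..a + 1} x" for x
    by (simp add: npoints_def translate_def algebra_simps)
  moreover have "(\<integral>\<^sup>+x. npoints {0<..1} (translate (- a) x) \<partial>P) = (\<integral>\<^sup>+x. npoints {0<..1} x \<partial>P)"
    by (rule stationary_nn_integral_counts[OF stationary sets_P, where B = "\<lambda>_. {0<..1}" and F = "\<lambda>c. c 0"])
       simp_all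
  ultimately have fin: "(\<integral>\<^sup>+x. npoints {a<..a + 1} x \<partial>P) \<noteq> \<infinity>"
    by (simp only: mean_npoints_unit) simp
  have "(\<lambda>x. npoints {a<..a + 1} x) \<in> borel_measurable P" by measurable
  from nn_integral_PInf_AE[OF this fin] show ?thesis .
qed

lemma AE_strict_mono: "AE x in P. strict_mono x"
proof -
  have "AE x in P. mono x \<and> x 0 \<le> 0 \<and> 0 < x 1" "AE x in P. inj x"
    using point_process simple by (auto simp: point_process_def simple_def)
  then show ?thesis by eventually_elim (simp add: strict_mono_iff_mono)
qed

text \<open>
  A bounded interval contains finitely many points because its mean count is finite; infinitely many
  distinct ones on each side of the origin must therefore be unbounded.
\<close>

lemma AE_two_sided: "AE x in P. two_sided x \<and> x 0 \<le> 0 \<and> 0 < x 1"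
proof -
  have "AE x in P. \<forall>z::int. npoints {of_int z<..of_int z + 1} x \<noteq> \<infinity>"
    unfolding AE_all_countable using AE_finite_unit by blast
  moreover have "AE x in P. mono x \<and> x 0 \<le> 0 \<and> 0 < x 1" "AE x in P. inj x"
    using point_process simple by (auto simp: point_process_def simple_def)
  ultimately show ?thesis
  proof eventually_elim
    case (elim x)
    have fin1: "finite {i. x i \<in> {of_int z<..of_int z + 1}}" for z :: int
    proof (rule ccontr)
      assume "infinite {i. x i \<in> {of_int z<..of_int z + 1}}"
      then show False using elim(1)[rule_format, of z] by (simp add: npoints_def)
    qed
    have fin: "finite {i. x i \<in> {- real n<..real n}}" for n :: nat
    proof (rule finite_subset)
      show "finite (\<Union>z\<in>{- int n..int n}. {i. x i \<in> {of_int z<..of_int z + 1}})" using fin1 by blast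
      show "{i. x i \<in> {- real n<..real n}} \<subseteq> (\<Union>z\<in>{- int n..int n}. {i. x i \<in> {of_int z<..of_int z + 1}})"
      proof
        fix i assume "i \<in> {i. x i \<in> {- real n<..real n}}"
        then have i: "- real n < x i" "x i \<le> real n" by auto
        define z where "z = \<lceil>x i\<rceil> - 1"
        have "of_int z < x i" "x i \<le> of_int z + 1" unfolding z_def by linarith+
        moreover have "- int n \<le> z" "z \<le> int n" using i unfolding z_def by linarith+
        ultimately show "i \<in> (\<Union>z\<in>{- int n..int n}. {i. x i \<in> {of_int z<..of_int z + 1}})" by auto
      qed
    qed
    have "\<exists>i. real n < x i" for n :: nat
    proof (rule ccontr)
      assume "\<not> ?thesis"
      then have "{1..} \<subseteq> {i. x i \<in> {- real n<..real n}}"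
        using elim(2) monoD[of x 1] by (force simp: not_less)
      from finite_subset[OF this fin] show False using infinite_Ici[of "1::int"] by simp
    qed
    moreover have "\<exists>i. x i \<le> - real n" for n :: nat
    proof (rule ccontr)
      assume "\<not> ?thesis"
      then have "{..0} \<subseteq> {i. x i \<in> {- real n<..real n}}"
        using elim(2) monoD[of x _ 0] by (force simp: not_le)
      from finite_subset[OF this fin] show False using infinite_Iic[of "0::int"] by simp
    qed
    ultimately show ?case using elim(2) by (simp add: two_sided_def)
  qed
qed

text \<open>
  Stationarity is about counts only, but the counts determine the points numbered from the origin, and a
  function that ignores the numbering cannot tell these from the translated ones.
\<close>

lemma nn_integral_translate_invariant:
  assumes [measurable]: "F \<in> borel_measurable borel"
    and inv: "\<And>i x. F (\<lambda>j. x (i + j)) = F x"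
  shows "(\<integral>\<^sup>+x. F (translate a x) \<partial>P) = (\<integral>\<^sup>+x. F x \<partial>P)"
proof -
  let ?C = "\<lambda>x n. npoints (test_interval n) x"
  have [measurable]: "test_interval n \<in> sets borel" for n by (simp add: test_interval_def Let_def)
  have FC: "F y = F (points_of_counts (?C y))" if two: "two_sided y" for y
  proof -
    obtain k where k: "y k \<le> 0" "0 < y (k + 1)" using ex1_implies_ex[OF two_sided_ex1_crossing[OF two, of 0]] by auto
    have "points_of_counts (?C (\<lambda>j. y (k + j))) = (\<lambda>j. y (k + j))"
      using k two_sidedD(1)[OF two_sided_relabel[OF two]] by (intro points_of_counts_eq) auto
    then show ?thesis by (simp add: npoints_relabel inv)
  qed
  have "(\<integral>\<^sup>+x. F (translate a x) \<partial>P) = (\<integral>\<^sup>+x. F (points_of_counts (?C (translate a x))) \<partial>P)"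
    by (rule nn_integral_cong_AE)
      (use AE_two_sided in \<open>eventually_elim, simp add: FC[OF two_sided_translate]\<close>)
  also have "\<dots> = (\<integral>\<^sup>+x. F (points_of_counts (?C x)) \<partial>P)"
    by (rule stationary_nn_integral_counts[OF stationary sets_P, where F = "\<lambda>c. F (points_of_counts c)"]) measurable
  also have "\<dots> = (\<integral>\<^sup>+x. F x \<partial>P)"
    by (rule nn_integral_cong_AE) (use AE_two_sided in \<open>eventually_elim, simp add: FC[symmetric]\<close>)
  finally show ?thesis .
qed

lemma sets_palm [measurable_cong]: "sets (palm P) = sets borel"
  by (simp add: palm_def)

lemma prob_space_palm: "prob_space (palm P)"
proof
  have "emeasure (palm P) (space (palm P)) = (\<integral>\<^sup>+x. 1 \<partial>palm P)" by simp
  also have "\<dots> = (\<integral>\<^sup>+x. \<integral>\<^sup>+i. (if 0 < x i \<and> x i \<le> 1 then 1 else 0) \<partial>count_space UNIV \<partial>P)"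
    by (rule nn_integral_palm[OF sets_P mean_npoints_unit]) simp
  also have "\<dots> = (\<integral>\<^sup>+x. npoints {0<..1} x \<partial>P)"
    unfolding npoints_eq_sum by (intro nn_integral_cong) (auto simp: indicator_def)
  finally show "emeasure (palm P) (space (palm P)) = 1" by (simp add: mean_npoints_unit)
qed

text \<open>
  The Palm law is defined by the points in the unit interval. To reach all places, move the points by a
  random r, uniform in the unit interval: the points that arrive at the place s are those that were in
  the window (s - 1, s], which stationarity identifies with (0, 1].
\<close>

lemma palm_pair_palm: "palm_pair P (palm P)"
proof -
  interpret palm: prob_space "palm P" by (rule prob_space_palm)
  interpret LP: pair_sigma_finite lborel P by unfold_locales
  interpret LM: pair_sigma_finite lborel "palm P" by unfold_locales
  have camp: "(\<integral>\<^sup>+x. \<integral>\<^sup>+i. h (x i, recenter i x) \<partial>count_space UNIV \<partial>P) =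
      (\<integral>\<^sup>+x. \<integral>\<^sup>+s. h (s, x) \<partial>lborel \<partial>palm P)"
    if h [measurable]: "h \<in> borel_measurable (borel \<Otimes>\<^sub>M borel)" for h
  proof -
    have inv: "(\<integral>\<^sup>+x. \<integral>\<^sup>+i. g (x i + a, recenter i x) \<partial>count_space UNIV \<partial>P) =
        (\<integral>\<^sup>+x. \<integral>\<^sup>+i. g (x i, recenter i x) \<partial>count_space UNIV \<partial>P)"
      if [measurable]: "g \<in> borel_measurable (borel \<Otimes>\<^sub>M borel)" for g :: "_ \<Rightarrow> ennreal" and a
    proof -
      let ?F = "\<lambda>x. \<integral>\<^sup>+i. g (x i, recenter i x) \<partial>count_space UNIV"
      have "(\<integral>\<^sup>+x. ?F (translate a x) \<partial>P) = (\<integral>\<^sup>+x. ?F x \<partial>P)"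
      proof (rule nn_integral_translate_invariant)
        show "?F \<in> borel_measurable borel" by (rule measurable_sum_points) measurable
        show "?F (\<lambda>j. x (i + j)) = ?F x" for i x
          using nn_integral_count_int_shift[of "\<lambda>i. g (x i, recenter i x)" i]
          by (simp add: recenter_def add.assoc)
      qed
      then show ?thesis by (simp add: recenter_translate translate_apply)
    qed
    let ?w = "\<lambda>s x i. if 0 \<le> s - x i \<and> s - x i < 1 then h (s, recenter i x) else 0"
    have [measurable]: "(\<lambda>w. \<integral>\<^sup>+i. ?w (fst w) (snd w) i \<partial>count_space UNIV) \<in> borel_measurable (borel \<Otimes>\<^sub>M borel)"
      by (rule measurable_sum_points) measurable
    let ?v = "\<lambda>r x i. if 0 \<le> r \<and> r < 1 then h (x i + r, recenter i x) else 0"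
    have [measurable]: "(\<lambda>w. \<integral>\<^sup>+i. ?v (fst w) (snd w) i \<partial>count_space UNIV) \<in> borel_measurable (borel \<Otimes>\<^sub>M borel)"
      by (rule measurable_sum_points) measurable
    have "(\<integral>\<^sup>+x. \<integral>\<^sup>+i. h (x i, recenter i x) \<partial>count_space UNIV \<partial>P) =
      (\<integral>\<^sup>+(r::real). (if 0 \<le> r \<and> r < 1 then \<integral>\<^sup>+x. \<integral>\<^sup>+i. h (x i, recenter i x) \<partial>count_space UNIV \<partial>P else 0) \<partial>lborel)"
      by (simp add: nn_integral_interval)
    also have "\<dots> = (\<integral>\<^sup>+r. \<integral>\<^sup>+x. \<integral>\<^sup>+i. ?v r x i \<partial>count_space UNIV \<partial>P \<partial>lborel)"
    proof (rule nn_integral_cong)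
      fix r :: real
      show "(if 0 \<le> r \<and> r < 1 then \<integral>\<^sup>+x. \<integral>\<^sup>+i. h (x i, recenter i x) \<partial>count_space UNIV \<partial>P else 0) =
        (\<integral>\<^sup>+x. \<integral>\<^sup>+i. ?v r x i \<partial>count_space UNIV \<partial>P)"
        using inv[OF h, of r] by (cases "0 \<le> r \<and> r < 1") auto
    qed
    also have "\<dots> = (\<integral>\<^sup>+x. \<integral>\<^sup>+r. \<integral>\<^sup>+i. ?v r x i \<partial>count_space UNIV \<partial>lborel \<partial>P)"
      by (rule LP.Fubini'[symmetric]) measurable
    also have "\<dots> = (\<integral>\<^sup>+x. \<integral>\<^sup>+s. \<integral>\<^sup>+i. ?w s x i \<partial>count_space UNIV \<partial>lborel \<partial>P)"
    proof (rule nn_integral_cong)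
      fix x
      have "(\<integral>\<^sup>+r. \<integral>\<^sup>+i. ?v r x i \<partial>count_space UNIV \<partial>lborel) = (\<integral>\<^sup>+i. \<integral>\<^sup>+r. ?v r x i \<partial>lborel \<partial>count_space UNIV)"
        by (rule nn_integral_count_space_nn_integral) measurable
      also have "\<dots> = (\<integral>\<^sup>+i. \<integral>\<^sup>+s. ?w s x i \<partial>lborel \<partial>count_space UNIV)"
      proof (rule nn_integral_cong)
        fix i
        have "(\<integral>\<^sup>+r. ?v r x i \<partial>lborel) = (\<integral>\<^sup>+r. ?w (x i + r) x i \<partial>lborel)"
          by (intro nn_integral_cong) simp
        also have "\<dots> = (\<integral>\<^sup>+s. ?w s x i \<partial>lborel)"
          by (rule nn_integral_translate_lborel) measurable
        finally show "(\<integral>\<^sup>+r. ?v r x i \<partial>lborel) = (\<integral>\<^sup>+s. ?w s x i \<partial>lborel)" .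
      qed
      also have "\<dots> = (\<integral>\<^sup>+s. \<integral>\<^sup>+i. ?w s x i \<partial>count_space UNIV \<partial>lborel)"
        by (rule nn_integral_count_space_nn_integral[symmetric]) measurable
      finally show "(\<integral>\<^sup>+r. \<integral>\<^sup>+i. ?v r x i \<partial>count_space UNIV \<partial>lborel) = (\<integral>\<^sup>+s. \<integral>\<^sup>+i. ?w s x i \<partial>count_space UNIV \<partial>lborel)" .
    qed
    also have "\<dots> = (\<integral>\<^sup>+s. \<integral>\<^sup>+x. \<integral>\<^sup>+i. ?w s x i \<partial>count_space UNIV \<partial>P \<partial>lborel)"
      by (rule LP.Fubini') measurable
    also have "\<dots> = (\<integral>\<^sup>+s. \<integral>\<^sup>+x. h (s, x) \<partial>palm P \<partial>lborel)"
    proof (rule nn_integral_cong)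
      fix s :: real
      let ?g = "\<lambda>p :: real \<times> (int \<Rightarrow> real). if 0 < fst p \<and> fst p \<le> 1 then h (s, snd p) else 0"
      have [measurable]: "?g \<in> borel_measurable (borel \<Otimes>\<^sub>M borel)" by measurable
      have "(\<integral>\<^sup>+x. \<integral>\<^sup>+i. ?w s x i \<partial>count_space UNIV \<partial>P) =
        (\<integral>\<^sup>+x. \<integral>\<^sup>+i. ?g (x i + (1 - s), recenter i x) \<partial>count_space UNIV \<partial>P)"
        by (intro nn_integral_cong) (auto simp: algebra_simps)
      also have "\<dots> = (\<integral>\<^sup>+x. \<integral>\<^sup>+i. ?g (x i, recenter i x) \<partial>count_space UNIV \<partial>P)"
        by (rule inv) measurable
      also have "\<dots> = (\<integral>\<^sup>+x. h (s, x) \<partial>palm P)"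
        by (subst nn_integral_palm[OF sets_P mean_npoints_unit]) (simp_all cong: if_cong)
      finally show "(\<integral>\<^sup>+x. \<integral>\<^sup>+i. ?w s x i \<partial>count_space UNIV \<partial>P) = (\<integral>\<^sup>+x. h (s, x) \<partial>palm P)" .
    qed
    also have "\<dots> = (\<integral>\<^sup>+x. \<integral>\<^sup>+s. h (s, x) \<partial>lborel \<partial>palm P)"
      by (rule LM.Fubini'[symmetric]) measurable
    finally show ?thesis .
  qed
  show ?thesis
    by (intro palm_pair.intro palm_pair_axioms.intro)
       (fact prob_space_axioms prob_space_palm sets_P sets_palm AE_two_sided camp)+
qed

end

section \<open>Renewal processes\<close>

text \<open>
  The deviation from the lattice is a sum of centred independent gaps, because the mean gap under the
  Palm law is 1; its variance is the number of gaps times the variance of one of them.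
\<close>

lemma renewal_deviation:
  assumes P: "stationary_simple P" and ren: "renewal P"
    and sq: "integrable (palm P) (\<lambda>x. (gap 0 x)\<^sup>2)"
  obtains K where "0 \<le> K" "\<And>j k. (\<integral>\<^sup>+x. ennreal (((x k - of_int k) - (x j - of_int j))\<^sup>2) \<partial>palm P) \<le> ennreal (K * \<bar>of_int k - of_int j\<bar>)"
proof -
  interpret stationary_simple P by fact
  interpret palm_pair P "palm P" by (rule palm_pair_palm)
  let ?M = "palm P"
  let ?X = "\<lambda>i x. gap i x - 1"
  have gap_meas [measurable]: "gap i \<in> borel_measurable borel" for i
    unfolding gap_def[abs_def] by measurable
  have ident: "distr ?M borel (gap i) = distr ?M borel (gap 0)" for i
    using ren by (simp add: renewal_def)
  have int_ident: "integrable ?M (\<lambda>x. f (gap i x)) \<longleftrightarrow> integrable ?M (\<lambda>x. f (gap 0 x))"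
    "(\<integral>x. f (gap i x) \<partial>?M) = (\<integral>x. f (gap 0 x) \<partial>?M)"
    if [measurable]: "f \<in> borel_measurable borel" for f :: "real \<Rightarrow> real" and i
    using integrable_distr_eq[of "gap i" ?M borel f] integrable_distr_eq[of "gap 0" ?M borel f]
      integral_distr[of "gap i" ?M borel f] integral_distr[of "gap 0" ?M borel f] ident[of i] by simp_all
  have int0: "integrable ?M (gap 0)"
    by (rule palm.square_integrable_imp_integrable[OF _ sq]) measurable
  have mean0: "(\<integral>x. gap 0 x \<partial>?M) = 1"
  proof -
    have "(\<integral>\<^sup>+x. ennreal (gap 0 x) \<partial>?M) = (\<integral>\<^sup>+x. ennreal (x 1) \<partial>?M)"
      by (rule nn_integral_cong_AE) (use palm_two_sided in \<open>eventually_elim, simp add: gap_def\<close>)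
    then have "(\<integral>\<^sup>+x. ennreal (gap 0 x) \<partial>?M) = 1" by (simp add: palm_mean_gap)
    moreover have "AE x in ?M. 0 \<le> gap 0 x"
      using palm_two_sided by eventually_elim (auto simp: gap_def dest!: two_sidedD(1) monoD[of _ 0 1])
    ultimately show ?thesis using nn_integral_eq_integral[OF int0] by simp
  qed
  have intX: "integrable ?M (?X i)" and meanX: "(\<integral>x. ?X i x \<partial>?M) = 0" for i
    using int_ident[of "\<lambda>g. g - 1" i] int0 mean0 by (simp_all add: palm.prob_space)
  define v where "v = (\<integral>x. (?X 0 x)\<^sup>2 \<partial>?M)"
  have "integrable ?M (\<lambda>x. (?X 0 x)\<^sup>2)"
    using int0 sq by (simp add: power2_diff)
  then have intX2: "integrable ?M (\<lambda>x. (?X i x)\<^sup>2)" and EX2: "(\<integral>x. (?X i x)\<^sup>2 \<partial>?M) = v" for i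
    using int_ident[of "\<lambda>g. (g - 1)\<^sup>2" i] by (simp_all add: v_def)
  have ind: "palm.indep_vars (\<lambda>_. borel) gap UNIV" using ren by (simp add: renewal_def)
  have cov: "integrable ?M (\<lambda>x. ?X i x * ?X j x)" "(\<integral>x. ?X i x * ?X j x \<partial>?M) = (if i = j then v else 0)" for i j
  proof -
    have "integrable ?M (\<lambda>x. ?X i x * ?X j x) \<and> (\<integral>x. ?X i x * ?X j x \<partial>?M) = (if i = j then v else 0)"
    proof (cases "i = j")
      case True
      then show ?thesis using intX2[of i] EX2[of i] by (simp add: power2_eq_square)
    next
      case False
      have "palm.indep_vars (\<lambda>_. borel) gap {i, j}"
        by (rule palm.indep_vars_subset[OF ind]) simp
      then have iv: "palm.indep_vars (\<lambda>_. borel) (\<lambda>i x. gap i x - 1) {i, j}"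
        by (rule palm.indep_vars_compose2) simp
      show ?thesis
        using palm.indep_vars_integrable[OF _ iv intX] palm.indep_vars_lebesgue_integral[OF _ iv intX] meanX False
        by simp
    qed
    then show "integrable ?M (\<lambda>x. ?X i x * ?X j x)" "(\<integral>x. ?X i x * ?X j x \<partial>?M) = (if i = j then v else 0)" by auto
  qed
  have v: "0 \<le> v" by (simp add: v_def)
  have main: "(\<integral>\<^sup>+x. ennreal (((x k - of_int k) - (x j - of_int j))\<^sup>2) \<partial>?M) = ennreal (v * (of_int k - of_int j))"
    if "j \<le> k" for j k :: int
  proof -
    have tele: "(x k - of_int k) - (x j - of_int j) = (\<Sum>i\<in>{j..<k}. ?X i x)" for x :: "int \<Rightarrow> real"
      using that
    proof (induction k rule: int_ge_induct)
      case (step k)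
      then have "{j..<k + 1} = insert k {j..<k}" by auto
      then show ?case using step by (simp add: gap_def)
    qed simp
    have sq: "((x k - of_int k) - (x j - of_int j))\<^sup>2 = (\<Sum>i\<in>{j..<k}. \<Sum>l\<in>{j..<k}. ?X i x * ?X l x)" for x :: "int \<Rightarrow> real"
      by (simp add: tele power2_eq_square sum_product)
    have "(\<integral>\<^sup>+x. ennreal (((x k - of_int k) - (x j - of_int j))\<^sup>2) \<partial>?M) =
      ennreal (\<integral>x. ((x k - of_int k) - (x j - of_int j))\<^sup>2 \<partial>?M)"
    proof (rule nn_integral_eq_integral)
      show "integrable ?M (\<lambda>x. ((x k - of_int k) - (x j - of_int j))\<^sup>2)" by (simp add: sq cov)
    qed simp
    also have "(\<integral>x. ((x k - of_int k) - (x j - of_int j))\<^sup>2 \<partial>?M) = v * (of_int k - of_int j)"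
      using that by (simp add: sq cov sum.delta of_nat_nat)
    finally show ?thesis .
  qed
  show thesis
  proof (rule that[OF v])
    fix j k :: int
    show "(\<integral>\<^sup>+x. ennreal (((x k - of_int k) - (x j - of_int j))\<^sup>2) \<partial>?M) \<le> ennreal (v * \<bar>of_int k - of_int j\<bar>)"
    proof (cases "j \<le> k")
      case True
      then show ?thesis using main[OF True] by simp
    next
      case False
      then have "k \<le> j" by simp
      from main[OF this] False show ?thesis by (simp add: power2_commute)
    qed
  qed
qed

section \<open>Fluctuations of the occupied sites\<close>

lemma site_Suc_front:
  "site m 0 (int (Suc n)) = next_site m 0 + site (\<lambda>j. m (next_site m 0 + j)) 0 (int n)"
proof -
  have "site m 0 (int (Suc n)) = (next_site m ^^ n) (next_site m 0)"
    unfolding site_def by (simp add: nat_add_distrib funpow_swap1)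
  also have "\<dots> = site m (next_site m 0) (int n)" by (simp add: site_def)
  finally show ?thesis by (simp flip: site_shift)
qed

lemma site_cong:
  assumes "\<And>j. 1 \<le> j \<Longrightarrow> m j = m' j"
  shows "site m 0 (int n) = site m' 0 (int n)"
proof -
  have "(next_site m ^^ n) 0 = (next_site m' ^^ n) 0 \<and> 0 \<le> (next_site m ^^ n) 0"
  proof (induction n)
    case (Suc n)
    then show ?case using assms by (auto simp: next_site_def occupied_def)
  qed simp
  then show ?thesis by (simp add: site_def)
qed

lemma exp_le_quadratic:
  fixes x :: real
  assumes "\<bar>x\<bar> \<le> 1"
  shows "exp x \<le> 1 + x + x\<^sup>2"
proof (cases "0 \<le> x")
  case True
  then show ?thesis using assms exp_bound[of x] by simp
next
  case False
  have p: "1 + (- x) + (- x)\<^sup>2 / 2 \<le> exp (- x)"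
    using False by (intro exp_lower_Taylor_quadratic) simp
  have q: "0 < 1 + x + x\<^sup>2"
    using assms False by (smt (verit) zero_less_power2)
  have "1 \<le> (1 - x + x\<^sup>2 / 2) * (1 + x + x\<^sup>2)"
  proof -
    have "(1 - x + x\<^sup>2 / 2) * (1 + x + x\<^sup>2) = 1 + x\<^sup>2 / 2 * (1 - x + x\<^sup>2)"
      by (simp add: algebra_simps power2_eq_square add_divide_distrib diff_divide_distrib)
    moreover have "0 \<le> 1 - x + x\<^sup>2" using False by (smt (verit) zero_le_power2)
    ultimately show ?thesis by (smt (verit) mult_nonneg_nonneg zero_le_power2 zero_le_divide_iff)
  qed
  also have "\<dots> \<le> exp (- x) * (1 + x + x\<^sup>2)"
    using p q by (intro mult_right_mono) auto
  finally have "exp x * 1 \<le> exp x * (exp (- x) * (1 + x + x\<^sup>2))" by (intro mult_left_mono) auto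
  then show ?thesis by (simp add: mult.assoc[symmetric] flip: exp_add)
qed

lemma nn_integral_le_mult:
  assumes "X = ennreal a * Y" "Y \<le> ennreal b" "0 \<le> a" "a * b \<le> c"
  shows "X \<le> ennreal c"
proof -
  have "X \<le> ennreal a * ennreal b" unfolding assms(1) by (rule mult_left_mono[OF assms(2)]) simp
  also have "\<dots> = ennreal (a * b)" using assms(3) by (simp add: ennreal_mult')
  finally show ?thesis using assms(4) by (meson ennreal_leI order_trans)
qed

text \<open>
  The centring by 4 n / 3 is the mean of the n-th site, as a quarter of the gaps is empty.
\<close>

definition site_mgf :: "real \<Rightarrow> nat \<Rightarrow> (int \<Rightarrow> bool) \<Rightarrow> ennreal" where
  "site_mgf \<theta> n m = ennreal (exp (\<theta> * (of_int (site m 0 (int n)) - 4 / 3 * real n)))"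

lemma measurable_site_mgf [measurable]: "site_mgf \<theta> n \<in> borel_measurable move_space"
  unfolding site_mgf_def[abs_def] by measurable

lemma site_mgf_cong: "(\<And>j. 1 \<le> j \<Longrightarrow> m j = m' j) \<Longrightarrow> site_mgf \<theta> n m = site_mgf \<theta> n m'"
  using site_cong[of m m' n] by (simp add: site_mgf_def)

lemma site_mgf_Suc:
  "next_site m 0 = 1 \<Longrightarrow> site_mgf \<theta> (Suc n) m = ennreal (exp (- \<theta> / 3)) * site_mgf \<theta> n (\<lambda>j. m (1 + j))"
  "next_site m 0 = 2 \<Longrightarrow> site_mgf \<theta> (Suc n) m = ennreal (exp (2 * \<theta> / 3)) * site_mgf \<theta> n (\<lambda>j. m (2 + j))"
  using site_Suc_front[of m n]
  by (simp_all add: site_mgf_def algebra_simps add_divide_distrib flip: ennreal_mult exp_add)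

text \<open>
  Given that gap 0 is occupied, the sites to the right depend on the moves to the right through a chain
  with two states, the move of the next point: if point 1 moves right, gap 1 is occupied and the rest
  is fresh; if it moves left, gap 1 is occupied when point 2 moves left too, which
  restarts in the same state, and otherwise the next site is gap 2 with a fresh rest. The weights
  exp (- \<open>\<theta>\<close> / 3) and exp (\<open>\<theta>\<close> / 3) of the two states form an eigenvector of the tilted transition matrix
  up to first order in \<open>\<theta>\<close>, so only a second order factor is lost in each step. The common factor
  exp (\<open>\<bar>\<theta>\<bar>\<close> / 3) makes both weights at least 1, as the induction starts with the value 1.
\<close>

lemma site_mgf_two_states:
  assumes \<theta>: "\<bar>\<theta>\<bar> \<le> 1"
  shows "(\<integral>\<^sup>+m. site_mgf \<theta> n (m(1 := True)) \<partial>fair_bits) \<le> ennreal (exp (\<theta>\<^sup>2 * real n / 6) * exp (- \<theta> / 3 + \<bar>\<theta>\<bar> / 3))"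
    "(\<integral>\<^sup>+m. site_mgf \<theta> n (m(1 := False)) \<partial>fair_bits) \<le> ennreal (exp (\<theta>\<^sup>2 * real n / 6) * exp (\<theta> / 3 + \<bar>\<theta>\<bar> / 3))"
proof -
  let ?R = "\<lambda>n. \<integral>\<^sup>+m. site_mgf \<theta> n (m(1 := True)) \<partial>fair_bits"
  let ?L = "\<lambda>n. \<integral>\<^sup>+m. site_mgf \<theta> n (m(1 := False)) \<partial>fair_bits"
  let ?E = "\<lambda>n. \<integral>\<^sup>+m. site_mgf \<theta> n m \<partial>fair_bits"
  let ?g = "exp (\<theta>\<^sup>2 / 6)"
  define r where "r = exp (- \<theta> / 3 + \<bar>\<theta>\<bar> / 3)"
  define l where "l = exp (\<theta> / 3 + \<bar>\<theta>\<bar> / 3)"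
  have rl: "0 < r" "0 < l" "1 \<le> r" "1 \<le> l" by (auto simp: r_def l_def)
  have lr: "l = exp (2 * \<theta> / 3) * r" by (simp add: r_def l_def flip: exp_add)
  have meas_upd [measurable]: "(\<lambda>m. site_mgf \<theta> n (m(k := b))) \<in> borel_measurable move_space" for n k b
    by (rule measurable_compose[OF measurable_fun_upd_move measurable_site_mgf])
  have meas_upd2 [measurable]: "(\<lambda>m. site_mgf \<theta> n (m(k := b, k' := b'))) \<in> borel_measurable move_space" for n k b k' b'
    by (rule measurable_compose[OF measurable_fun_upd_move meas_upd])
  have E: "?E n = ennreal (1 / 2) * ?R n + ennreal (1 / 2) * ?L n" for n
    by (rule nn_integral_fair_bits_split) measurable
  have R: "?R (Suc n) = ennreal (exp (- \<theta> / 3)) * ?E n" for n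
  proof -
    have "site_mgf \<theta> (Suc n) (m(1 := True)) = ennreal (exp (- \<theta> / 3)) * site_mgf \<theta> n (\<lambda>j. m (1 + j))" for m
    proof -
      have "next_site (m(1 := True)) 0 = 1" by (simp add: next_site_def occupied_def)
      moreover have "site_mgf \<theta> n (\<lambda>j. (m(1 := True)) (1 + j)) = site_mgf \<theta> n (\<lambda>j. m (1 + j))"
        by (rule site_mgf_cong) simp
      ultimately show ?thesis by (simp add: site_mgf_Suc)
    qed
    moreover have "(\<integral>\<^sup>+m. site_mgf \<theta> n (\<lambda>j. m (1 + j)) \<partial>fair_bits) = ?E n"
      by (rule nn_integral_fair_bits_shift) measurable
    moreover have "(\<lambda>m. site_mgf \<theta> n (\<lambda>j. m (1 + j))) \<in> borel_measurable fair_bits"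
      using measurable_compose[OF measurable_shift_moves[of "\<lambda>m. m" fair_bits 1] measurable_site_mgf] by simp
    ultimately show ?thesis by (simp add: nn_integral_cmult)
  qed
  have L: "?L (Suc n) = ennreal (1 / 2) * (ennreal (exp (2 * \<theta> / 3)) * ?E n) +
      ennreal (1 / 2) * (ennreal (exp (- \<theta> / 3)) * ?L n)" for n
  proof -
    have "?L (Suc n) = ennreal (1 / 2) * (\<integral>\<^sup>+m. site_mgf \<theta> (Suc n) (m(2 := True, 1 := False)) \<partial>fair_bits) +
      ennreal (1 / 2) * (\<integral>\<^sup>+m. site_mgf \<theta> (Suc n) (m(2 := False, 1 := False)) \<partial>fair_bits)"
      by (rule nn_integral_fair_bits_split) measurable
    moreover have "site_mgf \<theta> (Suc n) (m(2 := True, 1 := False)) =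
        ennreal (exp (2 * \<theta> / 3)) * site_mgf \<theta> n (\<lambda>j. m (2 + j))" for m
    proof -
      have "next_site (m(2 := True, 1 := False)) 0 = 2" by (simp add: next_site_def occupied_def)
      moreover have "site_mgf \<theta> n (\<lambda>j. (m(2 := True, 1 := False)) (2 + j)) = site_mgf \<theta> n (\<lambda>j. m (2 + j))"
        by (rule site_mgf_cong) simp
      ultimately show ?thesis by (simp add: site_mgf_Suc)
    qed
    moreover have "(\<integral>\<^sup>+m. site_mgf \<theta> n (\<lambda>j. m (2 + j)) \<partial>fair_bits) = ?E n"
      by (rule nn_integral_fair_bits_shift) measurable
    moreover have "(\<lambda>m. site_mgf \<theta> n (\<lambda>j. m (2 + j))) \<in> borel_measurable fair_bits"
      using measurable_compose[OF measurable_shift_moves[of "\<lambda>m. m" fair_bits 2] measurable_site_mgf] by simp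
    moreover have "site_mgf \<theta> (Suc n) (m(2 := False, 1 := False)) =
        ennreal (exp (- \<theta> / 3)) * site_mgf \<theta> n ((\<lambda>j. m (1 + j))(1 := False))" for m
    proof -
      have "next_site (m(2 := False, 1 := False)) 0 = 1" by (simp add: next_site_def occupied_def)
      moreover have "site_mgf \<theta> n (\<lambda>j. (m(2 := False, 1 := False)) (1 + j)) = site_mgf \<theta> n ((\<lambda>j. m (1 + j))(1 := False))"
        by (rule site_mgf_cong) auto
      ultimately show ?thesis by (simp add: site_mgf_Suc)
    qed
    moreover have "(\<integral>\<^sup>+m. site_mgf \<theta> n ((\<lambda>j. m (1 + j))(1 := False)) \<partial>fair_bits) = ?L n"
      by (rule nn_integral_fair_bits_shift) measurable
    moreover have "(\<lambda>m. site_mgf \<theta> n ((\<lambda>j. m (1 + j))(1 := False))) \<in> borel_measurable fair_bits"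
      using measurable_compose[OF measurable_shift_moves[of "\<lambda>m. m" fair_bits 1] meas_upd] by simp
    ultimately show ?thesis by (simp add: nn_integral_cmult)
  qed
  have q1: "exp (- \<theta> / 3) \<le> 1 - \<theta> / 3 + \<theta>\<^sup>2 / 9" "exp (\<theta> / 3) \<le> 1 + \<theta> / 3 + \<theta>\<^sup>2 / 9"
    "exp (2 * \<theta> / 3) \<le> 1 + 2 * \<theta> / 3 + 4 * \<theta>\<^sup>2 / 9"
    using exp_le_quadratic[of "- \<theta> / 3"] exp_le_quadratic[of "\<theta> / 3"] exp_le_quadratic[of "2 * \<theta> / 3"] \<theta>
    by (auto simp: power2_eq_square)
  have q2: "1 + \<theta>\<^sup>2 / 6 \<le> ?g" by (rule exp_ge_add_one_self)
  have lin1: "(a + b) / 2 \<le> g"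
    if "a \<le> 1 - t / 3 + s / 9" "b \<le> 1 + t / 3 + s / 9" "1 + s / 6 \<le> g" "0 \<le> s" for a b g s t :: real
    using that by argo
  have lin2: "(1 + b) / 4 + a / 2 \<le> g"
    if "a \<le> 1 - t / 3 + s / 9" "b \<le> 1 + 2 * t / 3 + 4 * s / 9" "1 + s / 6 \<le> g" for a b g s t :: real
    using that by argo
  have stepR: "exp (- \<theta> / 3) * ((r + l) / 2) \<le> ?g * r"
  proof -
    have "exp (- \<theta> / 3) * ((r + l) / 2) = (exp (- \<theta> / 3) + exp (\<theta> / 3)) / 2 * r"
      unfolding lr by (simp add: field_simps mult_exp_exp)
    also have "\<dots> \<le> ?g * r"
    proof (rule mult_right_mono)
      show "(exp (- \<theta> / 3) + exp (\<theta> / 3)) / 2 \<le> ?g"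
        using lin1[OF q1(1,2) q2 zero_le_power2] .
    qed (use rl in simp)
    finally show ?thesis .
  qed
  have stepL: "(exp (2 * \<theta> / 3) * ((r + l) / 2) + exp (- \<theta> / 3) * l) / 2 \<le> ?g * l"
  proof -
    have "exp (2 * \<theta> / 3) * r = l" by (simp add: lr)
    then have "(exp (2 * \<theta> / 3) * ((r + l) / 2) + exp (- \<theta> / 3) * l) / 2 =
      ((1 + exp (2 * \<theta> / 3)) / 4 + exp (- \<theta> / 3) / 2) * l"
      by (simp add: field_simps)
    also have "\<dots> \<le> ?g * l"
    proof (rule mult_right_mono)
      show "(1 + exp (2 * \<theta> / 3)) / 4 + exp (- \<theta> / 3) / 2 \<le> ?g"
        using lin2[OF q1(1,3) q2] .
    qed (use rl in simp)
    finally show ?thesis .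
  qed
  have "?R n \<le> ennreal (?g ^ n * r) \<and> ?L n \<le> ennreal (?g ^ n * l)"
  proof (induction n)
    case 0
    then show ?case
      using rl ennreal_leI[of 1 r] ennreal_leI[of 1 l]
      by (simp add: site_mgf_def fair_bits.emeasure_space_1[simplified])
  next
    case (Suc n)
    have half: "inverse 2 * ennreal a = ennreal (a / 2)" if "0 \<le> a" for a
      using that ennreal_mult[of "1 / 2" a] by simp
    have En: "?E n \<le> ennreal (?g ^ n * ((r + l) / 2))"
    proof -
      have "?E n \<le> ennreal (1 / 2) * ennreal (?g ^ n * r) + ennreal (1 / 2) * ennreal (?g ^ n * l)"
        unfolding E by (intro add_mono mult_left_mono conjunct1[OF Suc] conjunct2[OF Suc]) simp_all
      also have "\<dots> = ennreal (?g ^ n * ((r + l) / 2))"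
        using rl by (simp add: half field_simps flip: ennreal_plus)
      finally show ?thesis .
    qed
    have "?R (Suc n) \<le> ennreal (?g ^ Suc n * r)"
      by (rule nn_integral_le_mult[OF R En])
         (use stepR mult_left_mono[OF stepR, of "?g ^ n"] in \<open>simp_all add: mult_ac\<close>)
    moreover have "?L (Suc n) \<le> ennreal (?g ^ Suc n * l)"
    proof -
      have "?L (Suc n) \<le> ennreal (1 / 2) * (ennreal (exp (2 * \<theta> / 3)) * ennreal (?g ^ n * ((r + l) / 2))) +
        ennreal (1 / 2) * (ennreal (exp (- \<theta> / 3)) * ennreal (?g ^ n * l))"
        unfolding L by (intro add_mono mult_left_mono En conjunct2[OF Suc]) simp_all
      also have "\<dots> = ennreal (?g ^ n * ((exp (2 * \<theta> / 3) * ((r + l) / 2) + exp (- \<theta> / 3) * l) / 2))"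
        using rl by (simp add: half field_simps flip: ennreal_plus ennreal_mult)
      also have "\<dots> \<le> ennreal (?g ^ Suc n * l)"
        using mult_left_mono[OF stepL, of "?g ^ n"] by (intro ennreal_leI) (simp add: mult_ac)
      finally show ?thesis .
    qed
    ultimately show ?case ..
  qed
  moreover have "?g ^ n = exp (\<theta>\<^sup>2 * real n / 6)"
    by (simp add: exp_of_nat_mult[symmetric] mult.commute)
  ultimately show "?R n \<le> ennreal (exp (\<theta>\<^sup>2 * real n / 6) * exp (- \<theta> / 3 + \<bar>\<theta>\<bar> / 3))"
    "?L n \<le> ennreal (exp (\<theta>\<^sup>2 * real n / 6) * exp (\<theta> / 3 + \<bar>\<theta>\<bar> / 3))"
    by (simp_all add: r_def l_def)
qed

lemma palm_site_mgf:
  assumes \<theta>: "\<bar>\<theta>\<bar> \<le> 1"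
  shows "(\<integral>\<^sup>+m. site_mgf \<theta> n m \<partial>palm_moves) \<le> ennreal (exp (\<theta>\<^sup>2 * real n / 6 + 2 / 3 * \<bar>\<theta>\<bar>))"
proof -
  let ?R = "\<integral>\<^sup>+m. site_mgf \<theta> n (m(1 := True)) \<partial>fair_bits"
  let ?L = "\<integral>\<^sup>+m. site_mgf \<theta> n (m(1 := False)) \<partial>fair_bits"
  let ?b = "exp (\<theta>\<^sup>2 * real n / 6 + 2 / 3 * \<bar>\<theta>\<bar>)"
  have meas_upd [measurable]: "(\<lambda>m. site_mgf \<theta> n (m(k := b))) \<in> borel_measurable move_space" for n k b
    by (rule measurable_compose[OF measurable_fun_upd_move measurable_site_mgf])
  have c: "site_mgf \<theta> n (m(0 := b)) = site_mgf \<theta> n m" for m b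
    by (rule site_mgf_cong) simp
  have "(\<integral>\<^sup>+m. site_mgf \<theta> n m \<partial>palm_moves) = ennreal (4 / 3) * (\<integral>\<^sup>+m. indicator {m. occupied m 0} m * site_mgf \<theta> n m \<partial>fair_bits)"
    by (rule nn_integral_palm_moves) measurable
  also have "(\<integral>\<^sup>+m. indicator {m. occupied m 0} m * site_mgf \<theta> n m \<partial>fair_bits) =
    ennreal (1 / 2) * (\<integral>\<^sup>+m. site_mgf \<theta> n m \<partial>fair_bits) +
    ennreal (1 / 2) * (\<integral>\<^sup>+m. of_bool (\<not> m 1) * site_mgf \<theta> n m \<partial>fair_bits)"
    by (subst nn_integral_fair_bits_split[of _ 0]) (simp_all add: occupied_def indicator_def c)
  also have "(\<integral>\<^sup>+m. site_mgf \<theta> n m \<partial>fair_bits) = ennreal (1 / 2) * ?R + ennreal (1 / 2) * ?L"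
    by (rule nn_integral_fair_bits_split) measurable
  also have "(\<integral>\<^sup>+m. of_bool (\<not> m 1) * site_mgf \<theta> n m \<partial>fair_bits) = ennreal (1 / 2) * ?L"
    by (subst nn_integral_fair_bits_split[of _ 1]) simp_all
  also have "ennreal (4 / 3) * (ennreal (1 / 2) * (ennreal (1 / 2) * ?R + ennreal (1 / 2) * ?L) + ennreal (1 / 2) * (ennreal (1 / 2) * ?L))
    \<le> ennreal (4 / 3) * (ennreal (1 / 2) * (ennreal (1 / 2) * ennreal ?b + ennreal (1 / 2) * ennreal ?b) + ennreal (1 / 2) * (ennreal (1 / 2) * ennreal ?b))"
  proof -
    have "?R \<le> ennreal ?b"
      by (rule order_trans[OF site_mgf_two_states(1)[OF \<theta>]]) (auto intro!: ennreal_leI simp flip: exp_add)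
    moreover have "?L \<le> ennreal ?b"
      by (rule order_trans[OF site_mgf_two_states(2)[OF \<theta>]]) (auto intro!: ennreal_leI simp flip: exp_add)
    ultimately show ?thesis by (intro add_mono mult_left_mono) auto
  qed
  also have "\<dots> = ennreal (4 / 3 * (1 / 2 * (1 / 2 * ?b + 1 / 2 * ?b) + 1 / 2 * (1 / 2 * ?b)))"
    by (simp only: ennreal_plus ennreal_mult divide_nonneg_nonneg zero_le_numeral zero_le_one
        mult_nonneg_nonneg add_nonneg_nonneg exp_ge_zero)
  finally show ?thesis by simp
qed

text \<open>
  Bound the square by exponentials, via \<open>y\<^sup>2 \<le> 2 * exp \<bar>y\<bar>\<close>. For \<open>\<theta>\<close> of order 1 / sqrt n the exponential moment
  is bounded, which gives a variance of order n.
\<close>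

lemma palm_site_variance:
  "(\<integral>\<^sup>+m. ennreal ((3 / 4 * of_int (site m 0 (int n)) - real n)\<^sup>2) \<partial>palm_moves) \<le> ennreal (4 * exp 1 * real n)"
proof (cases "n = 0")
  case False
  define \<theta> where "\<theta> = 1 / sqrt (real n)"
  have \<theta>: "\<bar>\<theta>\<bar> \<le> 1" "\<bar>- \<theta>\<bar> \<le> 1" "\<theta>\<^sup>2 * real n = 1" "0 \<le> \<theta>"
    using False by (auto simp: \<theta>_def power_divide)
  have "ennreal ((3 / 4 * of_int (site m 0 (int n)) - real n)\<^sup>2) \<le>
      ennreal (2 * real n) * site_mgf \<theta> n m + ennreal (2 * real n) * site_mgf (- \<theta>) n m" for m
  proof -
    let ?w = "of_int (site m 0 (int n)) - 4 / 3 * real n"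
    have "(3 / 4 * of_int (site m 0 (int n)) - real n)\<^sup>2 = (9 / 16) * ?w\<^sup>2"
      by (simp add: power2_eq_square algebra_simps)
    also have "\<dots> \<le> ?w\<^sup>2" by simp
    also have "?w\<^sup>2 = real n * (\<theta> * ?w)\<^sup>2"
      using \<theta>(3) by (simp add: power_mult_distrib mult.assoc[symmetric] mult.commute)
    also have "\<dots> \<le> real n * (2 * exp (\<theta> * ?w) + 2 * exp (- \<theta> * ?w))"
    proof (rule mult_left_mono)
      have *: "y\<^sup>2 \<le> 2 * exp y" if "0 \<le> y" for y :: real
        using exp_lower_Taylor_quadratic[OF that] that by simp
      show "(\<theta> * ?w)\<^sup>2 \<le> 2 * exp (\<theta> * ?w) + 2 * exp (- \<theta> * ?w)"
      proof (cases "0 \<le> \<theta> * ?w")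
        case True
        show ?thesis by (rule order_trans[OF *[OF True]]) simp
      next
        case False
        have "(- \<theta> * ?w)\<^sup>2 \<le> 2 * exp (- \<theta> * ?w)" using False by (intro *) simp
        then show ?thesis by (simp add: add_increasing)
      qed
    qed simp
    finally have "ennreal ((3 / 4 * of_int (site m 0 (int n)) - real n)\<^sup>2) \<le>
      ennreal (2 * real n * exp (\<theta> * ?w) + 2 * real n * exp (- \<theta> * ?w))"
      by (intro ennreal_leI) (simp add: algebra_simps)
    also have "\<dots> = ennreal (2 * real n) * site_mgf \<theta> n m + ennreal (2 * real n) * site_mgf (- \<theta>) n m"
      by (simp add: site_mgf_def ennreal_plus ennreal_mult)
    finally show ?thesis .
  qed
  then have "(\<integral>\<^sup>+m. ennreal ((3 / 4 * of_int (site m 0 (int n)) - real n)\<^sup>2) \<partial>palm_moves) \<le>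
    (\<integral>\<^sup>+m. ennreal (2 * real n) * site_mgf \<theta> n m + ennreal (2 * real n) * site_mgf (- \<theta>) n m \<partial>palm_moves)"
    by (intro nn_integral_mono) simp
  also have "\<dots> = ennreal (2 * real n) * (\<integral>\<^sup>+m. site_mgf \<theta> n m \<partial>palm_moves) +
      ennreal (2 * real n) * (\<integral>\<^sup>+m. site_mgf (- \<theta>) n m \<partial>palm_moves)"
    by (simp add: nn_integral_add nn_integral_cmult)
  also have "\<dots> \<le> ennreal (2 * real n) * ennreal (exp 1) + ennreal (2 * real n) * ennreal (exp 1)"
    using \<theta> by (intro add_mono mult_left_mono order_trans[OF palm_site_mgf]) (auto intro!: ennreal_leI)
  also have "\<dots> = ennreal (4 * exp 1 * real n)"
    by (simp add: mult_ac flip: ennreal_plus ennreal_mult)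
  finally show ?thesis .
qed simp

section \<open>Starting from the lattice\<close>

lemma (in palm_pair) palm_mean_increment:
  assumes "j \<le> k"
  shows "(\<integral>\<^sup>+x. ennreal (x k - x j) \<partial>\<mu>) = ennreal (of_int k - of_int j)"
proof -
  have mean1: "(\<integral>\<^sup>+x. ennreal (x (i + 1) - x i) \<partial>\<mu>) = 1" for i
    using palm_recenter[of "\<lambda>x. ennreal (x 1)" i] palm_mean_gap by (simp add: recenter_def)
  show ?thesis using assms
  proof (induction k rule: int_ge_induct)
    case (step k)
    have "(\<integral>\<^sup>+x. ennreal (x (k + 1) - x j) \<partial>\<mu>) = (\<integral>\<^sup>+x. ennreal (x (k + 1) - x k) + ennreal (x k - x j) \<partial>\<mu>)"
    proof (rule nn_integral_cong_AE)
      show "AE x in \<mu>. ennreal (x (k + 1) - x j) = ennreal (x (k + 1) - x k) + ennreal (x k - x j)"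
        using palm_two_sided
      proof eventually_elim
        case (elim x)
        then have "mono x" by (simp add: two_sidedD(1))
        then have "x k \<le> x (k + 1)" "x j \<le> x k" using step(1) by (simp_all add: monoD)
        then show ?case by (simp flip: ennreal_plus)
      qed
    qed
    also have "\<dots> = 1 + ennreal (of_int k - of_int j)"
      using step mean1[of k] by (simp add: nn_integral_add)
    also have "\<dots> = ennreal (of_int (k + 1) - of_int j)"
      using step(1) by (simp flip: ennreal_plus ennreal_1)
    finally show ?case .
  qed simp
qed

abbreviation (input) lattice :: "int \<Rightarrow> real" where
  "lattice \<equiv> of_int"

lemma recenter_lattice: "recenter k lattice = lattice"
  by (simp add: recenter_def)

lemma two_sided_lattice: "two_sided lattice"
proof (rule two_sidedI)
  show "mono lattice" by (simp add: mono_def)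
  show "\<exists>i. lattice i \<le> a" "\<exists>i. a < lattice i" for a :: real
    using of_int_floor_le[of a] by (blast, intro exI[of _ "\<lfloor>a\<rfloor> + 1"], simp)
qed

lemma palm_step_lattice: "palm_step m lattice k = 3 / 4 * of_int (site m 0 k)"
  by (simp add: palm_step_def midpt_def field_simps)

lemma nn_integral_return_lattice:
  "F \<in> borel_measurable borel \<Longrightarrow> (\<integral>\<^sup>+x. F x \<partial>return borel lattice) = F lattice"
  by (rule nn_integral_return) simp_all

lemma measurable_palm_step_const [measurable]: "(\<lambda>x. palm_step m x) \<in> borel_measurable borel"
  by (rule measurable_palm_step) (simp_all add: space_PiM)

text \<open>
  The randomly shifted lattice is a stationary process, and the step from it shows the sites
  themselves (up to the factor 3/4). The general facts about Palm laws, applied after this step,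
  therefore give the means and the stationarity of the increments of the sites.
\<close>

lemma palm_pair_lattice:
  "palm_pair (from_palm (return borel lattice)) (return borel lattice)"
proof (rule palm_pair_from_palm)
  show "prob_space (return borel lattice)" by (rule prob_space_return) simp
  show "AE x in return borel lattice. x 0 = 0 \<and> two_sided x"
    by (subst AE_return) (simp_all add: two_sided_lattice)
  show "(\<integral>\<^sup>+x. F (recenter k x) \<partial>return borel lattice) = (\<integral>\<^sup>+x. F x \<partial>return borel lattice)"
    if [measurable]: "F \<in> borel_measurable borel" for F k
    by (simp add: nn_integral_return_lattice recenter_lattice)
  show "(\<integral>\<^sup>+x. ennreal (x 1) \<partial>return borel lattice) = 1"
    by (simp add: nn_integral_return_lattice)
qed simp

lemma AE_strict_mono_lattice: "AE x in from_palm (return borel lattice). strict_mono x"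
proof -
  let ?P = "from_palm (return borel lattice)"
  have "(\<integral>\<^sup>+x. indicator {x. \<not> strict_mono x} x \<partial>?P) = 0"
  proof -
    have "strict_mono (translate s lattice)" for s by (simp add: strict_mono_def translate_def)
    then have z: "indicator {x. \<not> strict_mono x} (translate s lattice) = (0 :: ennreal)" for s by simp
    have "(\<integral>\<^sup>+x. indicator {x. \<not> strict_mono x} x \<partial>?P) = (\<integral>\<^sup>+x. \<integral>\<^sup>+s. (if 0 \<le> s \<and> s < x 1
        then indicator {x. \<not> strict_mono x} (translate (- s) x) else 0) \<partial>lborel \<partial>return borel lattice)"
      by (rule nn_integral_from_palm) measurable
    also have "\<dots> = 0"
      by (subst nn_integral_return_lattice) (simp_all add: z cong: if_cong)
    finally show ?thesis .
  qed
  moreover have [simp]: "space ?P = UNIV" "{x. \<not> strict_mono x} \<in> sets ?P"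
    by (simp_all add: from_palm_def)
  ultimately have "emeasure ?P {x. \<not> strict_mono x} = 0" by simp
  then show ?thesis by (intro AE_I[where N = "{x. \<not> strict_mono x}"]) auto
qed

interpretation lattice_step:
  palm_pair "step_law (from_palm (return borel lattice))" "palm_step_law (return borel lattice)"
  by (rule palm_pair.palm_pair_step(1)[OF palm_pair_lattice AE_strict_mono_lattice])

lemma nn_integral_palm_step_lattice:
  assumes [measurable]: "F \<in> borel_measurable borel"
  shows "(\<integral>\<^sup>+x. F x \<partial>palm_step_law (return borel lattice)) = (\<integral>\<^sup>+m. F (palm_step m lattice) \<partial>palm_moves)"
proof -
  have "(\<integral>\<^sup>+x. F x \<partial>palm_step_law (return borel lattice)) =
    (\<integral>\<^sup>+m. \<integral>\<^sup>+x. F (palm_step m x) \<partial>return borel lattice \<partial>palm_moves)"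
    by (rule nn_integral_palm_step_law) (auto intro: prob_space_return)
  also have "\<dots> = (\<integral>\<^sup>+m. F (palm_step m lattice) \<partial>palm_moves)"
    by (intro nn_integral_cong nn_integral_return_lattice) measurable
  finally show ?thesis .
qed

lemma site_increments:
  assumes [measurable]: "F \<in> borel_measurable borel"
  shows "(\<integral>\<^sup>+m. F (of_int (site m 0 k) - of_int (site m 0 j) :: real) \<partial>palm_moves) =
    (\<integral>\<^sup>+m. F (of_int (site m 0 (k - j))) \<partial>palm_moves)"
proof -
  let ?G = "\<lambda>x :: int \<Rightarrow> real. F (4 / 3 * x (k - j))"
  have "(\<integral>\<^sup>+x. ?G (recenter j x) \<partial>palm_step_law (return borel lattice)) = (\<integral>\<^sup>+x. ?G x \<partial>palm_step_law (return borel lattice))"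
    by (rule lattice_step.palm_recenter) measurable
  then show ?thesis
    by (simp add: nn_integral_palm_step_lattice palm_step_lattice recenter_def right_diff_distrib)
qed

lemma mean_site_increment:
  assumes "j \<le> k"
  shows "(\<integral>\<^sup>+m. ennreal (of_int (site m 0 k) - of_int (site m 0 j)) \<partial>palm_moves) = ennreal (4 / 3 * (of_int k - of_int j))"
proof -
  have "(\<integral>\<^sup>+x. ennreal (4 / 3) * ennreal (x k - x j) \<partial>palm_step_law (return borel lattice)) =
    ennreal (4 / 3) * ennreal (of_int k - of_int j)"
    using lattice_step.palm_mean_increment[OF assms] by (subst nn_integral_cmult) simp_all
  also have "\<dots> = ennreal (4 / 3 * (of_int k - of_int j))"
    using assms by (subst ennreal_mult) simp_all
  finally show ?thesis
    by (simp add: nn_integral_palm_step_lattice palm_step_lattice ennreal_mult'[symmetric] right_diff_distrib)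
qed

lemma mean_abs_site_increment:
  "(\<integral>\<^sup>+m. ennreal \<bar>of_int (site m 0 k) - of_int (site m 0 j)\<bar> \<partial>palm_moves) = ennreal (4 / 3 * \<bar>of_int k - of_int j\<bar>)"
proof -
  have *: "(\<integral>\<^sup>+m. ennreal \<bar>of_int (site m 0 k) - of_int (site m 0 j)\<bar> \<partial>palm_moves) = ennreal (4 / 3 * (of_int k - of_int j))"
    if "j \<le> k" for j k
  proof -
    have "(\<integral>\<^sup>+m. ennreal \<bar>of_int (site m 0 k) - of_int (site m 0 j)\<bar> \<partial>palm_moves) =
      (\<integral>\<^sup>+m. ennreal (of_int (site m 0 k) - of_int (site m 0 j)) \<partial>palm_moves)"
    proof (rule nn_integral_cong_AE)
      show "AE m in palm_moves. ennreal \<bar>of_int (site m 0 k) - of_int (site m 0 j)\<bar> = ennreal (of_int (site m 0 k) - of_int (site m 0 j))"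
        using AE_palm_moves_occupied
      proof eventually_elim
        case (elim m)
        then have "site m 0 j \<le> site m 0 k" using that by (simp add: strict_mono_less_eq[OF strict_mono_site])
        then show ?case by simp
      qed
    qed
    then show ?thesis using mean_site_increment[OF that] by simp
  qed
  show ?thesis
  proof (cases "j \<le> k")
    case True
    then show ?thesis using *[OF True] by simp
  next
    case False
    then show ?thesis using *[of k j] by (simp add: abs_minus_commute)
  qed
qed

lemma lattice_step_deviation:
  "(\<integral>\<^sup>+m. ennreal (((palm_step m lattice k - lattice k) - (palm_step m lattice j - lattice j))\<^sup>2) \<partial>palm_moves)
    \<le> ennreal (4 * exp 1 * \<bar>of_int k - of_int j\<bar>)"
proof -
  have *: "(\<integral>\<^sup>+m. ennreal (((palm_step m lattice k - lattice k) - (palm_step m lattice j - lattice j))\<^sup>2) \<partial>palm_moves)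
    \<le> ennreal (4 * exp 1 * (of_int k - of_int j))" if "j \<le> k" for j k
  proof -
    let ?F = "\<lambda>y. ennreal ((3 / 4 * y - (of_int k - of_int j))\<^sup>2)"
    have "(\<integral>\<^sup>+m. ennreal (((palm_step m lattice k - lattice k) - (palm_step m lattice j - lattice j))\<^sup>2) \<partial>palm_moves) =
      (\<integral>\<^sup>+m. ?F (of_int (site m 0 k) - of_int (site m 0 j)) \<partial>palm_moves)"
      by (intro nn_integral_cong) (simp add: palm_step_lattice algebra_simps)
    also have "\<dots> = (\<integral>\<^sup>+m. ?F (of_int (site m 0 (k - j))) \<partial>palm_moves)"
      by (rule site_increments) measurable
    also have "\<dots> \<le> ennreal (4 * exp 1 * (of_int k - of_int j))"
      using palm_site_variance[of "nat (k - j)"] that by (simp add: of_nat_nat)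
    finally show ?thesis .
  qed
  show ?thesis
  proof (cases "j \<le> k")
    case True
    then show ?thesis using *[OF True] by simp
  next
    case False
    then show ?thesis using *[of k j] by (simp add: abs_minus_commute power2_commute)
  qed
qed

text \<open>
  By convexity the square of the new increment is at most 9/16 of the mean of the squares of two old
  increments, each over the distance between two sites. This distance is 4/3 of the number of new gaps
  in the mean, and 9/16 * 4/3 = 3/4.
\<close>

lemma palm_step_contraction:
  fixes Z :: "'a \<Rightarrow> int \<Rightarrow> real"
  assumes [measurable]: "Z \<in> borel_measurable N" and K: "0 \<le> K"
    and Z: "\<And>j k. (\<integral>\<^sup>+w. ennreal ((Z w k - Z w j)\<^sup>2) \<partial>N) \<le> ennreal (K * \<bar>of_int k - of_int j\<bar>)"
  shows "(\<integral>\<^sup>+m. \<integral>\<^sup>+w. ennreal ((palm_step m (Z w) k - palm_step m (Z w) j)\<^sup>2) \<partial>N \<partial>palm_moves)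
    \<le> ennreal (3 / 4 * K * \<bar>of_int k - of_int j\<bar>)"
proof -
  note [measurable] = measurable_point[OF assms(1)]
  have "(\<integral>\<^sup>+m. \<integral>\<^sup>+w. ennreal ((palm_step m (Z w) k - palm_step m (Z w) j)\<^sup>2) \<partial>N \<partial>palm_moves) \<le>
    (\<integral>\<^sup>+m. ennreal (9 / 16 * K) * ennreal \<bar>of_int (site m 0 k) - of_int (site m 0 j)\<bar> \<partial>palm_moves)"
  proof (rule nn_integral_mono)
    fix m
    let ?k = "site m 0 k" and ?j = "site m 0 j"
    have "(\<integral>\<^sup>+w. ennreal ((palm_step m (Z w) k - palm_step m (Z w) j)\<^sup>2) \<partial>N) \<le>
      (\<integral>\<^sup>+w. ennreal (9 / 32) * ennreal ((Z w ?k - Z w ?j)\<^sup>2) + ennreal (9 / 32) * ennreal ((Z w (?k + 1) - Z w (?j + 1))\<^sup>2) \<partial>N)"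
    proof (rule nn_integral_mono)
      fix w
      let ?a = "Z w ?k - Z w ?j" and ?b = "Z w (?k + 1) - Z w (?j + 1)"
      have d: "palm_step m (Z w) k - palm_step m (Z w) j = 3 / 4 * ((?a + ?b) / 2)"
        by (simp add: palm_step_def midpt_def field_simps)
      have "(3 / 4 * ((a + b) / 2))\<^sup>2 \<le> 9 / 32 * a\<^sup>2 + 9 / 32 * b\<^sup>2" for a b :: real
        using zero_le_power2[of "a - b"] by (simp add: power2_eq_square algebra_simps)
      then have "(palm_step m (Z w) k - palm_step m (Z w) j)\<^sup>2 \<le> 9 / 32 * ?a\<^sup>2 + 9 / 32 * ?b\<^sup>2"
        unfolding d .
      then have "ennreal ((palm_step m (Z w) k - palm_step m (Z w) j)\<^sup>2) \<le> ennreal (9 / 32 * ?a\<^sup>2 + 9 / 32 * ?b\<^sup>2)"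
        by (rule ennreal_leI)
      also have "\<dots> = ennreal (9 / 32) * ennreal (?a\<^sup>2) + ennreal (9 / 32) * ennreal (?b\<^sup>2)"
        by (subst ennreal_plus) (auto simp only: ennreal_mult zero_le_power2 divide_nonneg_nonneg
            zero_le_numeral mult_nonneg_nonneg)
      finally show "ennreal ((palm_step m (Z w) k - palm_step m (Z w) j)\<^sup>2) \<le>
        ennreal (9 / 32) * ennreal (?a\<^sup>2) + ennreal (9 / 32) * ennreal (?b\<^sup>2)" .
    qed
    also have "\<dots> = ennreal (9 / 32) * (\<integral>\<^sup>+w. ennreal ((Z w ?k - Z w ?j)\<^sup>2) \<partial>N) +
      ennreal (9 / 32) * (\<integral>\<^sup>+w. ennreal ((Z w (?k + 1) - Z w (?j + 1))\<^sup>2) \<partial>N)"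
      by (simp add: nn_integral_add nn_integral_cmult)
    also have "\<dots> \<le> ennreal (9 / 32) * ennreal (K * \<bar>of_int ?k - of_int ?j\<bar>) + ennreal (9 / 32) * ennreal (K * \<bar>of_int ?k - of_int ?j\<bar>)"
      using Z[of ?k ?j] Z[of "?k + 1" "?j + 1"] by (intro add_mono mult_left_mono) auto
    also have "\<dots> = ennreal (9 / 16 * K * \<bar>of_int ?k - of_int ?j\<bar>)"
      using K by (simp add: field_simps flip: ennreal_plus ennreal_mult)
    also have "\<dots> = ennreal (9 / 16 * K) * ennreal \<bar>of_int ?k - of_int ?j\<bar>"
      using K by (subst ennreal_mult) simp_all
    finally show "(\<integral>\<^sup>+w. ennreal ((palm_step m (Z w) k - palm_step m (Z w) j)\<^sup>2) \<partial>N) \<le>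
      ennreal (9 / 16 * K) * ennreal \<bar>of_int ?k - of_int ?j\<bar>" .
  qed
  also have "\<dots> = ennreal (9 / 16 * K) * ennreal (4 / 3 * \<bar>of_int k - of_int j\<bar>)"
    by (subst nn_integral_cmult) (simp_all add: mean_abs_site_increment)
  also have "\<dots> = ennreal (3 / 4 * K * \<bar>of_int k - of_int j\<bar>)"
    using K by (simp add: mult_ac flip: ennreal_mult)
  finally show ?thesis .
qed

section \<open>Running the Palm dynamics backwards\<close>

text \<open>
  The moves \<open>m 0\<close> are those of the last step. The steps are independent with the same law, so the
  order does not matter for the law at time t. But \<open>backward (Suc t) m x\<close> results from \<open>backward t m x\<close> by
  one change in the innermost argument, which the outer steps contract; this is why the sequence
  converges almost surely and not only in law.
\<close>

primrec backward :: "nat \<Rightarrow> (nat \<Rightarrow> int \<Rightarrow> bool) \<Rightarrow> (int \<Rightarrow> real) \<Rightarrow> int \<Rightarrow> real" where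
  "backward 0 m x = x"
| "backward (Suc t) m x = palm_step (m 0) (backward t (\<lambda>i. m (Suc i)) x)"

definition move_seq :: "(nat \<Rightarrow> int \<Rightarrow> bool) measure" where
  "move_seq = PiM UNIV (\<lambda>_. palm_moves)"

abbreviation move_seq_space :: "(nat \<Rightarrow> int \<Rightarrow> bool) measure" where
  "move_seq_space \<equiv> PiM UNIV (\<lambda>_. move_space)"

lemma sets_move_seq [measurable_cong]: "sets move_seq = sets move_seq_space"
  unfolding move_seq_def by (rule sets_PiM_cong) (simp_all add: sets_palm_moves)

interpretation move_seq: prob_space move_seq
  unfolding move_seq_def by (intro prob_space_PiM palm_moves.prob_space_axioms)

lemma measurable_move_seq_component:
  assumes "f \<in> measurable N move_seq_space"
  shows "(\<lambda>w. f w i) \<in> measurable N move_space"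
  by (rule measurable_compose[OF assms measurable_component_singleton]) simp

lemma measurable_move_seq_tail:
  assumes "f \<in> measurable N move_seq_space"
  shows "(\<lambda>w i. f w (Suc i)) \<in> measurable N move_seq_space"
  by (rule measurable_abs_UNIV, rule measurable_move_seq_component[OF assms])

lemma measurable_backward [measurable (raw)]:
  assumes "f \<in> measurable N move_seq_space" and [measurable]: "g \<in> borel_measurable N"
  shows "(\<lambda>w. backward t (f w) (g w)) \<in> borel_measurable N"
  using assms(1)
proof (induction t arbitrary: f)
  case (Suc t)
  have "(\<lambda>w. backward t (\<lambda>i. f w (Suc i)) (g w)) \<in> borel_measurable N"
    by (rule Suc.IH) (rule measurable_move_seq_tail[OF Suc.prems])
  then show ?case
    using measurable_palm_step[OF measurable_move_seq_component[OF Suc.prems]] by simp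
qed simp

lemma nn_integral_move_seq:
  assumes [measurable]: "F \<in> borel_measurable move_seq_space"
  shows "(\<integral>\<^sup>+m. F m \<partial>move_seq) = (\<integral>\<^sup>+s. \<integral>\<^sup>+m. F (case_nat s m) \<partial>move_seq \<partial>palm_moves)"
proof -
  interpret sequence_space palm_moves by unfold_locales
  have [measurable]: "F \<in> borel_measurable (PiM UNIV (\<lambda>_. palm_moves))"
    using assms sets_move_seq unfolding move_seq_def by (simp cong: measurable_cong_sets)
  have "(\<integral>\<^sup>+m. F m \<partial>move_seq) = (\<integral>\<^sup>+w. F ((\<lambda>(s, m). case_nat s m) w) \<partial>(palm_moves \<Otimes>\<^sub>M move_seq))"
    unfolding move_seq_def by (subst PiM_iter[symmetric]) (simp add: nn_integral_distr)
  also have "\<dots> = (\<integral>\<^sup>+s. \<integral>\<^sup>+m. F (case_nat s m) \<partial>move_seq \<partial>palm_moves)"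
    by (subst move_seq.nn_integral_fst[symmetric]) (simp_all add: move_seq_def)
  finally show ?thesis .
qed

lemma sets_palm_step_law_pow: "sets \<mu> = sets borel \<Longrightarrow> sets ((palm_step_law ^^ t) \<mu>) = sets borel"
  by (cases t) (simp_all add: palm_step_law_def)

lemma prob_space_palm_step_law_pow:
  "prob_space \<mu> \<Longrightarrow> sets \<mu> = sets borel \<Longrightarrow> prob_space ((palm_step_law ^^ t) \<mu>)"
  by (induction t) (simp_all add: prob_space_palm_step_law sets_palm_step_law_pow)

lemma nn_integral_backward:
  assumes "prob_space \<mu>" and sets [measurable_cong]: "sets \<mu> = sets borel"
    and "F \<in> borel_measurable borel"
  shows "(\<integral>\<^sup>+x. F x \<partial>(palm_step_law ^^ t) \<mu>) = (\<integral>\<^sup>+m. \<integral>\<^sup>+x. F (backward t m x) \<partial>\<mu> \<partial>move_seq)"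
  using assms(3)
proof (induction t arbitrary: F)
  case 0
  then show ?case by (simp add: move_seq.emeasure_space_1)
next
  case (Suc t)
  note [measurable] = Suc.prems
  interpret prob_space \<mu> by fact
  have "(\<integral>\<^sup>+x. F x \<partial>(palm_step_law ^^ Suc t) \<mu>) =
      (\<integral>\<^sup>+s. \<integral>\<^sup>+x. F (palm_step s x) \<partial>(palm_step_law ^^ t) \<mu> \<partial>palm_moves)"
    using nn_integral_palm_step_law[OF prob_space_palm_step_law_pow[OF assms(1) sets] sets_palm_step_law_pow[OF sets] Suc.prems, of t]
    by simp
  also have "\<dots> = (\<integral>\<^sup>+s. \<integral>\<^sup>+m. \<integral>\<^sup>+x. F (backward (Suc t) (case_nat s m) x) \<partial>\<mu> \<partial>move_seq \<partial>palm_moves)"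
    by (intro nn_integral_cong, subst Suc.IH) simp_all
  also have "\<dots> = (\<integral>\<^sup>+m. \<integral>\<^sup>+x. F (backward (Suc t) m x) \<partial>\<mu> \<partial>move_seq)"
    by (rule nn_integral_move_seq[symmetric]) measurable
  finally show ?case .
qed

text \<open>
  The recursion is the one satisfied by the difference of two runs with the same moves, steps being
  linear. The space N carries a random starting configuration.
\<close>

lemma backward_decay:
  fixes Z :: "nat \<Rightarrow> (nat \<Rightarrow> int \<Rightarrow> bool) \<times> 'a \<Rightarrow> int \<Rightarrow> real"
  assumes "prob_space N" and meas: "\<And>t. Z t \<in> borel_measurable (move_seq \<Otimes>\<^sub>M N)"
    and rec: "\<And>t m w. Z (Suc t) (m, w) = palm_step (m 0) (Z t (\<lambda>i. m (Suc i), w))"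
    and K: "0 \<le> K"
    and base: "\<And>j k. (\<integral>\<^sup>+p. ennreal ((Z 0 p k - Z 0 p j)\<^sup>2) \<partial>(move_seq \<Otimes>\<^sub>M N)) \<le> ennreal (K * \<bar>of_int k - of_int j\<bar>)"
  shows "(\<integral>\<^sup>+p. ennreal ((Z t p k - Z t p j)\<^sup>2) \<partial>(move_seq \<Otimes>\<^sub>M N)) \<le> ennreal ((3 / 4) ^ t * K * \<bar>of_int k - of_int j\<bar>)"
proof (induction t arbitrary: j k)
  case 0
  then show ?case using base by simp
next
  case (Suc t)
  interpret N: prob_space N by fact
  note [measurable] = measurable_point[OF meas]
  have "(\<integral>\<^sup>+p. ennreal ((Z (Suc t) p k - Z (Suc t) p j)\<^sup>2) \<partial>(move_seq \<Otimes>\<^sub>M N)) =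
    (\<integral>\<^sup>+m. \<integral>\<^sup>+w. ennreal ((Z (Suc t) (m, w) k - Z (Suc t) (m, w) j)\<^sup>2) \<partial>N \<partial>move_seq)"
    by (rule N.nn_integral_fst[symmetric]) measurable
  also have "\<dots> = (\<integral>\<^sup>+s. \<integral>\<^sup>+m. \<integral>\<^sup>+w. ennreal ((Z (Suc t) (case_nat s m, w) k - Z (Suc t) (case_nat s m, w) j)\<^sup>2) \<partial>N \<partial>move_seq \<partial>palm_moves)"
  proof (rule nn_integral_move_seq)
    have "(\<lambda>m. \<integral>\<^sup>+w. ennreal ((Z (Suc t) (m, w) k - Z (Suc t) (m, w) j)\<^sup>2) \<partial>N) \<in> borel_measurable move_seq"
      by measurable
    then show "(\<lambda>m. \<integral>\<^sup>+w. ennreal ((Z (Suc t) (m, w) k - Z (Suc t) (m, w) j)\<^sup>2) \<partial>N) \<in> borel_measurable move_seq_space"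
      by (simp cong: measurable_cong_sets add: sets_move_seq)
  qed
  also have "\<dots> = (\<integral>\<^sup>+s. \<integral>\<^sup>+p. ennreal ((palm_step s (Z t p) k - palm_step s (Z t p) j)\<^sup>2) \<partial>(move_seq \<Otimes>\<^sub>M N) \<partial>palm_moves)"
  proof (rule nn_integral_cong)
    fix s
    have [measurable]: "(\<lambda>p. palm_step s (Z t p) i) \<in> borel_measurable (move_seq \<Otimes>\<^sub>M N)" for i
      by (rule measurable_point, rule measurable_palm_step[OF _ meas]) (simp add: space_PiM)
    show "(\<integral>\<^sup>+m. \<integral>\<^sup>+w. ennreal ((Z (Suc t) (case_nat s m, w) k - Z (Suc t) (case_nat s m, w) j)\<^sup>2) \<partial>N \<partial>move_seq) =
      (\<integral>\<^sup>+p. ennreal ((palm_step s (Z t p) k - palm_step s (Z t p) j)\<^sup>2) \<partial>(move_seq \<Otimes>\<^sub>M N))"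
      by (subst N.nn_integral_fst[symmetric]) (simp_all add: rec)
  qed
  also have "\<dots> \<le> ennreal (3 / 4 * ((3 / 4) ^ t * K) * \<bar>of_int k - of_int j\<bar>)"
    by (rule palm_step_contraction[OF meas]) (use K Suc in simp_all)
  finally show ?case by (simp add: mult.assoc)
qed

text \<open>
  Use \<open>\<bar>y\<bar> \<le> e / 2 + y\<^sup>2 / (2 * e)\<close> with e proportional to \<open>(9 / 10) ^ t\<close>: both this and the quotient
  \<open>(3 / 4) ^ t / (9 / 10) ^ t = (5 / 6) ^ t\<close> are summable, with sums 10 and 6. Taking e proportional to a
  keeps the bound linear in a.
\<close>

lemma nn_integral_suminf_abs_le:
  fixes f :: "nat \<Rightarrow> 'a \<Rightarrow> real"
  assumes "prob_space M" and [measurable]: "\<And>t. f t \<in> borel_measurable M" and a: "0 < a" and C: "0 \<le> C"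
    and sq: "\<And>t. (\<integral>\<^sup>+x. ennreal ((f t x)\<^sup>2) \<partial>M) \<le> ennreal ((3 / 4) ^ t * C * a\<^sup>2)"
  shows "(\<integral>\<^sup>+x. (\<Sum>t. ennreal \<bar>f t x\<bar>) \<partial>M) \<le> ennreal (a * (5 + 3 * C))"
proof -
  interpret prob_space M by fact
  let ?b = "\<lambda>t. a / 2 * ((9 / 10) ^ t + C * (5 / 6) ^ t)"
  have b: "(\<integral>\<^sup>+x. ennreal \<bar>f t x\<bar> \<partial>M) \<le> ennreal (?b t)" for t
  proof -
    define e where "e = a * (9 / 10) ^ t"
    have e: "0 < e" using a by (simp add: e_def)
    have "ennreal \<bar>y\<bar> \<le> ennreal (e / 2) + ennreal (1 / (2 * e)) * ennreal (y\<^sup>2)" for y :: real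
    proof -
      have "0 \<le> (\<bar>y\<bar> - e)\<^sup>2" by simp
      then have "2 * e * \<bar>y\<bar> \<le> e\<^sup>2 + y\<^sup>2" by (simp add: power2_diff algebra_simps)
      then have "\<bar>y\<bar> \<le> e / 2 + 1 / (2 * e) * y\<^sup>2"
        using e by (simp add: field_simps power2_eq_square)
      then have "ennreal \<bar>y\<bar> \<le> ennreal (e / 2 + 1 / (2 * e) * y\<^sup>2)" by (rule ennreal_leI)
      also have "\<dots> = ennreal (e / 2) + ennreal (1 / (2 * e) * y\<^sup>2)"
        using e by (intro ennreal_plus) auto
      also have "ennreal (1 / (2 * e) * y\<^sup>2) = ennreal (1 / (2 * e)) * ennreal (y\<^sup>2)"
        using e by (intro ennreal_mult) auto
      finally show ?thesis .
    qed
    then have "(\<integral>\<^sup>+x. ennreal \<bar>f t x\<bar> \<partial>M) \<le> (\<integral>\<^sup>+x. ennreal (e / 2) + ennreal (1 / (2 * e)) * ennreal ((f t x)\<^sup>2) \<partial>M)"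
      by (intro nn_integral_mono)
    also have "\<dots> = ennreal (e / 2) + ennreal (1 / (2 * e)) * (\<integral>\<^sup>+x. ennreal ((f t x)\<^sup>2) \<partial>M)"
      by (simp add: nn_integral_add nn_integral_cmult emeasure_space_1)
    also have "\<dots> \<le> ennreal (e / 2) + ennreal (1 / (2 * e)) * ennreal ((3 / 4) ^ t * C * a\<^sup>2)"
      using sq by (intro add_mono mult_left_mono) auto
    also have "\<dots> = ennreal (e / 2) + ennreal (1 / (2 * e) * ((3 / 4) ^ t * C * a\<^sup>2))"
      using e C by (subst ennreal_mult) auto
    also have "\<dots> = ennreal (e / 2 + 1 / (2 * e) * ((3 / 4) ^ t * C * a\<^sup>2))"
      using e C by (intro ennreal_plus[symmetric]) auto
    also have "e / 2 + 1 / (2 * e) * ((3 / 4) ^ t * C * a\<^sup>2) = ?b t"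
    proof -
      have "(3 / 4 :: real) ^ t = (5 / 6) ^ t * (9 / 10) ^ t" by (simp flip: power_mult_distrib)
      then have "1 / (2 * e) * ((3 / 4) ^ t * C * a\<^sup>2) = a / 2 * (C * (5 / 6) ^ t)"
        using a by (simp add: e_def power2_eq_square)
      then show ?thesis by (simp add: e_def distrib_left)
    qed
    finally show ?thesis .
  qed
  have sums: "?b sums (a / 2 * (1 / (1 - 9 / 10) + C * (1 / (1 - 5 / 6))))"
    by (intro sums_mult sums_add geometric_sums) auto
  have "(\<integral>\<^sup>+x. (\<Sum>t. ennreal \<bar>f t x\<bar>) \<partial>M) = (\<Sum>t. \<integral>\<^sup>+x. ennreal \<bar>f t x\<bar> \<partial>M)"
    by (rule nn_integral_suminf) measurable
  also have "\<dots> \<le> (\<Sum>t. ennreal (?b t))"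
    by (intro suminf_le b) auto
  also have "\<dots> = ennreal (a / 2 * (1 / (1 - 9 / 10) + C * (1 / (1 - 5 / 6))))"
    using a C by (intro suminf_ennreal_eq[OF _ sums]) simp
  also have "a / 2 * (1 / (1 - 9 / 10) + C * (1 / (1 - 5 / 6))) = a * (5 + 3 * C)"
    by (simp add: field_simps)
  finally show ?thesis .
qed

section \<open>The limit\<close>

definition displacement :: "nat \<Rightarrow> (nat \<Rightarrow> int \<Rightarrow> bool) \<Rightarrow> int \<Rightarrow> real" where
  "displacement t m k = backward (Suc t) m lattice k - backward t m lattice k"

lemma palm_step_diff: "palm_step m x k - palm_step m y k = palm_step m (\<lambda>i. x i - y i) k"
  by (simp add: palm_step_def midpt_def field_simps)

lemma palm_step_0: "palm_step m x 0 = 0"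
  by (simp add: palm_step_def)

lemma displacement_Suc: "displacement (Suc t) m = palm_step (m 0) (displacement t (\<lambda>i. m (Suc i)))"
  by (rule ext) (simp add: displacement_def[abs_def] palm_step_diff)

lemma measurable_displacement:
  assumes [measurable]: "f \<in> measurable N move_seq_space"
  shows "(\<lambda>w. displacement t (f w)) \<in> borel_measurable N"
  unfolding displacement_def
  by (rule measurable_coordinatewise_then_product)
     (intro borel_measurable_diff measurable_point measurable_backward assms borel_measurable_const)

lemma displacement_0: "displacement t m 0 = 0"
  by (cases t) (simp_all add: displacement_def palm_step_0)

lemma displacement_decay:
  "(\<integral>\<^sup>+m. ennreal ((displacement t m k)\<^sup>2) \<partial>move_seq) \<le> ennreal ((3 / 4) ^ t * (4 * exp 1) * \<bar>of_int k\<bar>)"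
proof -
  let ?N = "return borel (0 :: real)"
  let ?Z = "\<lambda>t p. displacement t (fst p)"
  interpret N: prob_space ?N by (rule prob_space_return) simp
  have meas: "?Z t \<in> borel_measurable (move_seq \<Otimes>\<^sub>M ?N)" for t
    by (rule measurable_displacement) measurable
  note [measurable] = measurable_point[OF meas]
  have fst: "(\<integral>\<^sup>+p. ennreal ((?Z t p k - ?Z t p j)\<^sup>2) \<partial>(move_seq \<Otimes>\<^sub>M ?N)) =
    (\<integral>\<^sup>+m. ennreal ((displacement t m k - displacement t m j)\<^sup>2) \<partial>move_seq)" for t j k
    by (subst N.nn_integral_fst[symmetric]) (simp_all add: N.emeasure_space_1)
  have base: "(\<integral>\<^sup>+p. ennreal ((?Z 0 p k - ?Z 0 p j)\<^sup>2) \<partial>(move_seq \<Otimes>\<^sub>M ?N)) \<le> ennreal (4 * exp 1 * \<bar>of_int k - of_int j\<bar>)" for j k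
  proof -
    have "(\<lambda>m. ennreal ((displacement 0 m k - displacement 0 m j)\<^sup>2)) \<in> borel_measurable move_seq_space"
      using measurable_point[OF measurable_displacement[of "\<lambda>m. m" move_seq_space 0]] by simp
    from nn_integral_move_seq[OF this]
    have "(\<integral>\<^sup>+m. ennreal ((displacement 0 m k - displacement 0 m j)\<^sup>2) \<partial>move_seq) =
      (\<integral>\<^sup>+s. ennreal (((palm_step s lattice k - lattice k) - (palm_step s lattice j - lattice j))\<^sup>2) \<partial>palm_moves)"
      by (simp add: displacement_def move_seq.emeasure_space_1)
    then show ?thesis using fst lattice_step_deviation by simp
  qed
  have "(\<integral>\<^sup>+p. ennreal ((?Z t p k - ?Z t p 0)\<^sup>2) \<partial>(move_seq \<Otimes>\<^sub>M ?N)) \<le> ennreal ((3 / 4) ^ t * (4 * exp 1) * \<bar>of_int k - of_int 0\<bar>)"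
    by (rule backward_decay[where Z = ?Z and N = ?N, OF N.prob_space_axioms meas _ _ base])
       (simp_all add: displacement_Suc)
  then show ?thesis unfolding fst by (simp add: displacement_0)
qed

abbreviation total_displacement :: "(nat \<Rightarrow> int \<Rightarrow> bool) \<Rightarrow> int \<Rightarrow> ennreal" where
  "total_displacement m k \<equiv> (\<Sum>t. ennreal \<bar>displacement t m k\<bar>)"

lemma mean_total_displacement:
  "(\<integral>\<^sup>+m. total_displacement m k \<partial>move_seq) \<le> ennreal (sqrt \<bar>of_int k\<bar> * (5 + 12 * exp 1))"
proof (cases "k = 0")
  case True
  then show ?thesis by (simp add: displacement_0)
next
  case False
  have meas: "(\<lambda>m. displacement t m k) \<in> borel_measurable move_seq" for t
    using measurable_point[OF measurable_displacement[of "\<lambda>m. m" move_seq t]] by measurable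
  have "(\<integral>\<^sup>+m. total_displacement m k \<partial>move_seq) \<le> ennreal (sqrt \<bar>of_int k\<bar> * (5 + 3 * (4 * exp 1)))"
    by (rule nn_integral_suminf_abs_le[OF move_seq.prob_space_axioms meas])
       (use False displacement_decay in simp_all)
  then show ?thesis by simp
qed

lemma AE_total_displacement: "AE m in move_seq. \<forall>k. total_displacement m k \<noteq> \<infinity>"
  unfolding AE_all_countable
proof
  fix k
  have meas: "(\<lambda>m. displacement t m k) \<in> borel_measurable move_seq" for t
    using measurable_point[OF measurable_displacement[of "\<lambda>m. m" move_seq t]] by measurable
  show "AE m in move_seq. total_displacement m k \<noteq> \<infinity>"
  proof (rule nn_integral_PInf_AE)
    show "(\<integral>\<^sup>+m. total_displacement m k \<partial>move_seq) \<noteq> \<infinity>"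
      using mean_total_displacement[of k] by (auto simp: top_unique)
  qed (use meas in measurable)
qed

definition limit_points :: "(nat \<Rightarrow> int \<Rightarrow> bool) \<Rightarrow> int \<Rightarrow> real" where
  "limit_points m k = lim (\<lambda>t. backward t m lattice k)"

lemma measurable_limit_points [measurable (raw)]:
  assumes [measurable]: "f \<in> measurable N move_seq_space"
  shows "(\<lambda>w. limit_points (f w)) \<in> borel_measurable N"
  unfolding limit_points_def
  by (rule measurable_coordinatewise_then_product)
     (intro borel_measurable_lim_metric measurable_point measurable_backward assms borel_measurable_const)

lemma limit_points_tendsto:
  assumes "total_displacement m k \<noteq> \<infinity>"
  shows "(\<lambda>t. backward t m lattice k) \<longlonglongrightarrow> limit_points m k"
    "ennreal \<bar>limit_points m k - of_int k\<bar> \<le> total_displacement m k"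
    "ennreal \<bar>backward t m lattice k - of_int k\<bar> \<le> total_displacement m k"
proof -
  have sum: "summable (\<lambda>t. \<bar>displacement t m k\<bar>)"
    using assms by (intro summable_suminf_not_top) auto
  have part: "backward t m lattice k = of_int k + (\<Sum>s<t. displacement s m k)" for t
    using sum_lessThan_telescope[of "\<lambda>t. backward t m lattice k" t] by (simp add: displacement_def)
  have "(\<lambda>t. backward t m lattice k) \<longlonglongrightarrow> of_int k + (\<Sum>s. displacement s m k)"
    unfolding part by (intro tendsto_intros summable_LIMSEQ summable_rabs_cancel[OF sum])
  then have lim: "limit_points m k = of_int k + (\<Sum>s. displacement s m k)"
    and "(\<lambda>t. backward t m lattice k) \<longlonglongrightarrow> limit_points m k"
    by (auto simp: limit_points_def limI)
  then show "(\<lambda>t. backward t m lattice k) \<longlonglongrightarrow> limit_points m k" by simp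
  have tot: "total_displacement m k = ennreal (\<Sum>t. \<bar>displacement t m k\<bar>)"
    using assms by (intro suminf_ennreal) auto
  show "ennreal \<bar>limit_points m k - of_int k\<bar> \<le> total_displacement m k"
    unfolding tot lim using summable_rabs[OF sum] by (intro ennreal_leI) simp
  have "\<bar>\<Sum>s<t. displacement s m k\<bar> \<le> (\<Sum>s<t. \<bar>displacement s m k\<bar>)" by (rule sum_abs)
  also have "\<dots> \<le> (\<Sum>t. \<bar>displacement t m k\<bar>)" by (rule sum_le_suminf[OF sum]) auto
  finally show "ennreal \<bar>backward t m lattice k - of_int k\<bar> \<le> total_displacement m k"
    unfolding tot part by (intro ennreal_leI) simp
qed

lemma mono_palm_step: "occupied m 0 \<Longrightarrow> mono x \<Longrightarrow> mono (palm_step m x)"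
  by (rule monoI) (simp add: palm_step_def midpt_mono strict_mono_less_eq[OF strict_mono_site])

lemma mono_backward:
  "(\<And>i. occupied (m i) 0) \<Longrightarrow> mono x \<Longrightarrow> mono (backward t m x)"
  by (induction t arbitrary: m) (simp_all add: mono_palm_step)

lemma AE_move_seq_occupied: "AE m in move_seq. \<forall>i. occupied (m i) 0"
  unfolding AE_all_countable move_seq_def
  using AE_palm_moves_occupied
  by (intro allI AE_PiM_component[of UNIV "\<lambda>_. palm_moves"] palm_moves.prob_space_axioms) auto

lemma mono_limit_points:
  assumes "\<And>i. occupied (m i) 0" "\<And>k. total_displacement m k \<noteq> \<infinity>"
  shows "mono (limit_points m)"
proof (rule monoI)
  fix i j :: int assume "i \<le> j"
  have "mono lattice" by (simp add: mono_def)
  then show "limit_points m i \<le> limit_points m j"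
    using mono_backward[OF assms(1)] \<open>i \<le> j\<close>
    by (intro LIMSEQ_le[OF limit_points_tendsto(1)[OF assms(2)] limit_points_tendsto(1)[OF assms(2)]])
       (auto simp: mono_def)
qed

lemma limit_points_0:
  assumes "total_displacement m 0 \<noteq> \<infinity>"
  shows "limit_points m 0 = 0"
proof -
  have "backward t m lattice 0 = 0" for t by (cases t) (simp_all add: palm_step_0)
  then show ?thesis using LIMSEQ_unique[OF limit_points_tendsto(1)[OF assms]] by simp
qed

text \<open>
  The deviation of point k from k is of the order of the square root of k in the mean. Relative to k it is
  summable along the powers of 4, so almost surely it is eventually less than half of k there.
\<close>

lemma AE_two_sided_limit_points: "AE m in move_seq. two_sided (limit_points m)"
proof -
  let ?V = "\<lambda>m k. total_displacement m k"
  let ?p = "\<lambda>n. 4 ^ n :: int"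
  let ?D = "5 + 12 * exp 1 :: real"
  have meas [measurable]: "(\<lambda>m. displacement t m k) \<in> borel_measurable move_seq" for t k
    using measurable_point[OF measurable_displacement[of "\<lambda>m. m" move_seq t]] by measurable
  have "AE m in move_seq. (\<Sum>n. ennreal (1 / 4 ^ n) * (?V m (?p n) + ?V m (- ?p n))) \<noteq> \<infinity>"
  proof (rule nn_integral_PInf_AE)
    have "(\<integral>\<^sup>+m. (\<Sum>n. ennreal (1 / 4 ^ n) * (?V m (?p n) + ?V m (- ?p n))) \<partial>move_seq) =
      (\<Sum>n. ennreal (1 / 4 ^ n) * ((\<integral>\<^sup>+m. ?V m (?p n) \<partial>move_seq) + (\<integral>\<^sup>+m. ?V m (- ?p n) \<partial>move_seq)))"
      by (subst nn_integral_suminf) (simp_all add: nn_integral_cmult nn_integral_add)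
    also have "\<dots> \<le> (\<Sum>n. ennreal (2 * ?D * (1 / 2) ^ n))"
    proof (intro suminf_le)
      fix n
      have s: "sqrt \<bar>of_int (?p n)\<bar> = 2 ^ n" "sqrt \<bar>of_int (- ?p n)\<bar> = 2 ^ n"
        by (simp_all add: real_sqrt_power)
      have "ennreal (1 / 4 ^ n) * ((\<integral>\<^sup>+m. ?V m (?p n) \<partial>move_seq) + (\<integral>\<^sup>+m. ?V m (- ?p n) \<partial>move_seq)) \<le>
        ennreal (1 / 4 ^ n) * (ennreal (2 ^ n * ?D) + ennreal (2 ^ n * ?D))"
        using mean_total_displacement[of "?p n"] mean_total_displacement[of "- ?p n"] unfolding s
        by (intro mult_left_mono add_mono) auto
      also have "\<dots> = ennreal (1 / 4 ^ n) * ennreal (2 ^ n * ?D + 2 ^ n * ?D)"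
        by (intro arg_cong2[where f = "(*)"] refl ennreal_plus[symmetric]) (simp_all add: add_nonneg_nonneg)
      also have "\<dots> = ennreal (1 / 4 ^ n * (2 ^ n * ?D + 2 ^ n * ?D))"
        by (intro ennreal_mult[symmetric]) (simp_all add: add_nonneg_nonneg)
      also have "1 / 4 ^ n * (2 ^ n * ?D + 2 ^ n * ?D) = 2 * ?D * (1 / 2) ^ n"
      proof -
        have "(4 :: real) ^ n = 2 ^ n * 2 ^ n" by (simp flip: power_mult_distrib)
        then show ?thesis by (simp add: power_divide)
      qed
      finally show "ennreal (1 / 4 ^ n) * ((\<integral>\<^sup>+m. ?V m (?p n) \<partial>move_seq) + (\<integral>\<^sup>+m. ?V m (- ?p n) \<partial>move_seq)) \<le>
        ennreal (2 * ?D * (1 / 2) ^ n)" .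
    qed auto
    also have "\<dots> = ennreal (2 * ?D * (1 / (1 - 1 / 2)))"
    proof (rule suminf_ennreal_eq)
      show "0 \<le> 2 * ?D * (1 / 2) ^ n" for n by (simp add: add_nonneg_nonneg)
      show "(\<lambda>n. 2 * ?D * (1 / 2) ^ n) sums (2 * ?D * (1 / (1 - 1 / 2)))"
        by (intro sums_mult geometric_sums) auto
    qed
    finally show "(\<integral>\<^sup>+m. (\<Sum>n. ennreal (1 / 4 ^ n) * (?V m (?p n) + ?V m (- ?p n))) \<partial>move_seq) \<noteq> \<infinity>"
      by (auto simp: top_unique)
  qed measurable
  with AE_total_displacement AE_move_seq_occupied show ?thesis
  proof eventually_elim
    case (elim m)
    let ?Y = "limit_points m"
    have Vfin: "?V m k \<noteq> \<infinity>" for k using elim(1) by simp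
    define e where "e n = 1 / 4 ^ n * (\<bar>?Y (?p n) - of_int (?p n)\<bar> + \<bar>?Y (- ?p n) - of_int (- ?p n)\<bar>)" for n
    have "(\<Sum>n. ennreal (e n)) \<le> (\<Sum>n. ennreal (1 / 4 ^ n) * (?V m (?p n) + ?V m (- ?p n)))"
    proof (intro suminf_le)
      fix n
      have "ennreal (e n) = ennreal (1 / 4 ^ n) * (ennreal \<bar>?Y (?p n) - of_int (?p n)\<bar> + ennreal \<bar>?Y (- ?p n) - of_int (- ?p n)\<bar>)"
        unfolding e_def by (subst ennreal_mult) (auto simp: ennreal_plus)
      also have "\<dots> \<le> ennreal (1 / 4 ^ n) * (?V m (?p n) + ?V m (- ?p n))"
        by (intro mult_left_mono add_mono limit_points_tendsto(2) Vfin) auto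
      finally show "ennreal (e n) \<le> ennreal (1 / 4 ^ n) * (?V m (?p n) + ?V m (- ?p n))" .
    qed auto
    then have "(\<Sum>n. ennreal (e n)) \<noteq> top" using elim(3) by (auto simp: top_unique)
    then have "summable e" by (intro summable_suminf_not_top) (auto simp: e_def)
    then have "e \<longlonglongrightarrow> 0" by (rule summable_LIMSEQ_zero)
    then have ev: "eventually (\<lambda>n. e n < 1 / 2) sequentially" by (rule order_tendstoD) simp
    have big: "\<exists>n. a < 4 ^ n / 2 \<and> e n < 1 / 2" for a :: real
    proof -
      obtain N where N: "2 * a < 4 ^ N" using real_arch_pow[of 4 "2 * a"] by auto
      obtain M where M: "\<And>n. M \<le> n \<Longrightarrow> e n < 1 / 2" using ev by (auto simp: eventually_sequentially)
      have "2 * a < 4 ^ max N M"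
        by (rule less_le_trans[OF N power_increasing]) simp_all
      then show ?thesis using M[of "max N M"] by (intro exI[of _ "max N M"]) simp
    qed
    have dev: "\<bar>?Y (?p n) - 4 ^ n\<bar> < 4 ^ n / 2 \<and> \<bar>?Y (- ?p n) + 4 ^ n\<bar> < 4 ^ n / 2" if "e n < 1 / 2" for n
    proof -
      have "\<bar>?Y (?p n) - 4 ^ n\<bar> + \<bar>?Y (- ?p n) + 4 ^ n\<bar> < 4 ^ n / 2"
        using that by (simp add: e_def field_simps)
      then show ?thesis by linarith
    qed
    show ?case
    proof (rule two_sidedI)
      show "mono ?Y" by (rule mono_limit_points) (use elim(2) Vfin in auto)
      fix a :: real
      obtain n where n: "a < 4 ^ n / 2" "e n < 1 / 2" using big by blast
      have "a < ?Y (?p n)" using n(1) dev[OF n(2)] by linarith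
      then show "\<exists>i. a < ?Y i" ..
      obtain n where n: "- a < 4 ^ n / 2" "e n < 1 / 2" using big by blast
      have "?Y (- ?p n) \<le> a" using n(1) dev[OF n(2)] by linarith
      then show "\<exists>i. ?Y i \<le> a" ..
    qed
  qed
qed

section \<open>The Palm law of the limit\<close>

text \<open>
  The indicator of a closed set is a limit of continuous functions of the distance from it, and the
  closed sets generate the Borel sets.
\<close>

lemma measure_eqI_continuous:
  fixes M N :: "'a::metric_space measure"
  assumes "finite_measure M" "finite_measure N" and sets: "sets M = sets borel" "sets N = sets borel"
    and eq: "\<And>f :: 'a \<Rightarrow> real. continuous_on UNIV f \<Longrightarrow> (\<And>x. 0 \<le> f x) \<Longrightarrow> (\<And>x. f x \<le> 1) \<Longrightarrow>
      (\<integral>\<^sup>+x. ennreal (f x) \<partial>M) = (\<integral>\<^sup>+x. ennreal (f x) \<partial>N)"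
  shows "M = N"
proof (rule measure_eqI_generator_eq[where E = "Collect closed" and \<Omega> = UNIV and A = "\<lambda>_. UNIV"])
  have space: "space M = UNIV" "space N = UNIV" using sets_eq_imp_space_eq[OF sets(1)] sets_eq_imp_space_eq[OF sets(2)] by simp_all
  show "Int_stable (Collect closed :: 'a set set)" by (auto simp: Int_stable_def)
  show "sets M = sigma_sets UNIV (Collect closed)" "sets N = sigma_sets UNIV (Collect closed)"
    unfolding sets by (simp_all add: borel_eq_closed)
  show "emeasure M UNIV \<noteq> \<infinity>" using finite_measure.emeasure_finite[OF assms(1)] by simp
  fix A :: "'a set" assume "A \<in> Collect closed"
  then have A: "closed A" by simp
  show "emeasure M A = emeasure N A"
  proof (cases "A = {}")
    case False
    define f where "f n x = max 0 (1 - real n * infdist x A)" for n x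
    have cont: "continuous_on UNIV (f n)" for n
      unfolding f_def by (intro continuous_intros)
    have f01: "0 \<le> f n x" "f n x \<le> 1" for n x by (auto simp: f_def infdist_nonneg)
    have lim: "(\<lambda>n. ennreal (f n x)) \<longlonglongrightarrow> indicator A x" for x
    proof (cases "x \<in> A")
      case True
      then show ?thesis by (simp add: f_def)
    next
      case x: False
      then have d: "0 < infdist x A"
        using infdist_pos_not_in_closed[OF A False] by simp
      obtain n0 :: nat where n0: "1 / infdist x A < real n0" using reals_Archimedean2 by blast
      have "f n x = 0" if "n0 \<le> n" for n
      proof -
        have "1 < real n0 * infdist x A" using n0 d by (simp add: field_simps)
        also have "\<dots> \<le> real n * infdist x A" using that d by (intro mult_right_mono) auto
        finally show ?thesis by (simp add: f_def)
      qed
      then have "eventually (\<lambda>n. ennreal (f n x) = indicator A x) sequentially"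
        using x by (intro eventually_sequentiallyI[of n0]) simp
      then show ?thesis by (rule tendsto_eventually)
    qed
    have conv: "(\<lambda>n. \<integral>\<^sup>+x. ennreal (f n x) \<partial>L) \<longlonglongrightarrow> emeasure L A"
      if L: "finite_measure L" "sets L = sets borel" for L
    proof -
      have [measurable_cong]: "sets L = sets borel" by fact
      have [measurable]: "f n \<in> borel_measurable borel" for n by (rule borel_measurable_continuous_onI[OF cont])
      have [measurable]: "A \<in> sets borel" using A by simp
      have "(\<lambda>n. \<integral>\<^sup>+x. ennreal (f n x) \<partial>L) \<longlonglongrightarrow> (\<integral>\<^sup>+x. indicator A x \<partial>L)"
      proof (rule nn_integral_dominated_convergence[where w = "\<lambda>_. 1"])
        show "(\<integral>\<^sup>+x. 1 \<partial>L) < \<infinity>"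
          using finite_measure.emeasure_finite[OF L(1), of "space L"] by (simp add: less_top[symmetric])
      qed (use f01 lim in \<open>auto simp: ennreal_le_1\<close>)
      moreover have "A \<in> sets L" using A by (simp add: L(2))
      ultimately show ?thesis by simp
    qed
    have "(\<integral>\<^sup>+x. ennreal (f n x) \<partial>M) = (\<integral>\<^sup>+x. ennreal (f n x) \<partial>N)" for n
      by (rule eq[OF cont f01])
    then show ?thesis
      using conv[OF assms(1) sets(1)] conv[OF assms(2) sets(2)] LIMSEQ_unique by fastforce
  qed simp
qed auto

lemma tendsto_fun:
  fixes a :: "'t \<Rightarrow> 'i \<Rightarrow> 'b::topological_space"
  assumes "\<And>i. ((\<lambda>t. a t i) \<longlongrightarrow> l i) F"
  shows "(a \<longlongrightarrow> l) F"
proof -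
  have "limitin (product_topology (\<lambda>_. euclidean) UNIV) a l F"
    using assms by (simp add: limitin_componentwise)
  then show ?thesis by (simp add: euclidean_product_topology)
qed

lemma continuous_tendsto_fun:
  assumes "continuous_on UNIV f" "\<And>i. (\<lambda>t. a t i) \<longlonglongrightarrow> l i"
  shows "(\<lambda>t. f (a t)) \<longlonglongrightarrow> f l"
  by (rule continuous_on_tendsto_compose[OF assms(1) tendsto_fun[OF assms(2)]]) simp_all

definition limit_palm :: "(int \<Rightarrow> real) measure" where
  "limit_palm = distr move_seq borel limit_points"

lemma sets_limit_palm [measurable_cong]: "sets limit_palm = sets borel"
  by (simp add: limit_palm_def)

lemma measurable_limit_points_id: "limit_points \<in> borel_measurable move_seq"
  using measurable_limit_points[of "\<lambda>m. m" move_seq] by measurable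

lemma measurable_backward_lattice: "(\<lambda>m. backward t m lattice) \<in> borel_measurable move_seq"
  using measurable_backward[of "\<lambda>m. m" move_seq "\<lambda>_. lattice" t] by measurable

lemma nn_integral_limit_palm:
  "F \<in> borel_measurable borel \<Longrightarrow> (\<integral>\<^sup>+x. F x \<partial>limit_palm) = (\<integral>\<^sup>+m. F (limit_points m) \<partial>move_seq)"
  unfolding limit_palm_def by (rule nn_integral_distr) (simp_all add: measurable_limit_points_id)

lemma prob_space_limit_palm: "prob_space limit_palm"
  unfolding limit_palm_def by (rule move_seq.prob_space_distr) (simp add: measurable_limit_points_id)

interpretation lattice_palm:
  palm_pair "clustering_law (from_palm (return borel lattice)) t" "(palm_step_law ^^ t) (return borel lattice)" for t
  by (rule palm_pair.palm_pair_clustering[OF palm_pair_lattice AE_strict_mono_lattice])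

lemma nn_integral_backward_lattice:
  assumes [measurable]: "F \<in> borel_measurable borel"
  shows "(\<integral>\<^sup>+x. F x \<partial>(palm_step_law ^^ t) (return borel lattice)) = (\<integral>\<^sup>+m. F (backward t m lattice) \<partial>move_seq)"
proof -
  have "(\<integral>\<^sup>+x. F x \<partial>(palm_step_law ^^ t) (return borel lattice)) =
    (\<integral>\<^sup>+m. \<integral>\<^sup>+x. F (backward t m x) \<partial>return borel lattice \<partial>move_seq)"
    by (rule nn_integral_backward) (auto intro: prob_space_return)
  also have "\<dots> = (\<integral>\<^sup>+m. F (backward t m lattice) \<partial>move_seq)"
  proof (rule nn_integral_cong)
    fix m
    have "(\<lambda>x. backward t m x) \<in> borel_measurable borel"
      by (rule measurable_backward) (simp_all add: space_PiM)
    from measurable_compose[OF this assms]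
    show "(\<integral>\<^sup>+x. F (backward t m x) \<partial>return borel lattice) = F (backward t m lattice)"
      by (rule nn_integral_return_lattice)
  qed
  finally show ?thesis .
qed

lemma AE_limit_points_tendsto: "AE m in move_seq. \<forall>k. (\<lambda>t. backward t m lattice k) \<longlonglongrightarrow> limit_points m k"
  using AE_total_displacement by eventually_elim (simp add: limit_points_tendsto)

text \<open>
  The Palm laws at all times are invariant, and recentring is continuous, so that the invariance
  passes to the weak limit.
\<close>

lemma limit_palm_recenter:
  assumes [measurable]: "F \<in> borel_measurable borel"
  shows "(\<integral>\<^sup>+x. F (recenter k x) \<partial>limit_palm) = (\<integral>\<^sup>+x. F x \<partial>limit_palm)"
proof -
  interpret prob_space limit_palm by (rule prob_space_limit_palm)
  have [measurable]: "(\<lambda>x. recenter k x) \<in> borel_measurable limit_palm" by measurable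
  have conv: "(\<lambda>t. \<integral>\<^sup>+x. ennreal (f x) \<partial>(palm_step_law ^^ t) (return borel lattice)) \<longlonglongrightarrow> (\<integral>\<^sup>+x. ennreal (f x) \<partial>limit_palm)"
    if f: "continuous_on UNIV f" "\<And>x. 0 \<le> f x" "\<And>x. f x \<le> 1" for f :: "(int \<Rightarrow> real) \<Rightarrow> real"
  proof -
    have mf [measurable]: "f \<in> borel_measurable borel" by (rule borel_measurable_continuous_onI[OF f(1)])
    note [measurable] = measurable_backward_lattice measurable_limit_points_id
    have "(\<lambda>t. \<integral>\<^sup>+m. ennreal (f (backward t m lattice)) \<partial>move_seq) \<longlonglongrightarrow> (\<integral>\<^sup>+m. ennreal (f (limit_points m)) \<partial>move_seq)"
    proof (rule nn_integral_dominated_convergence[where w = "\<lambda>_. 1"])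
      show "AE m in move_seq. (\<lambda>t. ennreal (f (backward t m lattice))) \<longlonglongrightarrow> ennreal (f (limit_points m))"
        using AE_limit_points_tendsto
        by eventually_elim (intro tendsto_ennrealI continuous_tendsto_fun[OF f(1)], simp)
    qed (use f in \<open>simp_all add: move_seq.emeasure_space_1 ennreal_le_1\<close>)
    then show ?thesis by (simp add: nn_integral_backward_lattice nn_integral_limit_palm)
  qed
  have "distr limit_palm borel (recenter k) = limit_palm"
  proof (rule measure_eqI_continuous)
    show "finite_measure (distr limit_palm borel (recenter k))"
      by (intro prob_space.finite_measure prob_space_distr) measurable
    show "finite_measure limit_palm" by (rule finite_measure)
    fix f :: "(int \<Rightarrow> real) \<Rightarrow> real"
    assume f: "continuous_on UNIV f" "\<And>x. 0 \<le> f x" "\<And>x. f x \<le> 1"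
    have mf [measurable]: "f \<in> borel_measurable borel" by (rule borel_measurable_continuous_onI[OF f(1)])
    have "continuous_on UNIV (recenter k)"
      unfolding recenter_def by (intro continuous_intros continuous_on_product_coordinates)
    then have "continuous_on UNIV (\<lambda>x. f (recenter k x))"
      by (rule continuous_on_compose2[OF f(1)]) auto
    from conv[OF this f(2) f(3)]
    have "(\<lambda>t. \<integral>\<^sup>+x. ennreal (f (recenter k x)) \<partial>(palm_step_law ^^ t) (return borel lattice)) \<longlonglongrightarrow>
      (\<integral>\<^sup>+x. ennreal (f (recenter k x)) \<partial>limit_palm)" .
    moreover have "(\<integral>\<^sup>+x. ennreal (f (recenter k x)) \<partial>(palm_step_law ^^ t) (return borel lattice)) =
      (\<integral>\<^sup>+x. ennreal (f x) \<partial>(palm_step_law ^^ t) (return borel lattice))" for t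
      by (rule lattice_palm.palm_recenter) measurable
    ultimately have "(\<lambda>t. \<integral>\<^sup>+x. ennreal (f x) \<partial>(palm_step_law ^^ t) (return borel lattice)) \<longlonglongrightarrow>
      (\<integral>\<^sup>+x. ennreal (f (recenter k x)) \<partial>limit_palm)" by simp
    from LIMSEQ_unique[OF this conv[OF f]]
    show "(\<integral>\<^sup>+x. ennreal (f x) \<partial>distr limit_palm borel (recenter k)) = (\<integral>\<^sup>+x. ennreal (f x) \<partial>limit_palm)"
      by (simp add: nn_integral_distr)
  qed (simp_all add: sets_limit_palm)
  from arg_cong[OF this, of "\<lambda>M. \<integral>\<^sup>+x. F x \<partial>M"] show ?thesis
    by (simp add: nn_integral_distr)
qed

text \<open>
  A mean can drop in a weak limit; here the gaps are dominated by the integrable variable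
  \<open>1 + total_displacement m 1\<close>.
\<close>

lemma limit_palm_mean_gap: "(\<integral>\<^sup>+x. ennreal (x 1) \<partial>limit_palm) = 1"
proof -
  note [measurable] = measurable_point[OF measurable_backward_lattice] measurable_point[OF measurable_limit_points_id]
  have [measurable]: "(\<lambda>m. displacement t m k) \<in> borel_measurable move_seq" for t k
    using measurable_point[OF measurable_displacement[of "\<lambda>m. m" move_seq t]] by measurable
  have "(\<lambda>t. \<integral>\<^sup>+m. ennreal (backward t m lattice 1) \<partial>move_seq) \<longlonglongrightarrow> (\<integral>\<^sup>+m. ennreal (limit_points m 1) \<partial>move_seq)"
  proof (rule nn_integral_dominated_convergence[where w = "\<lambda>m. 1 + total_displacement m 1"])
    show "AE m in move_seq. ennreal (backward t m lattice 1) \<le> 1 + total_displacement m 1" for t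
      using AE_total_displacement
    proof eventually_elim
      case (elim m)
      have "ennreal (backward t m lattice 1) \<le> ennreal (1 + \<bar>backward t m lattice 1 - 1\<bar>)"
        by (rule ennreal_leI) simp
      also have "\<dots> = 1 + ennreal \<bar>backward t m lattice 1 - 1\<bar>" by (simp add: ennreal_plus)
      also have "\<dots> \<le> 1 + total_displacement m 1"
        using limit_points_tendsto(3)[of m 1 t] elim by (intro add_left_mono) simp
      finally show ?case .
    qed
    have "(\<integral>\<^sup>+m. 1 + total_displacement m 1 \<partial>move_seq) = 1 + (\<integral>\<^sup>+m. total_displacement m 1 \<partial>move_seq)"
      by (subst nn_integral_add) (simp_all add: move_seq.emeasure_space_1)
    also have "\<dots> \<le> 1 + ennreal (sqrt \<bar>of_int 1\<bar> * (5 + 12 * exp 1))"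
      by (intro add_left_mono mean_total_displacement)
    also have "\<dots> < \<infinity>" by (simp flip: ennreal_plus ennreal_1)
    finally show "(\<integral>\<^sup>+m. 1 + total_displacement m 1 \<partial>move_seq) < \<infinity>" .
    show "AE m in move_seq. (\<lambda>t. ennreal (backward t m lattice 1)) \<longlonglongrightarrow> ennreal (limit_points m 1)"
      using AE_limit_points_tendsto by eventually_elim (intro tendsto_ennrealI, simp)
  qed measurable
  moreover have "(\<integral>\<^sup>+m. ennreal (backward t m lattice 1) \<partial>move_seq) = 1" for t
    using lattice_palm.palm_mean_gap[of t] nn_integral_backward_lattice[of "\<lambda>x. ennreal (x 1)" t] by simp
  ultimately have "(\<lambda>t::nat. 1 :: ennreal) \<longlonglongrightarrow> (\<integral>\<^sup>+m. ennreal (limit_points m 1) \<partial>move_seq)" by simp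
  from LIMSEQ_unique[OF this tendsto_const] show ?thesis
    by (subst nn_integral_limit_palm) simp_all
qed

lemma palm_pair_limit: "palm_pair (from_palm limit_palm) limit_palm"
proof (rule palm_pair_from_palm[OF prob_space_limit_palm sets_limit_palm _ limit_palm_recenter limit_palm_mean_gap])
  have "AE m in move_seq. limit_points m 0 = 0 \<and> two_sided (limit_points m)"
    using AE_total_displacement AE_two_sided_limit_points
    by eventually_elim (simp add: limit_points_0)
  then show "AE x in limit_palm. x 0 = 0 \<and> two_sided x"
    unfolding limit_palm_def by (subst AE_distr_iff) (simp_all add: measurable_limit_points_id)
qed

section \<open>Exponential moments of the gaps\<close>

text \<open>
  By convexity of exp a step replaces \<open>\<alpha>\<close> by \<open>3 / 4 * \<alpha>\<close> and the length \<open>k - j\<close> by the distance of two sites, whose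
  exponential moment with parameter \<open>\<theta>\<close> is that of \<open>palm_site_mgf\<close>. The coefficients are the ones for which
  the bound reproduces itself. The linear one stays, as \<open>4 / 3 * 3 / 4 = 1\<close>; the square one receives
  \<open>4 / 3 * 2 / 3 * 9 / 16 = 1 / 2\<close> from the induction hypothesis and at most \<open>1 / 6\<close> from the sites, in total
  \<open>2 / 3\<close>; the constant one receives \<open>3 / 4 * 8 / 3 = 2\<close> and at most \<open>2 / 3\<close>, in total \<open>8 / 3\<close>.
\<close>

lemma exp_moment_backward:
  assumes "0 \<le> \<alpha>" "\<alpha> \<le> 2 / 3" "j \<le> k"
  shows "(\<integral>\<^sup>+m. ennreal (exp (\<alpha> * (backward t m lattice k - backward t m lattice j))) \<partial>move_seq) \<le>
    ennreal (exp (of_int (k - j) * (\<alpha> + 2 / 3 * \<alpha>\<^sup>2) + 8 / 3 * \<alpha>))"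
  using assms
proof (induction t arbitrary: \<alpha> j k)
  case 0
  have "\<alpha> * (of_int k - of_int j) \<le> of_int (k - j) * (\<alpha> + 2 / 3 * \<alpha>\<^sup>2) + 8 / 3 * \<alpha>"
    using 0 mult_nonneg_nonneg[of "of_int (k - j)" "2 / 3 * \<alpha>\<^sup>2"] by (simp add: algebra_simps)
  then show ?case by (simp add: move_seq.emeasure_space_1 ennreal_leI)
next
  case (Suc t)
  define \<theta> where "\<theta> = 3 / 4 * \<alpha> + 2 / 3 * (3 / 4 * \<alpha>)\<^sup>2"
  let ?n = "of_int (k - j) :: real"
  have \<theta>: "0 \<le> \<theta>" "\<theta> \<le> \<alpha>"
  proof -
    show "0 \<le> \<theta>" using Suc.prems by (simp add: \<theta>_def)
    have "\<alpha> * \<alpha> \<le> \<alpha> * (2 / 3)" using Suc.prems by (intro mult_left_mono) auto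
    then show "\<theta> \<le> \<alpha>" by (simp add: \<theta>_def power2_eq_square)
  qed
  note [measurable] = measurable_point[OF measurable_backward_lattice]
  have one: "(\<integral>\<^sup>+m. ennreal (exp (\<alpha> * (palm_step s (backward t m lattice) k - palm_step s (backward t m lattice) j))) \<partial>move_seq)
      \<le> ennreal (exp (2 * \<alpha>)) * ennreal (exp (\<theta> * (of_int (site s 0 k) - of_int (site s 0 j))))"
    if s: "occupied s 0" for s
  proof -
    let ?k = "site s 0 k" and ?j = "site s 0 j"
    have jk: "?j \<le> ?k" using Suc.prems by (simp add: strict_mono_less_eq[OF strict_mono_site[OF s]])
    let ?b = "exp (\<theta> * (of_int ?k - of_int ?j) + 2 * \<alpha>)"
    have "ennreal (exp (\<alpha> * (palm_step s y k - palm_step s y j))) \<le>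
        ennreal (1 / 2) * ennreal (exp (3 / 4 * \<alpha> * (y ?k - y ?j))) + ennreal (1 / 2) * ennreal (exp (3 / 4 * \<alpha> * (y (?k + 1) - y (?j + 1))))"
      for y
    proof -
      let ?a = "3 / 4 * \<alpha> * (y ?k - y ?j)" and ?c = "3 / 4 * \<alpha> * (y (?k + 1) - y (?j + 1))"
      have e: "\<alpha> * (palm_step s y k - palm_step s y j) = (?a + ?c) / 2"
        by (simp add: palm_step_def midpt_def field_simps)
      have "exp ((u + v) / 2) \<le> 1 / 2 * exp u + 1 / 2 * exp v" for u v :: real
      proof -
        have "0 \<le> (exp (u / 2) - exp (v / 2))\<^sup>2" by simp
        then show ?thesis by (simp add: power2_diff add_divide_distrib exp_add flip: exp_double)
      qed
      then have "ennreal (exp ((?a + ?c) / 2)) \<le> ennreal (1 / 2 * exp ?a + 1 / 2 * exp ?c)" by (rule ennreal_leI)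
      also have "\<dots> = ennreal (1 / 2) * ennreal (exp ?a) + ennreal (1 / 2) * ennreal (exp ?c)"
        by (simp only: ennreal_plus ennreal_mult zero_le_divide_1_iff zero_le_numeral mult_nonneg_nonneg exp_ge_zero)
      finally show ?thesis unfolding e .
    qed
    then have "(\<integral>\<^sup>+m. ennreal (exp (\<alpha> * (palm_step s (backward t m lattice) k - palm_step s (backward t m lattice) j))) \<partial>move_seq) \<le>
      (\<integral>\<^sup>+m. ennreal (1 / 2) * ennreal (exp (3 / 4 * \<alpha> * (backward t m lattice ?k - backward t m lattice ?j))) +
         ennreal (1 / 2) * ennreal (exp (3 / 4 * \<alpha> * (backward t m lattice (?k + 1) - backward t m lattice (?j + 1)))) \<partial>move_seq)"
      by (intro nn_integral_mono)
    also have "\<dots> = ennreal (1 / 2) * (\<integral>\<^sup>+m. ennreal (exp (3 / 4 * \<alpha> * (backward t m lattice ?k - backward t m lattice ?j))) \<partial>move_seq) +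
        ennreal (1 / 2) * (\<integral>\<^sup>+m. ennreal (exp (3 / 4 * \<alpha> * (backward t m lattice (?k + 1) - backward t m lattice (?j + 1)))) \<partial>move_seq)"
      by (subst nn_integral_add, simp, simp, subst (1 2) nn_integral_cmult) simp_all
    also have "\<dots> \<le> ennreal (1 / 2) * ennreal ?b + ennreal (1 / 2) * ennreal ?b"
    proof -
      have e1: "of_int (?k - ?j) * (3 / 4 * \<alpha> + 2 / 3 * (3 / 4 * \<alpha>)\<^sup>2) + 8 / 3 * (3 / 4 * \<alpha>) = \<theta> * (of_int ?k - of_int ?j) + 2 * \<alpha>"
        by (simp add: \<theta>_def)
      have e2: "of_int (?k + 1 - (?j + 1)) * (3 / 4 * \<alpha> + 2 / 3 * (3 / 4 * \<alpha>)\<^sup>2) + 8 / 3 * (3 / 4 * \<alpha>) = \<theta> * (of_int ?k - of_int ?j) + 2 * \<alpha>"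
        by (simp add: \<theta>_def)
      have small: "0 \<le> 3 / 4 * \<alpha>" "3 / 4 * \<alpha> \<le> 2 / 3" using Suc.prems by simp_all
      have jk1: "?j + 1 \<le> ?k + 1" using jk by simp
      have IH1: "(\<integral>\<^sup>+m. ennreal (exp (3 / 4 * \<alpha> * (backward t m lattice ?k - backward t m lattice ?j))) \<partial>move_seq) \<le> ennreal ?b"
        using Suc.IH[OF small jk] unfolding e1 .
      have IH2: "(\<integral>\<^sup>+m. ennreal (exp (3 / 4 * \<alpha> * (backward t m lattice (?k + 1) - backward t m lattice (?j + 1)))) \<partial>move_seq) \<le> ennreal ?b"
        using Suc.IH[OF small jk1] unfolding e2 .
      show ?thesis
        using mult_left_mono[OF IH1, of "ennreal (1 / 2)"] mult_left_mono[OF IH2, of "ennreal (1 / 2)"]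
        by (intro add_mono) simp_all
    qed
    also have "\<dots> = ennreal (1 / 2 * ?b + 1 / 2 * ?b)"
      by (simp only: ennreal_plus ennreal_mult zero_le_divide_1_iff zero_le_numeral mult_nonneg_nonneg exp_ge_zero)
    also have "1 / 2 * ?b + 1 / 2 * ?b = exp (2 * \<alpha>) * exp (\<theta> * (of_int ?k - of_int ?j))"
      by (simp add: add.commute flip: exp_add)
    also have "ennreal \<dots> = ennreal (exp (2 * \<alpha>)) * ennreal (exp (\<theta> * (of_int ?k - of_int ?j)))"
      by (rule ennreal_mult) simp_all
    finally show ?thesis .
  qed
  have "(\<lambda>m. ennreal (exp (\<alpha> * (backward (Suc t) m lattice k - backward (Suc t) m lattice j)))) \<in> borel_measurable move_seq"
    by measurable
  then have "(\<lambda>m. ennreal (exp (\<alpha> * (backward (Suc t) m lattice k - backward (Suc t) m lattice j)))) \<in> borel_measurable move_seq_space"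
    by (simp cong: measurable_cong_sets add: sets_move_seq)
  from nn_integral_move_seq[OF this]
  have "(\<integral>\<^sup>+m. ennreal (exp (\<alpha> * (backward (Suc t) m lattice k - backward (Suc t) m lattice j))) \<partial>move_seq) =
    (\<integral>\<^sup>+s. \<integral>\<^sup>+m. ennreal (exp (\<alpha> * (palm_step s (backward t m lattice) k - palm_step s (backward t m lattice) j))) \<partial>move_seq \<partial>palm_moves)"
    by simp
  also have "\<dots> \<le> (\<integral>\<^sup>+s. ennreal (exp (2 * \<alpha>)) * ennreal (exp (\<theta> * (of_int (site s 0 k) - of_int (site s 0 j)))) \<partial>palm_moves)"
    by (rule nn_integral_mono_AE) (use AE_palm_moves_occupied in eventually_elim, rule one)
  also have "\<dots> = ennreal (exp (2 * \<alpha>)) * (\<integral>\<^sup>+s. ennreal (exp (\<theta> * (of_int (site s 0 k) - of_int (site s 0 j)))) \<partial>palm_moves)"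
    by (rule nn_integral_cmult) measurable
  also have "(\<integral>\<^sup>+s. ennreal (exp (\<theta> * (of_int (site s 0 k) - of_int (site s 0 j)))) \<partial>palm_moves) =
    (\<integral>\<^sup>+s. ennreal (exp (\<theta> * of_int (site s 0 (k - j)))) \<partial>palm_moves)"
    by (rule site_increments[where F = "\<lambda>y. ennreal (exp (\<theta> * y))"]) measurable
  also have "\<dots> = (\<integral>\<^sup>+s. ennreal (exp (4 / 3 * \<theta> * ?n)) * site_mgf \<theta> (nat (k - j)) s \<partial>palm_moves)"
    using Suc.prems by (intro nn_integral_cong) (simp add: site_mgf_def algebra_simps flip: ennreal_mult exp_add)
  also have "\<dots> = ennreal (exp (4 / 3 * \<theta> * ?n)) * (\<integral>\<^sup>+s. site_mgf \<theta> (nat (k - j)) s \<partial>palm_moves)"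
    by (rule nn_integral_cmult) measurable
  also have "ennreal (exp (2 * \<alpha>)) * \<dots> \<le> ennreal (exp (2 * \<alpha>)) * (ennreal (exp (4 / 3 * \<theta> * ?n)) *
      ennreal (exp (\<theta>\<^sup>2 * real (nat (k - j)) / 6 + 2 / 3 * \<bar>\<theta>\<bar>)))"
    using \<theta> Suc.prems by (intro mult_left_mono palm_site_mgf) auto
  also have "\<dots> = ennreal (exp (2 * \<alpha> + (4 / 3 * \<theta> * ?n + (\<theta>\<^sup>2 * ?n / 6 + 2 / 3 * \<theta>))))"
    using \<theta> Suc.prems by (simp add: exp_add ennreal_mult)
  also have "\<dots> \<le> ennreal (exp (?n * (\<alpha> + 2 / 3 * \<alpha>\<^sup>2) + 8 / 3 * \<alpha>))"
  proof -
    have n: "0 \<le> ?n" using Suc.prems by simp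
    have sq: "\<theta>\<^sup>2 \<le> \<alpha>\<^sup>2" using \<theta> by (intro power_mono)
    have "4 / 3 * \<theta> = \<alpha> + \<alpha>\<^sup>2 / 2" by (simp add: \<theta>_def power2_eq_square)
    then have "4 / 3 * \<theta> + \<theta>\<^sup>2 / 6 \<le> \<alpha> + 2 / 3 * \<alpha>\<^sup>2" using sq by linarith
    from mult_left_mono[OF this n]
    have "?n * (4 / 3 * \<theta> + \<theta>\<^sup>2 / 6) \<le> ?n * (\<alpha> + 2 / 3 * \<alpha>\<^sup>2)" .
    then have "2 * \<alpha> + (4 / 3 * \<theta> * ?n + (\<theta>\<^sup>2 * ?n / 6 + 2 / 3 * \<theta>)) \<le> ?n * (\<alpha> + 2 / 3 * \<alpha>\<^sup>2) + 8 / 3 * \<alpha>"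
      using \<theta>(2) by (simp add: algebra_simps)
    then show ?thesis by (simp add: ennreal_leI)
  qed
  finally show ?case .
qed

text \<open>
  The exponential moment with parameter 1/2 is finite by Fatou's lemma; the tail follows by Markov's
  inequality.
\<close>

lemma exponential_tail_limit: "exponential_tail limit_palm (gap 0)"
proof -
  define D where "D = exp (of_int (1 - 0) * (1 / 2 + 2 / 3 * (1 / 2)\<^sup>2) + 8 / 3 * (1 / 2) :: real)"
  note [measurable] = measurable_point[OF measurable_backward_lattice] measurable_point[OF measurable_limit_points_id]
  interpret prob_space limit_palm by (rule prob_space_limit_palm)
  have "(\<integral>\<^sup>+m. ennreal (exp (1 / 2 * (limit_points m 1 - limit_points m 0))) \<partial>move_seq) =
    (\<integral>\<^sup>+m. liminf (\<lambda>t. ennreal (exp (1 / 2 * (backward t m lattice 1 - backward t m lattice 0)))) \<partial>move_seq)"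
  proof (rule nn_integral_cong_AE)
    show "AE m in move_seq. ennreal (exp (1 / 2 * (limit_points m 1 - limit_points m 0))) =
        liminf (\<lambda>t. ennreal (exp (1 / 2 * (backward t m lattice 1 - backward t m lattice 0))))"
      using AE_limit_points_tendsto
    proof eventually_elim
      case (elim m)
      then have "(\<lambda>t. ennreal (exp (1 / 2 * (backward t m lattice 1 - backward t m lattice 0)))) \<longlonglongrightarrow>
        ennreal (exp (1 / 2 * (limit_points m 1 - limit_points m 0)))"
        by (intro tendsto_ennrealI tendsto_intros) auto
      then show ?case by (intro lim_imp_Liminf[symmetric]) simp_all
    qed
  qed
  also have "\<dots> \<le> liminf (\<lambda>t. \<integral>\<^sup>+m. ennreal (exp (1 / 2 * (backward t m lattice 1 - backward t m lattice 0))) \<partial>move_seq)"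
    by (rule nn_integral_liminf) measurable
  also have "\<dots> \<le> liminf (\<lambda>t::nat. ennreal D)"
    unfolding D_def by (intro Liminf_mono always_eventually allI exp_moment_backward) auto
  also have "\<dots> = ennreal D" by (rule Liminf_const) simp
  finally have moment: "(\<integral>\<^sup>+x. ennreal (exp (1 / 2 * gap 0 x)) \<partial>limit_palm) \<le> ennreal D"
    unfolding gap_def by (subst nn_integral_limit_palm) simp_all
  have [measurable]: "gap 0 \<in> borel_measurable borel" unfolding gap_def[abs_def] by measurable
  have "measure limit_palm {w \<in> space limit_palm. gap 0 w > z} \<le> D * exp (- (1 / 2) * z)" for z
  proof -
    have [measurable]: "{w \<in> space limit_palm. gap 0 w > z} \<in> sets limit_palm" by measurable
    have "emeasure limit_palm {w \<in> space limit_palm. gap 0 w > z} = (\<integral>\<^sup>+x. indicator {w \<in> space limit_palm. gap 0 w > z} x \<partial>limit_palm)"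
      by simp
    also have "\<dots> \<le> (\<integral>\<^sup>+x. ennreal (exp (- (1 / 2) * z)) * ennreal (exp (1 / 2 * gap 0 x)) \<partial>limit_palm)"
    proof (rule nn_integral_mono)
      fix x
      have "1 \<le> exp (- (1 / 2) * z) * exp (1 / 2 * gap 0 x)" if "gap 0 x > z"
        using that by (simp flip: exp_add)
      then show "indicator {w \<in> space limit_palm. gap 0 w > z} x \<le> ennreal (exp (- (1 / 2) * z)) * ennreal (exp (1 / 2 * gap 0 x))"
        by (auto simp: indicator_def simp flip: ennreal_mult intro: order_trans)
    qed
    also have "\<dots> = ennreal (exp (- (1 / 2) * z)) * (\<integral>\<^sup>+x. ennreal (exp (1 / 2 * gap 0 x)) \<partial>limit_palm)"
      by (rule nn_integral_cmult) measurable
    also have "\<dots> \<le> ennreal (exp (- (1 / 2) * z)) * ennreal D"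
      by (rule mult_left_mono[OF moment]) simp
    also have "\<dots> = ennreal (D * exp (- (1 / 2) * z))"
      by (simp add: D_def mult.commute flip: ennreal_mult)
    finally show ?thesis by (simp add: emeasure_eq_measure D_def)
  qed
  then show ?thesis
    unfolding exponential_tail_def by (intro exI[of _ D] exI[of _ "1 / 2"]) (auto simp: D_def)
qed

section \<open>Convergence\<close>

lemma (in palm_pair) eq_from_palm: "P = from_palm \<mu>"
proof (rule measure_eqI)
  show "sets P = sets (from_palm \<mu>)" by (simp add: sets_P from_palm_def)
  fix A assume A: "A \<in> sets P"
  then have [measurable]: "A \<in> sets borel" by (simp add: sets_P)
  have "emeasure P A = (\<integral>\<^sup>+x. indicator A x \<partial>P)" using A by simp
  also have "\<dots> = (\<integral>\<^sup>+x. indicator A x \<partial>from_palm \<mu>)"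
    by (subst nn_integral_inversion, simp, subst nn_integral_from_palm[OF sets_palm]) simp_all
  also have "\<dots> = emeasure (from_palm \<mu>) A" by (simp add: from_palm_def)
  finally show "emeasure P A = emeasure (from_palm \<mu>) A" .
qed

text \<open>
  When the Palm law is that of a random variable, the place s of the origin becomes a further integration
  variable next to it, and limits can be taken pointwise in both.
\<close>

lemma integral_from_palm_distr:
  fixes F :: "(int \<Rightarrow> real) \<Rightarrow> real"
  assumes [measurable]: "X \<in> borel_measurable N" "F \<in> borel_measurable borel"
  shows "(\<integral>x. F x \<partial>from_palm (distr N borel X)) =
    (\<integral>w. indicator {w. 0 \<le> snd w \<and> snd w < X (fst w) 1} w * F (translate (- snd w) (X (fst w))) \<partial>(N \<Otimes>\<^sub>M lborel))"
proof -
  let ?I = "\<lambda>w. indicator {w. 0 \<le> snd w \<and> snd w < X (fst w) 1} w :: real"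
  let ?T = "\<lambda>w. translate (- snd w) (X (fst w))"
  have X1 [measurable]: "(\<lambda>w. X w 1) \<in> borel_measurable N" by (rule measurable_point) fact
  have [measurable]: "(\<lambda>w. X (fst w)) \<in> borel_measurable (N \<Otimes>\<^sub>M lborel)" by measurable
  have [measurable]: "(\<lambda>w. X (fst w) 1) \<in> borel_measurable (N \<Otimes>\<^sub>M lborel)" by measurable
  have [measurable]: "?I \<in> borel_measurable (N \<Otimes>\<^sub>M lborel)" by measurable
  have [measurable]: "?T \<in> borel_measurable (N \<Otimes>\<^sub>M lborel)" by measurable
  have "from_palm (distr N borel X) = distr (density (N \<Otimes>\<^sub>M lborel) (\<lambda>w. ennreal (?I w))) borel ?T"
  proof (rule measure_eqI)
    fix A assume "A \<in> sets (from_palm (distr N borel X))"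
    then have [measurable]: "A \<in> sets borel" by (simp add: from_palm_def)
    let ?h = "\<lambda>x. \<integral>\<^sup>+s. (if 0 \<le> s \<and> s < x 1 then indicator A (translate (- s) x) else 0 :: ennreal) \<partial>lborel"
    have [measurable]: "?h \<in> borel_measurable borel" by measurable
    have "emeasure (from_palm (distr N borel X)) A = (\<integral>\<^sup>+x. indicator A x \<partial>from_palm (distr N borel X))"
      by (simp add: from_palm_def)
    also have "\<dots> = (\<integral>\<^sup>+x. ?h x \<partial>distr N borel X)"
      by (rule nn_integral_from_palm) simp_all
    also have "\<dots> = (\<integral>\<^sup>+w. ?h (X w) \<partial>N)"
      by (rule nn_integral_distr) measurable
    also have "\<dots> = (\<integral>\<^sup>+w. \<integral>\<^sup>+s. ennreal (?I (w, s)) * indicator A (?T (w, s)) \<partial>lborel \<partial>N)"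
      by (intro nn_integral_cong) (auto simp: indicator_def)
    also have "\<dots> = (\<integral>\<^sup>+w. ennreal (?I w) * indicator A (?T w) \<partial>(N \<Otimes>\<^sub>M lborel))"
      by (rule lborel.nn_integral_fst) measurable
    also have "\<dots> = (\<integral>\<^sup>+x. indicator A x \<partial>distr (density (N \<Otimes>\<^sub>M lborel) (\<lambda>w. ennreal (?I w))) borel ?T)"
      by (simp add: nn_integral_distr nn_integral_density del: nn_integral_indicator)
    also have "\<dots> = emeasure (distr (density (N \<Otimes>\<^sub>M lborel) (\<lambda>w. ennreal (?I w))) borel ?T) A" by simp
    finally show "emeasure (from_palm (distr N borel X)) A = emeasure (distr (density (N \<Otimes>\<^sub>M lborel) (\<lambda>w. ennreal (?I w))) borel ?T) A" .
  qed (simp add: from_palm_def)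
  then show ?thesis by (simp add: integral_distr integral_density)
qed

text \<open>
  The initial laws that the dynamics forgets: the deviation from the lattice has mean square increments
  bounded linearly in their length.
\<close>

locale clustering_start = palm_pair P \<mu> for P \<mu> +
  fixes K :: real
  assumes strict: "AE x in P. strict_mono x" and K: "0 \<le> K"
    and deviation: "\<And>j k. (\<integral>\<^sup>+x. ennreal (((x k - of_int k) - (x j - of_int j))\<^sup>2) \<partial>\<mu>) \<le> ennreal (K * \<bar>of_int k - of_int j\<bar>)"
begin

abbreviation \<Omega> :: "((nat \<Rightarrow> int \<Rightarrow> bool) \<times> (int \<Rightarrow> real)) measure" where
  "\<Omega> \<equiv> move_seq \<Otimes>\<^sub>M \<mu>"

sublocale \<Omega>: pair_prob_space move_seq \<mu> by unfold_locales

text \<open>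
  Both runs use the same moves, so only the start is compared.
\<close>

definition start_effect :: "nat \<Rightarrow> (nat \<Rightarrow> int \<Rightarrow> bool) \<times> (int \<Rightarrow> real) \<Rightarrow> int \<Rightarrow> real" where
  "start_effect t p k = backward t (fst p) (snd p) k - backward t (fst p) lattice k"

lemma measurable_backward_start: "(\<lambda>p. backward t (fst p) (snd p)) \<in> borel_measurable \<Omega>"
  by (rule measurable_backward) measurable

lemma measurable_limit_points_fst: "(\<lambda>p. limit_points (fst p)) \<in> borel_measurable \<Omega>"
  by (rule measurable_limit_points) measurable

lemma measurable_start_effect: "start_effect t \<in> borel_measurable \<Omega>"
proof -
  have "(\<lambda>p. backward t (fst p) lattice) \<in> borel_measurable \<Omega>"
    by (rule measurable_backward) measurable
  from measurable_point[OF this] measurable_point[OF measurable_backward_start] show ?thesis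
    unfolding start_effect_def[abs_def]
    by (intro measurable_coordinatewise_then_product borel_measurable_diff) simp_all
qed

lemma start_effect_decay:
  "(\<integral>\<^sup>+p. ennreal ((start_effect t p k - start_effect t p j)\<^sup>2) \<partial>\<Omega>) \<le> ennreal ((3 / 4) ^ t * K * \<bar>of_int k - of_int j\<bar>)"
proof (rule backward_decay[OF palm.prob_space_axioms measurable_start_effect _ K])
  show "start_effect (Suc t) (m, w) = palm_step (m 0) (start_effect t (\<lambda>i. m (Suc i), w))" for t m w
    by (rule ext) (simp add: start_effect_def[abs_def] palm_step_diff)
  fix j k
  have "(\<integral>\<^sup>+p. ennreal ((start_effect 0 p k - start_effect 0 p j)\<^sup>2) \<partial>\<Omega>) =
    (\<integral>\<^sup>+m. \<integral>\<^sup>+x. ennreal (((x k - of_int k) - (x j - of_int j))\<^sup>2) \<partial>\<mu> \<partial>move_seq)"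
    by (subst palm.nn_integral_fst[symmetric])
       (use measurable_point[OF measurable_start_effect] in \<open>simp_all add: start_effect_def\<close>)
  also have "\<dots> \<le> ennreal (K * \<bar>of_int k - of_int j\<bar>)"
    using deviation by (simp add: move_seq.emeasure_space_1)
  finally show "(\<integral>\<^sup>+p. ennreal ((start_effect 0 p k - start_effect 0 p j)\<^sup>2) \<partial>\<Omega>) \<le> ennreal (K * \<bar>of_int k - of_int j\<bar>)" .
qed

abbreviation total_start_effect :: "(nat \<Rightarrow> int \<Rightarrow> bool) \<times> (int \<Rightarrow> real) \<Rightarrow> int \<Rightarrow> ennreal" where
  "total_start_effect p k \<equiv> (\<Sum>t. ennreal \<bar>start_effect t p k - start_effect t p 0\<bar>)"

lemma measurable_total_start_effect [measurable]: "(\<lambda>p. total_start_effect p k) \<in> borel_measurable \<Omega>"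
proof -
  note [measurable] = measurable_point[OF measurable_start_effect]
  show ?thesis by measurable
qed

lemma measurable_total_displacement_fst [measurable]: "(\<lambda>p. total_displacement (fst p) k) \<in> borel_measurable \<Omega>"
proof -
  have [measurable]: "(\<lambda>p. displacement t (fst p) k) \<in> borel_measurable \<Omega>" for t
    by (rule measurable_point, rule measurable_displacement) measurable
  show ?thesis by measurable
qed

lemma mean_total_start_effect: "(\<integral>\<^sup>+p. total_start_effect p k \<partial>\<Omega>) < \<infinity>"
proof (cases "k = 0")
  case False
  have "(\<integral>\<^sup>+p. total_start_effect p k \<partial>\<Omega>) \<le> ennreal (sqrt \<bar>of_int k\<bar> * (5 + 3 * K))"
  proof (rule nn_integral_suminf_abs_le[OF \<Omega>.P.prob_space_axioms])
    show "(\<lambda>p. start_effect t p k - start_effect t p 0) \<in> borel_measurable \<Omega>" for t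
      using measurable_point[OF measurable_start_effect] by measurable
    show "(\<integral>\<^sup>+p. ennreal ((start_effect t p k - start_effect t p 0)\<^sup>2) \<partial>\<Omega>) \<le> ennreal ((3 / 4) ^ t * K * (sqrt \<bar>of_int k\<bar>)\<^sup>2)" for t
      using start_effect_decay[of t k 0] by simp
  qed (use False K in simp_all)
  also have "\<dots> < \<infinity>" by simp
  finally show ?thesis .
qed simp

definition gap_bound :: "(nat \<Rightarrow> int \<Rightarrow> bool) \<times> (int \<Rightarrow> real) \<Rightarrow> ennreal" where
  "gap_bound p = 1 + total_displacement (fst p) 1 + total_start_effect p 1"

lemma measurable_gap_bound [measurable]: "gap_bound \<in> borel_measurable \<Omega>"
  unfolding gap_bound_def[abs_def] by measurable

lemma AE_fst:
  assumes "AE m in move_seq. A m"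
  shows "AE p in \<Omega>. A (fst p)"
proof (rule AE_distrD[of fst \<Omega> move_seq])
  show "AE m in distr \<Omega> move_seq fst. A m"
    unfolding palm.distr_pair_fst by (rule assms)
qed simp

lemma mean_gap_bound: "(\<integral>\<^sup>+p. gap_bound p \<partial>\<Omega>) < \<infinity>"
proof -
  have "(\<lambda>m. total_displacement m 1) \<in> borel_measurable move_seq"
  proof -
    have [measurable]: "(\<lambda>m. displacement t m 1) \<in> borel_measurable move_seq" for t
      using measurable_point[OF measurable_displacement[of "\<lambda>m. m" move_seq t]] by measurable
    show ?thesis by measurable
  qed
  then have "(\<integral>\<^sup>+p. total_displacement (fst p) 1 \<partial>\<Omega>) = (\<integral>\<^sup>+m. total_displacement m 1 \<partial>move_seq)"
    by (subst palm.nn_integral_fst[symmetric]) (simp_all add: palm.emeasure_space_1)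
  also have "\<dots> < \<infinity>"
    by (rule le_less_trans[OF mean_total_displacement]) simp
  finally have "(\<integral>\<^sup>+p. total_displacement (fst p) 1 \<partial>\<Omega>) < \<infinity>" .
  then show ?thesis
    using mean_total_start_effect[of 1] unfolding gap_bound_def
    by (simp add: nn_integral_add \<Omega>.P.emeasure_space_1 ennreal_add_less_top)
qed

lemma AE_coupled_convergence: "AE p in \<Omega>. (\<forall>k. (\<lambda>t. backward t (fst p) (snd p) k) \<longlonglongrightarrow> limit_points (fst p) k) \<and>
    (\<forall>t. mono (backward t (fst p) (snd p))) \<and> two_sided (limit_points (fst p)) \<and> limit_points (fst p) 0 = 0 \<and>
    (\<forall>t. backward t (fst p) (snd p) 1 \<le> enn2real (gap_bound p))"
proof -
  have start: "AE p in \<Omega>. snd p 0 = 0 \<and> two_sided (snd p)"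
  proof (rule \<Omega>.AE_pair_measure)
    show "AE m in move_seq. AE x in \<mu>. snd (m, x) 0 = 0 \<and> two_sided (snd (m, x))"
      using palm_two_sided by simp
  qed measurable
  have fin: "AE p in \<Omega>. \<forall>k. total_start_effect p k \<noteq> \<infinity>"
    unfolding AE_all_countable
  proof
    fix k
    show "AE p in \<Omega>. total_start_effect p k \<noteq> \<infinity>"
      using mean_total_start_effect[of k] by (intro nn_integral_PInf_AE) auto
  qed
  show ?thesis
    using start fin AE_fst[OF AE_total_displacement] AE_fst[OF AE_move_seq_occupied] AE_fst[OF AE_two_sided_limit_points]
  proof eventually_elim
    case (elim p)
    let ?X = "\<lambda>t. backward t (fst p) (snd p)" and ?L = "\<lambda>t. backward t (fst p) lattice"
    have X0: "?X t 0 = 0" "?L t 0 = 0" for t using elim(1) by (cases t; simp add: palm_step_0)+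
    have eff: "start_effect t p k - start_effect t p 0 = ?X t k - ?L t k" for t k
      by (simp add: start_effect_def X0)
    have sum: "summable (\<lambda>t. \<bar>?X t k - ?L t k\<bar>)" for k
      using elim(2) by (intro summable_suminf_not_top) (auto simp: eff)
    have lim: "(\<lambda>t. ?X t k) \<longlonglongrightarrow> limit_points (fst p) k" for k
    proof -
      have "(\<lambda>t. ?X t k - ?L t k) \<longlonglongrightarrow> 0"
        using summable_LIMSEQ_zero[OF sum[of k]] by (rule tendsto_rabs_zero_cancel)
      moreover have "(\<lambda>t. ?L t k) \<longlonglongrightarrow> limit_points (fst p) k"
        using elim(3) by (intro limit_points_tendsto) simp
      ultimately have "(\<lambda>t. (?X t k - ?L t k) + ?L t k) \<longlonglongrightarrow> 0 + limit_points (fst p) k"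
        by (rule tendsto_add)
      then show ?thesis by simp
    qed
    have bnd: "?X t 1 \<le> enn2real (gap_bound p)" for t
    proof -
      have "(\<Sum>s\<in>{t}. ennreal \<bar>?X s 1 - ?L s 1\<bar>) \<le> (\<Sum>s. ennreal \<bar>?X s 1 - ?L s 1\<bar>)"
        by (rule sum_le_suminf[OF summableI]) simp_all
      then have "ennreal \<bar>?X t 1 - ?L t 1\<bar> \<le> total_start_effect p 1"
        unfolding eff by (simp only: sum.insert sum.empty finite.emptyI empty_iff not_False_eq_True add_0_right)
      moreover have "ennreal \<bar>?L t 1 - 1\<bar> \<le> total_displacement (fst p) 1"
        using limit_points_tendsto(3)[OF spec[OF elim(3), of 1], of t] by (simp only: of_int_1)
      ultimately have "1 + ennreal \<bar>?L t 1 - 1\<bar> + ennreal \<bar>?X t 1 - ?L t 1\<bar> \<le> gap_bound p"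
        unfolding gap_bound_def by (intro add_mono order_refl)
      moreover have "1 + ennreal \<bar>?L t 1 - 1\<bar> + ennreal \<bar>?X t 1 - ?L t 1\<bar> = ennreal (1 + \<bar>?L t 1 - 1\<bar> + \<bar>?X t 1 - ?L t 1\<bar>)"
        by (simp add: ennreal_plus)
      ultimately have "ennreal (1 + \<bar>?L t 1 - 1\<bar> + \<bar>?X t 1 - ?L t 1\<bar>) \<le> gap_bound p" by (simp only:)
      moreover have "gap_bound p < top"
        using spec[OF elim(2), of 1] spec[OF elim(3), of 1]
        unfolding gap_bound_def infinity_ennreal_def top.not_eq_extremum ennreal_add_less_top by simp
      ultimately have "enn2real (ennreal (1 + \<bar>?L t 1 - 1\<bar> + \<bar>?X t 1 - ?L t 1\<bar>)) \<le> enn2real (gap_bound p)"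
        by (rule enn2real_mono)
      moreover have "enn2real (ennreal (1 + \<bar>?L t 1 - 1\<bar> + \<bar>?X t 1 - ?L t 1\<bar>)) = 1 + \<bar>?L t 1 - 1\<bar> + \<bar>?X t 1 - ?L t 1\<bar>"
        by (rule enn2real_ennreal) simp
      ultimately show ?thesis by linarith
    qed
    have "mono (?X t)" for t
      by (rule mono_backward) (use elim(1,4) in \<open>auto dest: two_sidedD\<close>)
    then show ?case
      using lim bnd elim(3,5) by (auto intro: limit_points_0)
  qed
qed

lemma palm_law_eq: "(palm_step_law ^^ t) \<mu> = distr \<Omega> borel (\<lambda>p. backward t (fst p) (snd p))"
proof (rule measure_eqI)
  show "sets ((palm_step_law ^^ t) \<mu>) = sets (distr \<Omega> borel (\<lambda>p. backward t (fst p) (snd p)))"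
    by (simp add: sets_palm_step_law_pow sets_palm)
  fix A assume A: "A \<in> sets ((palm_step_law ^^ t) \<mu>)"
  then have [measurable]: "A \<in> sets borel" by (simp add: sets_palm_step_law_pow sets_palm)
  note [measurable] = measurable_backward_start
  have "emeasure ((palm_step_law ^^ t) \<mu>) A = (\<integral>\<^sup>+x. indicator A x \<partial>(palm_step_law ^^ t) \<mu>)" using A by simp
  also have "\<dots> = (\<integral>\<^sup>+m. \<integral>\<^sup>+x. indicator A (backward t m x) \<partial>\<mu> \<partial>move_seq)"
    by (rule nn_integral_backward[OF palm.prob_space_axioms sets_palm]) simp
  also have "\<dots> = (\<integral>\<^sup>+p. indicator A (backward t (fst p) (snd p)) \<partial>\<Omega>)"
    by (subst palm.nn_integral_fst[symmetric]) simp_all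
  also have "\<dots> = (\<integral>\<^sup>+x. indicator A x \<partial>distr \<Omega> borel (\<lambda>p. backward t (fst p) (snd p)))"
    by (rule nn_integral_distr[symmetric]) simp_all
  also have "\<dots> = emeasure (distr \<Omega> borel (\<lambda>p. backward t (fst p) (snd p))) A" by simp
  finally show "emeasure ((palm_step_law ^^ t) \<mu>) A = emeasure (distr \<Omega> borel (\<lambda>p. backward t (fst p) (snd p))) A" .
qed

lemma limit_palm_eq: "limit_palm = distr \<Omega> borel (\<lambda>p. limit_points (fst p))"
proof -
  have "distr \<Omega> borel (\<lambda>p. limit_points (fst p)) = distr (distr \<Omega> move_seq fst) borel limit_points"
    by (subst distr_distr) (simp_all add: measurable_limit_points_id comp_def)
  then show ?thesis by (simp add: palm.distr_pair_fst limit_palm_def)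
qed

lemma palm_clustering: "palm (clustering_law P t) = (palm_step_law ^^ t) \<mu>"
  by (rule palm_pair.palm_eq[OF palm_pair_clustering[OF strict]])

lemma weakly_converges_palm:
  "weakly_converges (\<lambda>t. palm (clustering_law P t)) (palm (from_palm limit_palm))"
  unfolding weakly_converges_def palm_clustering palm_law_eq
    trans[OF palm_pair.palm_eq[OF palm_pair_limit] limit_palm_eq]
proof (intro allI impI)
  fix f :: "(int \<Rightarrow> real) \<Rightarrow> real"
  assume f: "continuous_on UNIV f" "bounded (range f)"
  have mf [measurable]: "f \<in> borel_measurable borel" by (rule borel_measurable_continuous_onI[OF f(1)])
  note [measurable] = measurable_backward_start measurable_limit_points_fst
  obtain B where B: "\<And>x. norm (f x) \<le> B" using f(2) by (auto simp: bounded_iff)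
  have "(\<lambda>t. \<integral>p. f (backward t (fst p) (snd p)) \<partial>\<Omega>) \<longlonglongrightarrow> (\<integral>p. f (limit_points (fst p)) \<partial>\<Omega>)"
  proof (rule integral_dominated_convergence[where w = "\<lambda>_. B"])
    show "AE p in \<Omega>. (\<lambda>t. f (backward t (fst p) (snd p))) \<longlonglongrightarrow> f (limit_points (fst p))"
      using AE_coupled_convergence by eventually_elim (intro continuous_tendsto_fun[OF f(1)], simp)
  qed (use B in simp_all)
  then show "(\<lambda>t. integral\<^sup>L (distr \<Omega> borel (\<lambda>p. backward t (fst p) (snd p))) f) \<longlonglongrightarrow>
    integral\<^sup>L (distr \<Omega> borel (\<lambda>p. limit_points (fst p))) f"
    unfolding integral_distr[OF measurable_backward_start mf] integral_distr[OF measurable_limit_points_fst mf] .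
qed

text \<open>
  Here F depends on the position of the origin and may jump when a point passes one of the places in R.
  With the place of the origin as a further integration variable this is harmless: for all
  but countably many places no point of the limit falls on R.
\<close>

lemma integral_clustering_tendsto:
  fixes F :: "(int \<Rightarrow> real) \<Rightarrow> real"
  assumes [measurable]: "F \<in> borel_measurable borel" and B: "\<And>x. \<bar>F x\<bar> \<le> B" and R: "countable R"
    and cont: "\<And>z z'. (\<And>k. (\<lambda>t. z t k) \<longlonglongrightarrow> z' k) \<Longrightarrow> (\<And>t. mono (z t)) \<Longrightarrow> two_sided z' \<Longrightarrow>
      z' 0 < 0 \<Longrightarrow> 0 < z' 1 \<Longrightarrow> (\<And>r k. r \<in> R \<Longrightarrow> z' k \<noteq> r) \<Longrightarrow> (\<lambda>t. F (z t)) \<longlonglongrightarrow> F z'"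
  shows "(\<lambda>t. \<integral>x. F x \<partial>clustering_law P t) \<longlonglongrightarrow> (\<integral>x. F x \<partial>from_palm limit_palm)"
proof -
  interpret OL: pair_sigma_finite \<Omega> lborel by unfold_locales
  let ?X = "\<lambda>t p. backward t (fst p) (snd p)" and ?Y = "\<lambda>p. limit_points (fst p)"
  let ?u = "\<lambda>X w. indicator {w. 0 \<le> snd w \<and> snd w < X (fst w) 1} w * F (translate (- snd w) (X (fst w))) :: real"
  let ?W = "\<lambda>p. enn2real (gap_bound p)"
  let ?w = "\<lambda>w. B * indicator {w. 0 \<le> snd w \<and> snd w \<le> ?W (fst w)} w"
  have um [measurable]: "?u X \<in> borel_measurable (\<Omega> \<Otimes>\<^sub>M lborel)" if [measurable]: "X \<in> borel_measurable \<Omega>" for X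
  proof -
    have [measurable]: "(\<lambda>w. X (fst w)) \<in> borel_measurable (\<Omega> \<Otimes>\<^sub>M lborel)" by measurable
    note [measurable] = measurable_point[OF this]
    show ?thesis by measurable
  qed
  note mX = um[OF measurable_backward_start] and mY = um[OF measurable_limit_points_fst]
  have [measurable]: "gap_bound \<in> borel_measurable \<Omega>" by (rule measurable_gap_bound)
  have mw [measurable]: "?w \<in> borel_measurable (\<Omega> \<Otimes>\<^sub>M lborel)" by measurable
  have meas_bound: "{w \<in> space (\<Omega> \<Otimes>\<^sub>M lborel). norm (?u (?X t) w) \<le> ?w w} \<in> sets (\<Omega> \<Otimes>\<^sub>M lborel)" for t
    by (rule borel_measurable_le[OF measurable_compose[OF mX borel_measurable_norm] mw])
  have meas_lim: "{w \<in> space (\<Omega> \<Otimes>\<^sub>M lborel). (\<lambda>t. ?u (?X t) w - ?u ?Y w) \<longlonglongrightarrow> 0} \<in> sets (\<Omega> \<Otimes>\<^sub>M lborel)"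
    using measurable_limit[where c = "0 :: real", OF borel_measurable_diff[OF mX mY]] by (simp only: pred_def)
  have B0: "0 \<le> B" using B[of undefined] by simp
  have P: "clustering_law P t = from_palm (distr \<Omega> borel (?X t))" for t
    using palm_pair.eq_from_palm[OF palm_pair_clustering[OF strict]] by (simp add: palm_law_eq)
  have "(\<lambda>t. \<integral>w. ?u (?X t) w \<partial>(\<Omega> \<Otimes>\<^sub>M lborel)) \<longlonglongrightarrow> (\<integral>w. ?u ?Y w \<partial>(\<Omega> \<Otimes>\<^sub>M lborel))"
  proof (rule integral_dominated_convergence[where w = ?w])
    show "integrable (\<Omega> \<Otimes>\<^sub>M lborel) ?w"
    proof (rule integrableI_bounded)
      have "(\<integral>\<^sup>+w. ennreal (norm (?w w)) \<partial>(\<Omega> \<Otimes>\<^sub>M lborel)) = (\<integral>\<^sup>+p. \<integral>\<^sup>+s. ennreal (norm (?w (p, s))) \<partial>lborel \<partial>\<Omega>)"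
        by (rule lborel.nn_integral_fst[symmetric]) measurable
      also have "\<dots> = (\<integral>\<^sup>+p. ennreal B * ennreal (?W p) \<partial>\<Omega>)"
      proof (rule nn_integral_cong)
        fix p
        have "(\<integral>\<^sup>+s. ennreal (norm (?w (p, s))) \<partial>lborel) = (\<integral>\<^sup>+s. ennreal B * indicator {0..?W p} s \<partial>lborel)"
          using B0 by (intro nn_integral_cong) (auto simp: indicator_def)
        then show "(\<integral>\<^sup>+s. ennreal (norm (?w (p, s))) \<partial>lborel) = ennreal B * ennreal (?W p)"
          by (simp add: nn_integral_cmult)
      qed
      also have "\<dots> \<le> (\<integral>\<^sup>+p. ennreal B * gap_bound p \<partial>\<Omega>)"
        by (intro nn_integral_mono mult_left_mono) (auto simp: ennreal_enn2real_if)
      also have "\<dots> = ennreal B * (\<integral>\<^sup>+p. gap_bound p \<partial>\<Omega>)" by (rule nn_integral_cmult) measurable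
      also have "\<dots> < \<infinity>" using mean_gap_bound by (simp add: ennreal_mult_less_top)
      finally show "(\<integral>\<^sup>+w. ennreal (norm (?w w)) \<partial>(\<Omega> \<Otimes>\<^sub>M lborel)) < \<infinity>" .
    qed measurable
    show "AE w in \<Omega> \<Otimes>\<^sub>M lborel. norm (?u (?X t) w) \<le> ?w w" for t
    proof (rule OL.AE_pair_measure)
      show "AE p in \<Omega>. AE s in lborel. norm (?u (?X t) (p, s)) \<le> ?w (p, s)"
        using AE_coupled_convergence
      proof eventually_elim
        case (elim p)
        then have "?X t p 1 \<le> ?W p" by simp
        then have "norm (?u (?X t) (p, s)) \<le> ?w (p, s)" for s
          using B[of "translate (- s) (?X t p)"] B0
          by (cases "0 \<le> s \<and> s < ?X t p 1"; cases "0 \<le> s \<and> s \<le> ?W p") simp_all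
        then show ?case by (intro AE_I2)
      qed
    qed (rule meas_bound)
    have "AE w in \<Omega> \<Otimes>\<^sub>M lborel. (\<lambda>t. ?u (?X t) w - ?u ?Y w) \<longlonglongrightarrow> 0"
    proof (rule OL.AE_pair_measure)
      show "AE p in \<Omega>. AE s in lborel. (\<lambda>t. ?u (?X t) (p, s) - ?u ?Y (p, s)) \<longlonglongrightarrow> 0"
        using AE_coupled_convergence
      proof eventually_elim
        case (elim p)
        \<comment> \<open>The excluded places of the origin: the end points of its gap, and those that put a point on R.\<close>
        let ?C = "insert (?Y p 1) (insert 0 ((\<lambda>(r, k). ?Y p k - r) ` (R \<times> UNIV)))"
        have lim: "(\<lambda>t. ?X t p k) \<longlonglongrightarrow> ?Y p k" for k using elim by simp
        have "countable ?C" using R by auto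
        then have "AE s in lborel. s \<notin> ?C"
          by (rule AE_not_in[OF countable_imp_null_set_lborel])
        then show ?case
        proof eventually_elim
          case C: (elim s)
          have "(\<lambda>t. ?u (?X t) (p, s)) \<longlonglongrightarrow> ?u ?Y (p, s)"
          proof (cases "0 < s \<and> s < ?Y p 1")
            case True
            have "(\<lambda>t. F (translate (- s) (?X t p))) \<longlonglongrightarrow> F (translate (- s) (?Y p))"
            proof (rule cont)
              show "(\<lambda>t. translate (- s) (?X t p) k) \<longlonglongrightarrow> translate (- s) (?Y p) k" for k
                unfolding translate_apply by (intro tendsto_intros lim)
              show "mono (translate (- s) (?X t p))" for t
                using elim by (auto simp: mono_def translate_def)
              show "two_sided (translate (- s) (?Y p))" using elim by (simp add: two_sided_translate)
              show "translate (- s) (?Y p) 0 < 0" "0 < translate (- s) (?Y p) 1"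
                using True elim by (simp_all add: translate_apply)
              show "translate (- s) (?Y p) k \<noteq> r" if "r \<in> R" for r k
              proof
                assume "translate (- s) (?Y p) k = r"
                then have "s = ?Y p k - r" by (simp add: translate_apply)
                then show False using C that by force
              qed
            qed
            moreover have "eventually (\<lambda>t. s < ?X t p 1) sequentially"
              using order_tendstoD(1)[OF lim] True by blast
            then have "eventually (\<lambda>t. F (translate (- s) (?X t p)) = ?u (?X t) (p, s)) sequentially"
              by eventually_elim (use True in simp)
            ultimately have "(\<lambda>t. ?u (?X t) (p, s)) \<longlonglongrightarrow> F (translate (- s) (?Y p))"
              by (rule Lim_transform_eventually)
            then show ?thesis using True by simp
          next
            case False
            then consider "s < 0" | "?Y p 1 < s" using C by fastforce
            then show ?thesis
            proof cases
              case 1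
              then show ?thesis by simp
            next
              case 2
              then have "eventually (\<lambda>t. ?X t p 1 < s) sequentially"
                using order_tendstoD(2)[OF lim] by blast
              then have "eventually (\<lambda>t. ?u (?X t) (p, s) = ?u ?Y (p, s)) sequentially"
                by eventually_elim (use 2 in simp)
              then show ?thesis by (rule tendsto_eventually)
            qed
          qed
          then show ?case by (rule LIM_zero)
        qed
      qed
    qed (rule meas_lim)
    then show "AE w in \<Omega> \<Otimes>\<^sub>M lborel. (\<lambda>t. ?u (?X t) w) \<longlonglongrightarrow> ?u ?Y w"
      by eventually_elim (rule LIM_zero_cancel)
  qed (rule mX mY)+
  then show ?thesis
    unfolding P limit_palm_eq
    by (simp only: integral_from_palm_distr[OF measurable_backward_start assms(1)] integral_from_palm_distr[OF measurable_limit_points_fst assms(1)])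
qed

end

lemma counting_eq:
  assumes z: "mono z" "z 0 \<le> 0" "0 < z 1" and k: "z k \<le> r" "r < z (k + 1)"
  shows "counting r z = of_int k"
proof (cases "0 \<le> r")
  case True
  have "0 \<le> k"
  proof (rule ccontr)
    assume "\<not> 0 \<le> k"
    then have "z (k + 1) \<le> z 0" using monoD[OF z(1), of "k + 1" 0] by simp
    then show False using k z True by simp
  qed
  have mem: "z i \<in> {0<..r} \<longleftrightarrow> i \<in> {1..k}" for i
    using monoD[OF z(1), of i 0] monoD[OF z(1), of 1 i] monoD[OF z(1), of i k] monoD[OF z(1), of "k + 1" i] z k
    by (cases "i \<le> 0"; cases "i \<le> k") auto
  have "{i. z i \<in> {0<..r}} = {1..k}" unfolding mem by (rule Collect_mem_eq)
  then have "npoints {0<..r} z = of_nat (nat k)" by (simp add: npoints_def)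
  then show ?thesis using True \<open>0 \<le> k\<close> by (simp add: counting_def)
next
  case False
  have "k \<le> 0"
  proof (rule ccontr)
    assume "\<not> k \<le> 0"
    then have "z 1 \<le> z k" using monoD[OF z(1), of 1 k] by simp
    then show False using k z False by simp
  qed
  have mem: "z i \<in> {r<..0} \<longleftrightarrow> i \<in> {k + 1..0}" for i
    using monoD[OF z(1), of i 0] monoD[OF z(1), of 1 i] monoD[OF z(1), of i k] monoD[OF z(1), of "k + 1" i] z k
    by (cases "i \<le> 0"; cases "i \<le> k") auto
  have "{i. z i \<in> {r<..0}} = {k + 1..0}" unfolding mem by (rule Collect_mem_eq)
  then have "npoints {r<..0} z = of_nat (nat (- k))" by (simp add: npoints_def)
  then show ?thesis using False \<open>k \<le> 0\<close> by (simp add: counting_def)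
qed

text \<open>
  If no point of the limit sits at r, the number of points up to r is eventually constant.
\<close>

lemma counting_tendsto:
  assumes lim: "\<And>k. (\<lambda>t. z t k) \<longlonglongrightarrow> z' k" and mono: "\<And>t. mono (z t)" and two: "two_sided z'"
    and pos: "z' 0 < 0" "0 < z' 1" and r: "\<And>k. z' k \<noteq> r"
  shows "(\<lambda>t. counting r (z t)) \<longlonglongrightarrow> counting r z'"
proof -
  obtain k where k: "z' k \<le> r" "r < z' (k + 1)"
    using ex1_implies_ex[OF two_sided_ex1_crossing[OF two, of r]] by auto
  then have "z' k < r" using r[of k] by simp
  have "eventually (\<lambda>t. z t k < r) sequentially" "eventually (\<lambda>t. r < z t (k + 1)) sequentially"
    "eventually (\<lambda>t. z t 0 < 0) sequentially" "eventually (\<lambda>t. 0 < z t 1) sequentially"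
    using order_tendstoD[OF lim] \<open>z' k < r\<close> k(2) pos by blast+
  then have "eventually (\<lambda>t. counting r (z t) = counting r z') sequentially"
  proof eventually_elim
    case (elim t)
    have "counting r (z t) = of_int k" by (rule counting_eq[OF mono]) (use elim in simp_all)
    moreover have "counting r z' = of_int k"
      by (rule counting_eq[OF two_sidedD(1)[OF two]]) (use k pos in simp_all)
    ultimately show ?case by simp
  qed
  then show ?thesis by (rule tendsto_eventually)
qed

lemma measurable_counting [measurable]: "counting r \<in> borel_measurable borel"
proof -
  have "(\<lambda>x. npoints B x) \<in> borel_measurable borel" if "B \<in> sets borel" for B
    by (rule measurable_npoints) (simp_all add: that)
  then show ?thesis
    unfolding counting_def[abs_def] by (cases "0 \<le> r") simp_all
qed

lemma (in clustering_start) fdd_converges_clustering: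
  "fdd_converges (clustering_law P) (from_palm limit_palm)"
proof -
  have sets_law: "sets (clustering_law P t) = sets borel" "sets (from_palm limit_palm) = sets borel" for t
    by (simp_all add: clustering_law_def from_palm_def)
  have weak: "weakly_converges (\<lambda>t. distr (clustering_law P t) borel G) (distr (from_palm limit_palm) borel G)"
    if G [measurable]: "G \<in> borel_measurable borel" and R: "countable R"
    and cont: "\<And>z z' i. (\<And>k. (\<lambda>t. z t k) \<longlonglongrightarrow> z' k) \<Longrightarrow> (\<And>t. mono (z t)) \<Longrightarrow> two_sided z' \<Longrightarrow>
      z' 0 < 0 \<Longrightarrow> 0 < z' 1 \<Longrightarrow> (\<And>r k. r \<in> R \<Longrightarrow> z' k \<noteq> r) \<Longrightarrow> (\<lambda>t. G (z t) i) \<longlonglongrightarrow> G z' i"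
    for G :: "(int \<Rightarrow> real) \<Rightarrow> 'i::countable \<Rightarrow> real" and R
    unfolding weakly_converges_def
  proof (intro allI impI)
    fix f :: "('i \<Rightarrow> real) \<Rightarrow> real"
    assume f: "continuous_on UNIV f" "bounded (range f)"
    have [measurable]: "f \<in> borel_measurable borel" by (rule borel_measurable_continuous_onI[OF f(1)])
    obtain B where B: "\<And>x. \<bar>f x\<bar> \<le> B" using f(2) by (auto simp: bounded_iff)
    have "(\<lambda>t. \<integral>x. f (G x) \<partial>clustering_law P t) \<longlonglongrightarrow> (\<integral>x. f (G x) \<partial>from_palm limit_palm)"
    proof (rule integral_clustering_tendsto[OF _ B R])
      show "(\<lambda>t. f (G (z t))) \<longlonglongrightarrow> f (G z')"
        if "\<And>k. (\<lambda>t. z t k) \<longlonglongrightarrow> z' k" "\<And>t. mono (z t)" "two_sided z'" "z' 0 < 0" "0 < z' 1"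
          "\<And>r k. r \<in> R \<Longrightarrow> z' k \<noteq> r" for z z'
        by (rule continuous_tendsto_fun[OF f(1)]) (rule cont[OF that])
    qed measurable
    then show "(\<lambda>t. integral\<^sup>L (distr (clustering_law P t) borel G) f) \<longlonglongrightarrow> integral\<^sup>L (distr (from_palm limit_palm) borel G) f"
      by (simp add: integral_distr sets_law cong: measurable_cong_sets)
  qed
  show ?thesis
    unfolding fdd_converges_def
  proof (intro conjI allI impI)
    fix I :: "int set"
    show "weakly_converges (\<lambda>t. distr (clustering_law P t) borel (\<lambda>x. restrict x I)) (distr (from_palm limit_palm) borel (\<lambda>x. restrict x I))"
    proof (rule weak[OF _ countable_empty])
      show "(\<lambda>x :: int \<Rightarrow> real. restrict x I) \<in> borel_measurable borel"
      proof (rule measurable_coordinatewise_then_product)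
        fix i
        show "(\<lambda>x :: int \<Rightarrow> real. restrict x I i) \<in> borel_measurable borel"
          by (cases "i \<in> I") simp_all
      qed
      show "(\<lambda>t. restrict (z t) I i) \<longlonglongrightarrow> restrict z' I i"
        if "\<And>k. (\<lambda>t. z t k) \<longlonglongrightarrow> z' k" for z z' i
        using that by (simp add: restrict_def)
    qed
  next
    fix s :: "nat \<Rightarrow> real" and k :: nat
    show "weakly_converges (\<lambda>t. distr (clustering_law P t) borel (\<lambda>x. \<lambda>j\<in>{..<k}. counting (s j) x))
      (distr (from_palm limit_palm) borel (\<lambda>x. \<lambda>j\<in>{..<k}. counting (s j) x))"
    proof (rule weak[OF _ countable_image[OF countableI_type, of s]])
      show "(\<lambda>x. \<lambda>j\<in>{..<k}. counting (s j) x) \<in> borel_measurable borel"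
      proof (rule measurable_coordinatewise_then_product)
        fix i
        show "(\<lambda>x. (\<lambda>j\<in>{..<k}. counting (s j) x) i) \<in> borel_measurable borel"
          by (cases "i < k") simp_all
      qed
      show "(\<lambda>t. (\<lambda>j\<in>{..<k}. counting (s j) (z t)) i) \<longlonglongrightarrow> (\<lambda>j\<in>{..<k}. counting (s j) z') i"
        if "\<And>k. (\<lambda>t. z t k) \<longlonglongrightarrow> z' k" "\<And>t. mono (z t)" "two_sided z'" "z' 0 < 0" "0 < z' 1"
          "\<And>r k. r \<in> range s \<Longrightarrow> z' k \<noteq> r" for z z' i
        using counting_tendsto[OF that(1-5), of "s i"] that(6)[of "s i"] by (simp add: restrict_def)
    qed
  qed
qed

lemma clustering_start_renewal:
  assumes "point_process P" "stationary P" "has_intensity P 1" "renewal P" "integrable (palm P) (\<lambda>x. (gap 0 x)\<^sup>2)"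
  obtains K where "clustering_start P (palm P) K"
proof -
  have S: "stationary_simple P"
    using assms by (simp add: stationary_simple_def stationary_simple_axioms_def point_process_def renewal_def)
  obtain K where K: "0 \<le> K" "\<And>j k. (\<integral>\<^sup>+x. ennreal (((x k - of_int k) - (x j - of_int j))\<^sup>2) \<partial>palm P) \<le> ennreal (K * \<bar>of_int k - of_int j\<bar>)"
    using renewal_deviation[OF S assms(4,5)] by blast
  show thesis
    by (rule that[of K], intro clustering_start.intro clustering_start_axioms.intro)
       (fact stationary_simple.palm_pair_palm[OF S] stationary_simple.AE_strict_mono[OF S] K)+
qed

theorem theorem3p1:
  shows "\<exists>Q :: (int \<Rightarrow> real) measure.
    point_process Q \<and> stationary Q \<and> has_intensity Q 1 \<and>
    (\<forall>P. point_process P \<longrightarrow> stationary P \<longrightarrow> has_intensity P 1 \<longrightarrow> renewal P \<longrightarrow>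
       integrable (palm P) (\<lambda>x. (gap 0 x)\<^sup>2) \<longrightarrow>
       fdd_converges (clustering_law P) Q \<and>
       weakly_converges (\<lambda>t. palm (clustering_law P t)) (palm Q)) \<and>
    exponential_tail (palm Q) (gap 0)"
proof (intro exI[of _ "from_palm limit_palm"] conjI allI impI)
  interpret limit: palm_pair "from_palm limit_palm" limit_palm by (rule palm_pair_limit)
  show "point_process (from_palm limit_palm)" by (rule limit.point_process)
  show "stationary (from_palm limit_palm)" by (rule limit.stationary)
  show "has_intensity (from_palm limit_palm) 1" by (rule limit.has_intensity_1)
  show "exponential_tail (palm (from_palm limit_palm)) (gap 0)"
    unfolding limit.palm_eq by (rule exponential_tail_limit)
  fix P :: "(int \<Rightarrow> real) measure"
  assume P: "point_process P" "stationary P" "has_intensity P 1" "renewal P" "integrable (palm P) (\<lambda>x. (gap 0 x)\<^sup>2)"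
  obtain K where "clustering_start P (palm P) K" by (rule clustering_start_renewal[OF P])
  then interpret clustering_start P "palm P" K .
  show "fdd_converges (clustering_law P) (from_palm limit_palm)" by (rule fdd_converges_clustering)
  show "weakly_converges (\<lambda>t. palm (clustering_law P t)) (palm (from_palm limit_palm))"
    by (rule weakly_converges_palm)
qed

end
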